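(* Let $\mathbf T=(T_1,\ldots,T_k)$ be an element of the regular polyball $\mathbf B_{\mathbf n}(\mathcal H)$, $\mathbf n=(n_1,\ldots,n_k)\in\mathbb N^k$, with trace class defect, and let $\Phi_{T_1},\ldots,\Phi_{T_k}$ be the associated completely positive maps. Then the curvature of $\mathbf T$ satisfies the asymptotic formulas $$\mathrm{curv}(\mathbf T)=\lim_{m\to\infty}\frac1{\binom{m+k}{k}}\sum_{\substack{q_1\ge0,\ldots,q_k\ge0\\ q_1+\cdots+q_k\le m}}\frac{1}{n_1^{q_1}\cdots n_k^{q_k}}\mathrm{trace}\left[\Phi_{T_1}^{q_1}\circ\cdots\circ\Phi_{T_k}^{q_k}(\mathbf\Delta_{\mathbf T}(I))\right]$$ $$=\lim_{m\to\infty}\frac1{\binom{m+k-1}{k-1}}\sum_{\substack{q_1\ge0,\ldots,q_k\ge0\\ q_1+\cdots+q_k=m}}\frac{1}{n_1^{q_1}\cdots n_k^{q_k}}\mathrm{trace}\left[\Phi_{T_1}^{q_1}\circ\cdots\circ\Phi_{T_k}^{q_k}(\mathbf\Delta_{\mathbf T}(I))\right]$$ $$=\lim_{q_1\to\infty}\cdots\lim_{q_k\to\infty}\frac{\mathrm{trace}\left[(id-\Phi_{T_1}^{q_1+1})\circ\cdots\circ(id-\Phi_{T_k}^{q_k+1})(I)\right]}{\prod_{i=1}^k(1+n_i+\cdots+n_i^{q_i})}$$ $$=\lim_{(q_1,\ldots,q_k)\in\mathbb Z_+^k}\frac1{n_1^{q_1}\cdots n_k^{q_k}}\mathrm{trace}\left[\Phi_{T_1}^{q_1}\circ\cdots\circ\Phi_{T_k}^{q_k}(\mathbf\Delta_{\mathbf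 T}(I))\right].$$
   Context: All Hilbert spaces are complex; $\mathbb N=\{1,2,\ldots\}$, $\mathbb Z_+=\{0,1,\ldots\}$. For $X_i=(X_{i,1},\ldots,X_{i,n_i})\in B(\mathcal H)^{n_i}$ let $\Phi_{X_i}(Y)=\sum_{j=1}^{n_i}X_{i,j}YX_{i,j}^*$ for $Y\in B(\mathcal H)$. The regular polyball $\mathbf B_{\mathbf n}(\mathcal H)$ is the set of all $\mathbf X=(X_1,\ldots,X_k)$ with $X_i\in B(\mathcal H)^{n_i}$ such that every entry of $X_s$ commutes with every entry of $X_t$ whenever $s\ne t$ (entries of the same $X_s$ need not commute) and $(id-\Phi_{X_1})^{p_1}\circ\cdots\circ(id-\Phi_{X_k})^{p_k}(I)\ge0$ for all $(p_1,\ldots,p_k)\in\{0,1\}^k$. Put $\mathbf\Delta_{\mathbf X}=(id-\Phi_{X_1})\circ\cdots\circ(id-\Phi_{X_k})$. $\mathbf T\in\mathbf B_{\mathbf n}(\mathcal H)$ has trace class defect if $\mathbf\Delta_{\mathbf T}(I)$ is a trace class operator. Put $\mathcal D_{\mathbf T}=\overline{\mathbf\Delta_{\mathbf T}(I)\mathcal H}$. $F^2(H_{n_i})=\mathbb C1\oplus\bigoplus_{p\ge1}H_{n_i}^{\otimes p}$ is the full Fock space of an $n_i$-dimensional Hilbert space $H_{n_i}$ with orthonormal basis $e^i_1,\ldots,e^i_{n_i}$. $\mathbb F_{n_i}^+$ is the free unital semigroup on $n_i$ generators $g_1^i,\ldots,g_{n_i}^i$ with length $|\cdot|$; for $\alpha=g^i_{j_1}\cdots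 g^i_{j_p}$ put $e^i_\alpha=e^i_{j_1}\otimes\cdots\otimes e^i_{j_p}$ and $T_{i,\alpha}=T_{i,j_1}\cdots T_{i,j_p}$, while for the neutral element $e^i_\alpha=1$ and $T_{i,\alpha}=I$. The Berezin kernel of $\mathbf T$ is $\mathbf K_{\mathbf T}:\mathcal H\to F^2(H_{n_1})\otimes\cdots\otimes F^2(H_{n_k})\otimes\mathcal D_{\mathbf T}$, $$\mathbf K_{\mathbf T}h=\sum_{\beta_i\in\mathbb F_{n_i}^+,\,i=1,\ldots,k}e^1_{\beta_1}\otimes\cdots\otimes e^k_{\beta_k}\otimes\mathbf\Delta_{\mathbf T}(I)^{1/2}T_{1,\beta_1}^*\cdots T_{k,\beta_k}^*h.$$ $P^{(i)}_q$ is the orthogonal projection of $F^2(H_{n_i})$ onto the span of all $e^i_\alpha$ with $|\alpha|=q$. The curvature of $\mathbf T$ with trace class defect is $$\mathrm{curv}(\mathbf T):=\lim_{m\to\infty}\frac1{\binom{m+k}{k}}\sum_{\substack{q_1\ge0,\ldots,q_k\ge0\\ q_1+\cdots+q_k\le m}}\frac{\mathrm{trace}\left[\mathbf K_{\mathbf T}^*(P^{(1)}_{q_1}\otimes\cdots\otimes P^{(k)}_{q_k}\otimes I_{\mathcal D_{\mathbf T}})\mathbf K_{\mathbf T}\right]}{\mathrm{trace}\left[P^{(1)}_{q_1}\otimes\cdots\otimes P^{(k)}_{q_k}\right]}$$ (this limit exists). Limits over $\mathbb Z_+^k$ are limits of nets, $\mathbb Z_+^k$ being directed by the coordinatewise order.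 *)

theory Defs
  imports "HOL-Analysis.Analysis"
begin

section \<open>Complex Hilbert spaces\<close>

text \<open>The inner product is linear in the first argument. The real inner product space underlying
  a complex Hilbert space carries the real part of the complex inner product, so that the norm,
  the topology and completeness are those of the library.\<close>

class complex_hilbert_space = real_inner + complete_space +
  fixes scaleC :: "complex \<Rightarrow> 'a \<Rightarrow> 'a" (infixr \<open>*\<^sub>C\<close> 75)
    and cinner :: "'a \<Rightarrow> 'a \<Rightarrow> complex"
  assumes scaleC_add_right: "a *\<^sub>C (x + y) = a *\<^sub>C x + a *\<^sub>C y"
    and scaleC_add_left: "(a + b) *\<^sub>C x = a *\<^sub>C x + b *\<^sub>C x"
    and scaleC_scaleC: "a *\<^sub>C b *\<^sub>C x = (a * b) *\<^sub>C x"
    and scaleR_scaleC: "r *\<^sub>R x = complex_of_real r *\<^sub>C x"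
    and cinner_commute: "cinner x y = cnj (cinner y x)"
    and cinner_add_left: "cinner (x + y) z = cinner x z + cinner y z"
    and cinner_scaleC_left: "cinner (a *\<^sub>C x) y = a * cinner x y"
    and inner_eq_Re_cinner: "inner x y = Re (cinner x y)"

lemma cinner_self: "cinner x x = complex_of_real ((norm x)\<^sup>2)"
proof -
  have "Im (cinner x x) = 0"
    using cinner_commute[of x x] by (metis Im_complex_of_real Reals_cnj_iff complex_is_Real_iff)
  then show ?thesis
    by (simp add: complex_eq_iff dot_square_norm[symmetric] inner_eq_Re_cinner)
qed

lemma norm_scaleC: "norm (a *\<^sub>C x) = cmod a * norm x"
proof -
  have "cinner (a *\<^sub>C x) (a *\<^sub>C x) = a * cnj a * cinner x x"
    by (metis cinner_commute cinner_scaleC_left complex_cnj_mult mult.assoc)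
  then have "complex_of_real ((norm (a *\<^sub>C x))\<^sup>2) = complex_of_real ((cmod a * norm x)\<^sup>2)"
    by (simp add: cinner_self power_mult_distrib flip: complex_norm_square)
  then have "(norm (a *\<^sub>C x))\<^sup>2 = (cmod a * norm x)\<^sup>2"
    by (simp only: of_real_eq_iff)
  then show ?thesis
    by (simp add: power2_eq_iff_nonneg)
qed

lemma cmod_cinner_le: "cmod (cinner x y) \<le> norm x * norm y"
proof (cases "cinner x y = 0")
  case False
  define c where "c = cnj (cinner x y) / cmod (cinner x y)"
  have c: "cmod c = 1"
    using False by (simp add: c_def norm_divide)
  have "c * cinner x y = complex_of_real (cmod (cinner x y))"
    using False by (simp add: c_def complex_norm_square[symmetric] power2_eq_square mult.commute[of "cnj _"])
  then have "cmod (cinner x y) = inner (c *\<^sub>C x) y"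
    by (simp add: inner_eq_Re_cinner cinner_scaleC_left)
  also have "\<dots> \<le> norm (c *\<^sub>C x) * norm y"
    by (rule norm_cauchy_schwarz)
  finally show ?thesis
    by (simp add: norm_scaleC c)
qed simp

instantiation complex :: complex_hilbert_space
begin

definition scaleC_complex :: "complex \<Rightarrow> complex \<Rightarrow> complex"
  where "scaleC_complex a x = a * x"

definition cinner_complex :: "complex \<Rightarrow> complex \<Rightarrow> complex"
  where "cinner_complex x y = x * cnj y"

instance
  by standard
    (auto simp: scaleC_complex_def cinner_complex_def algebra_simps scaleR_conv_of_real
      inner_complex_def)

end


section \<open>Square-summable families\<close>

text \<open>The Hilbert space of all square-summable families of elements of \<open>'a\<close> indexed by \<open>'i\<close>.\<close>

typedef (overloaded) ('i, 'a) l2 =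
  "{f :: 'i \<Rightarrow> 'a::complex_hilbert_space. (\<lambda>i. (norm (f i))\<^sup>2) summable_on UNIV}"
  morphisms l2_apply Abs_l2
  by (rule exI[of _ "\<lambda>_. 0"]) simp

setup_lifting type_definition_l2

lemma norm_add_square_le:
  fixes x y :: "'a::real_inner"
  shows "(norm (x + y))\<^sup>2 \<le> 2 * (norm x)\<^sup>2 + 2 * (norm y)\<^sup>2"
  using zero_le_power2[of "norm (x - y)"]
  unfolding power2_norm_eq_inner by (simp add: inner_simps inner_commute)

lemma l2_add_aux:
  fixes f g :: "'i \<Rightarrow> 'a::real_inner"
  assumes "(\<lambda>i. (norm (f i))\<^sup>2) summable_on UNIV" "(\<lambda>i. (norm (g i))\<^sup>2) summable_on UNIV"
  shows "(\<lambda>i. (norm (f i + g i))\<^sup>2) summable_on UNIV"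
proof (rule summable_on_comparison_test)
  show "(\<lambda>i. 2 * (norm (f i))\<^sup>2 + 2 * (norm (g i))\<^sup>2) summable_on UNIV"
    by (intro summable_on_add summable_on_cmult_right assms)
qed (auto simp: norm_add_square_le)

instantiation l2 :: (type, complex_hilbert_space) real_vector
begin

lift_definition zero_l2 :: "('a, 'b) l2" is "\<lambda>_. 0"
  by simp

lift_definition plus_l2 :: "('a, 'b) l2 \<Rightarrow> ('a, 'b) l2 \<Rightarrow> ('a, 'b) l2" is "\<lambda>f g i. f i + g i"
  by (rule l2_add_aux)

lift_definition uminus_l2 :: "('a, 'b) l2 \<Rightarrow> ('a, 'b) l2" is "\<lambda>f i. - f i"
  by simp

lift_definition minus_l2 :: "('a, 'b) l2 \<Rightarrow> ('a, 'b) l2 \<Rightarrow> ('a, 'b) l2" is "\<lambda>f g i. f i - g i"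
  subgoal for f g using l2_add_aux[of f "\<lambda>i. - g i"] by simp
  done

lift_definition scaleR_l2 :: "real \<Rightarrow> ('a, 'b) l2 \<Rightarrow> ('a, 'b) l2" is "\<lambda>r f i. r *\<^sub>R f i"
  by (simp add: power_mult_distrib summable_on_cmult_right)

instance
  by standard (transfer; simp add: algebra_simps)+

end

lemma l2_summable_cinner:
  fixes f g :: "'i \<Rightarrow> 'a::complex_hilbert_space"
  assumes "(\<lambda>i. (norm (f i))\<^sup>2) summable_on UNIV" "(\<lambda>i. (norm (g i))\<^sup>2) summable_on UNIV"
  shows "(\<lambda>i. cinner (f i) (g i)) summable_on UNIV"
proof -
  have "(\<lambda>i. norm (norm (f i) * norm (g i))) summable_on UNIV"
    by (rule abs_summable_product) (use assms in \<open>simp_all add: power2_eq_square\<close>)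
  then have "(\<lambda>i. norm (cinner (f i) (g i))) summable_on UNIV"
    by (rule Infinite_Sum.abs_summable_on_comparison_test) (simp add: cmod_cinner_le)
  then show ?thesis
    by (rule abs_summable_summable)
qed

lemma l2_summable_inner:
  fixes f g :: "'i \<Rightarrow> 'a::complex_hilbert_space"
  assumes "(\<lambda>i. (norm (f i))\<^sup>2) summable_on UNIV" "(\<lambda>i. (norm (g i))\<^sup>2) summable_on UNIV"
  shows "(\<lambda>i. inner (f i) (g i)) summable_on UNIV"
  unfolding inner_eq_Re_cinner
  by (rule summable_on_Re[OF l2_summable_cinner[OF assms]])

instantiation l2 :: (type, complex_hilbert_space) real_inner
begin

lift_definition inner_l2 :: "('a, 'b) l2 \<Rightarrow> ('a, 'b) l2 \<Rightarrow> real"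
  is "\<lambda>f g. \<Sum>\<^sub>\<infinity>i. inner (f i) (g i)" .

definition norm_l2 :: "('a, 'b) l2 \<Rightarrow> real"
  where "norm_l2 x = sqrt (inner x x)"

definition sgn_l2 :: "('a, 'b) l2 \<Rightarrow> ('a, 'b) l2"
  where "sgn_l2 x = x /\<^sub>R norm x"

definition dist_l2 :: "('a, 'b) l2 \<Rightarrow> ('a, 'b) l2 \<Rightarrow> real"
  where "dist_l2 x y = norm (x - y)"

definition uniformity_l2 :: "(('a, 'b) l2 \<times> ('a, 'b) l2) filter"
  where "uniformity_l2 = (INF e\<in>{0<..}. principal {(x, y). dist x y < e})"

definition open_l2 :: "('a, 'b) l2 set \<Rightarrow> bool"
  where "open_l2 U \<longleftrightarrow> (\<forall>x\<in>U. eventually (\<lambda>(x', y). x' = x \<longrightarrow> y \<in> U) uniformity)"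

instance
proof
  fix x y z :: "('a, 'b) l2" and r :: real and U :: "('a, 'b) l2 set"
  show "dist x y = norm (x - y)" by (rule dist_l2_def)
  show "sgn x = x /\<^sub>R norm x" by (rule sgn_l2_def)
  show "(uniformity :: (('a, 'b) l2 \<times> ('a, 'b) l2) filter)
      = (INF e\<in>{0<..}. principal {(x, y). dist x y < e})"
    by (rule uniformity_l2_def)
  show "open U \<longleftrightarrow> (\<forall>x\<in>U. eventually (\<lambda>(x', y). x' = x \<longrightarrow> y \<in> U) uniformity)"
    by (rule open_l2_def)
  show "norm x = sqrt (inner x x)" by (rule norm_l2_def)
  show "inner x y = inner y x"
    by transfer (simp add: inner_commute)
  show "inner (x + y) z = inner x z + inner y z"
    by transfer (simp add: inner_add_left infsum_add l2_summable_inner)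
  show "inner (r *\<^sub>R x) y = r * inner x y"
    by transfer (simp add: infsum_cmult_right')
  show "0 \<le> inner x x"
    by transfer (simp add: infsum_nonneg)
  show "inner x x = 0 \<longleftrightarrow> x = 0"
  proof
    assume "inner x x = 0"
    then have 0: "(\<Sum>\<^sub>\<infinity>i. inner (l2_apply x i) (l2_apply x i)) = 0"
      by (simp add: inner_l2.rep_eq)
    have "inner (l2_apply x i) (l2_apply x i) = 0" for i
      by (rule nonneg_infsum_le_0D[of "\<lambda>i. inner (l2_apply x i) (l2_apply x i)" UNIV])
        (use l2_apply[of x] 0 in \<open>auto simp: l2_summable_inner\<close>)
    then show "x = 0"
      by (simp add: zero_l2.rep_eq fun_eq_iff flip: l2_apply_inject)
  qed (transfer; simp)
qed

end

lemma norm_l2_square: "(norm x)\<^sup>2 = (\<Sum>\<^sub>\<infinity>i. (norm (l2_apply x i))\<^sup>2)"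
  unfolding power2_norm_eq_inner by transfer simp

lemma sum_le_norm_l2_square:
  assumes "finite F"
  shows "(\<Sum>i\<in>F. (norm (l2_apply x i))\<^sup>2) \<le> (norm x)\<^sup>2"
  unfolding norm_l2_square
  by (rule finite_sum_le_infsum) (use l2_apply[of x] assms in auto)

lemma norm_l2_apply_le: "norm (l2_apply x i) \<le> norm x"
  using sum_le_norm_l2_square[of "{i}" x] by simp

instance l2 :: (type, complex_hilbert_space) complete_space
proof
  fix X :: "nat \<Rightarrow> ('a, 'b) l2"
  assume X: "Cauchy X"
  have diff: "l2_apply (x - y) i = l2_apply x i - l2_apply y i" for x y :: "('a, 'b) l2" and i
    by transfer simp
  have "Cauchy (\<lambda>n. l2_apply (X n) i)" for i
    using X unfolding Cauchy_def dist_norm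
    by (metis diff norm_l2_apply_le order_le_less_trans)
  then have "\<exists>L. (\<lambda>n. l2_apply (X n) i) \<longlonglongrightarrow> L" for i
    by (simp add: Cauchy_convergent_iff convergent_def)
  then obtain g where g: "\<And>i. (\<lambda>n. l2_apply (X n) i) \<longlonglongrightarrow> g i"
    by metis
  have *: "\<exists>M. \<forall>n\<ge>M. \<forall>F. finite F \<longrightarrow> (\<Sum>i\<in>F. (norm (l2_apply (X n) i - g i))\<^sup>2) \<le> e\<^sup>2"
    if e: "0 < e" for e
  proof -
    obtain M where M: "\<And>m n. M \<le> m \<Longrightarrow> M \<le> n \<Longrightarrow> norm (X n - X m) < e"
      using X e unfolding Cauchy_def dist_norm by blast
    have "(\<Sum>i\<in>F. (norm (l2_apply (X n) i - g i))\<^sup>2) \<le> e\<^sup>2" if "M \<le> n" "finite F" for n F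
    proof (rule LIMSEQ_le_const2)
      show "(\<lambda>m. \<Sum>i\<in>F. (norm (l2_apply (X n) i - l2_apply (X m) i))\<^sup>2)
          \<longlonglongrightarrow> (\<Sum>i\<in>F. (norm (l2_apply (X n) i - g i))\<^sup>2)"
        by (intro tendsto_intros g)
      have "(\<Sum>i\<in>F. (norm (l2_apply (X n) i - l2_apply (X m) i))\<^sup>2) \<le> e\<^sup>2" if "M \<le> m" for m
      proof -
        have "(\<Sum>i\<in>F. (norm (l2_apply (X n) i - l2_apply (X m) i))\<^sup>2) \<le> (norm (X n - X m))\<^sup>2"
          using sum_le_norm_l2_square[OF \<open>finite F\<close>, of "X n - X m"] by (simp add: diff)
        also have "\<dots> \<le> e\<^sup>2"
          using M[OF that \<open>M \<le> n\<close>] by (intro power_mono) auto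
        finally show ?thesis .
      qed
      then show "\<exists>N. \<forall>m\<ge>N. (\<Sum>i\<in>F. (norm (l2_apply (X n) i - l2_apply (X m) i))\<^sup>2) \<le> e\<^sup>2"
        by blast
    qed
    then show ?thesis by blast
  qed
  have summ: "(\<lambda>i. (norm (f i))\<^sup>2) summable_on UNIV"
    if "\<And>F. finite F \<Longrightarrow> (\<Sum>i\<in>F. (norm (f i))\<^sup>2) \<le> e\<^sup>2" for f :: "'a \<Rightarrow> 'b" and e :: real
    by (rule nonneg_bdd_above_summable_on) (use that in \<open>auto simp: bdd_above_def\<close>)
  obtain M where M: "\<And>F. finite F \<Longrightarrow> (\<Sum>i\<in>F. (norm (l2_apply (X M) i - g i))\<^sup>2) \<le> 1\<^sup>2"
    using *[of 1] by auto
  have "(\<lambda>i. (norm (l2_apply (X M) i + (- (l2_apply (X M) i - g i))))\<^sup>2) summable_on UNIV"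
    by (rule l2_add_aux) (use l2_apply[of "X M"] summ[OF M] in \<open>auto simp: norm_minus_commute\<close>)
  then have "g \<in> {f. (\<lambda>i. (norm (f i))\<^sup>2) summable_on UNIV}"
    by simp
  then have G: "l2_apply (Abs_l2 g) = g"
    by (rule Abs_l2_inverse)
  have "X \<longlonglongrightarrow> Abs_l2 g"
  proof (rule metric_LIMSEQ_I)
    fix e :: real assume "0 < e"
    then obtain M where
      M: "\<And>n F. M \<le> n \<Longrightarrow> finite F \<Longrightarrow> (\<Sum>i\<in>F. (norm (l2_apply (X n) i - g i))\<^sup>2) \<le> (e / 2)\<^sup>2"
      using *[of "e / 2"] by auto
    have "dist (X n) (Abs_l2 g) < e" if "M \<le> n" for n
    proof -
      have "(norm (X n - Abs_l2 g))\<^sup>2 \<le> (e / 2)\<^sup>2"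
        unfolding norm_l2_square diff G
        by (rule infsum_le_finite_sums[OF summ[OF M[OF that]]]) (use M[OF that] in auto)
      then have "norm (X n - Abs_l2 g) \<le> e / 2"
        using \<open>0 < e\<close> by (simp add: power2_le_iff_abs_le)
      then show ?thesis
        using \<open>0 < e\<close> by (simp add: dist_norm)
    qed
    then show "\<exists>N. \<forall>n\<ge>N. dist (X n) (Abs_l2 g) < e"
      by blast
  qed
  then show "convergent X"
    by (auto simp: convergent_def)
qed

instantiation l2 :: (type, complex_hilbert_space) complex_hilbert_space
begin

lift_definition scaleC_l2 :: "complex \<Rightarrow> ('a, 'b) l2 \<Rightarrow> ('a, 'b) l2" is "\<lambda>c f i. c *\<^sub>C f i"
  by (simp add: norm_scaleC power_mult_distrib summable_on_cmult_right)

lift_definition cinner_l2 :: "('a, 'b) l2 \<Rightarrow> ('a, 'b) l2 \<Rightarrow> complex"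
  is "\<lambda>f g. \<Sum>\<^sub>\<infinity>i. cinner (f i) (g i)" .

instance
proof
  fix x y z :: "('a, 'b) l2" and a b :: complex and r :: real
  show "a *\<^sub>C (x + y) = a *\<^sub>C x + a *\<^sub>C y" by transfer (simp add: scaleC_add_right)
  show "(a + b) *\<^sub>C x = a *\<^sub>C x + b *\<^sub>C x" by transfer (simp add: scaleC_add_left)
  show "a *\<^sub>C b *\<^sub>C x = (a * b) *\<^sub>C x" by transfer (simp add: scaleC_scaleC)
  show "r *\<^sub>R x = complex_of_real r *\<^sub>C x" by transfer (simp add: scaleR_scaleC)
  show "cinner x y = cnj (cinner y x)"
    by transfer (simp flip: infsum_cnj cinner_commute)
  show "cinner (x + y) z = cinner x z + cinner y z"
    by transfer (simp add: cinner_add_left infsum_add l2_summable_cinner)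
  show "cinner (a *\<^sub>C x) y = a * cinner x y"
    by transfer (simp add: cinner_scaleC_left infsum_cmult_right')
  show "inner x y = Re (cinner x y)"
    by transfer (simp add: inner_eq_Re_cinner infsum_Re l2_summable_cinner)
qed

end

lift_definition ket :: "'i \<Rightarrow> ('i, complex) l2" is "\<lambda>a i. if i = a then 1 else 0"
proof -
  fix a :: 'i
  have "(\<lambda>i. (norm (if i = a then 1 else (0::complex)))\<^sup>2) summable_on {a}"
    by simp
  then show "(\<lambda>i. (norm (if i = a then 1 else (0::complex)))\<^sup>2) summable_on UNIV"
    by (subst (asm) summable_on_cong_neutral[where T = UNIV]) auto
qed



section \<open>Bounded operators\<close>

interpretation complex_vector: vector_space "scaleC :: complex \<Rightarrow> 'a \<Rightarrow> 'a::complex_hilbert_space"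
proof
  show "1 *\<^sub>C x = x" for x :: 'a
    using scaleR_scaleC[of 1 x] by simp
qed (simp_all add: scaleC_add_right scaleC_add_left scaleC_scaleC)

text \<open>The library type of bounded operators contains the operators that are linear over the
  reals; the complex-linear ones among them form the space of bounded operators
  between complex Hilbert spaces.\<close>

definition bounded_ops ::
  "('a::complex_hilbert_space \<Rightarrow>\<^sub>L 'b::complex_hilbert_space) set"
  where "bounded_ops = {A. \<forall>c x. blinfun_apply A (c *\<^sub>C x) = c *\<^sub>C blinfun_apply A x}"

definition adj ::
  "('a::complex_hilbert_space \<Rightarrow>\<^sub>L 'b::complex_hilbert_space) \<Rightarrow> 'b \<Rightarrow>\<^sub>L 'a"
  where "adj A = (THE B. B \<in> bounded_ops \<and>
    (\<forall>x y. cinner (blinfun_apply A x) y = cinner x (blinfun_apply B y)))"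

definition positive_op :: "('a::complex_hilbert_space \<Rightarrow>\<^sub>L 'a) \<Rightarrow> bool"
  where "positive_op A \<longleftrightarrow>
    A \<in> bounded_ops \<and> (\<forall>x. cinner (blinfun_apply A x) x \<in> \<real>\<^sub>\<ge>\<^sub>0)"

definition op_sqrt :: "('a::complex_hilbert_space \<Rightarrow>\<^sub>L 'a) \<Rightarrow> 'a \<Rightarrow>\<^sub>L 'a"
  where "op_sqrt A = (THE B. positive_op B \<and> B o\<^sub>L B = A)"

definition op_abs :: "('a::complex_hilbert_space \<Rightarrow>\<^sub>L 'a) \<Rightarrow> 'a \<Rightarrow>\<^sub>L 'a"
  where "op_abs A = op_sqrt (adj A o\<^sub>L A)"

text \<open>Orthogonal projection onto a closed subspace \<open>M\<close>, as an operator on the ambient space.\<close>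

definition proj_onto :: "'a::complex_hilbert_space set \<Rightarrow> 'a \<Rightarrow>\<^sub>L 'a"
  where "proj_onto M = (THE P. P \<in> bounded_ops \<and>
    (\<forall>x. blinfun_apply P x \<in> M \<and> (\<forall>y\<in>M. cinner (x - blinfun_apply P x) y = 0)))"

definition is_onb :: "'a::complex_hilbert_space set \<Rightarrow> bool"
  where "is_onb E \<longleftrightarrow> (\<forall>x\<in>E. norm x = 1) \<and> pairwise (\<lambda>x y. cinner x y = 0) E \<and>
    closure (complex_vector.span E) = UNIV"

definition trace_class :: "('a::complex_hilbert_space \<Rightarrow>\<^sub>L 'a) \<Rightarrow> bool"
  where "trace_class A \<longleftrightarrow> A \<in> bounded_ops \<and>
    (\<exists>E. is_onb E \<and> (\<lambda>e. cinner (blinfun_apply (op_abs A) e) e) summable_on E)"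

text \<open>For trace class operators the value does not depend on the choice of the orthonormal basis.\<close>

definition op_trace :: "('a::complex_hilbert_space \<Rightarrow>\<^sub>L 'a) \<Rightarrow> complex"
  where "op_trace A = (\<Sum>\<^sub>\<infinity>e\<in>(SOME E. is_onb E). cinner (blinfun_apply A e) e)"


section \<open>Tensor products of Fock spaces\<close>

text \<open>Words over the generators \<open>g\<^sub>1, \<dots>, g\<^sub>n\<close> are lists of letters below \<open>n\<close> (the letter \<open>j\<close>
  stands for \<open>g\<^bsub>j+1\<^esub>\<close>). The full Fock space over an \<open>n\<close>-dimensional space is the closed linear span
  of the vectors \<open>e\<^sub>\<alpha> = ket \<alpha>\<close>, \<open>\<alpha> \<in> lists {..<n}\<close>, in \<open>(nat list, complex) l2\<close>.
  The tensor product of \<open>k\<close> spaces \<open>('i, complex) l2\<close> with a Hilbert space \<open>'a\<close> is realised as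
  the space of square-summable families of elements of \<open>'a\<close> indexed by lists of length \<open>k\<close>, which
  is a closed subspace of \<open>('i list, 'a) l2\<close>; with \<open>'a = complex\<close> this is the tensor
  product of the \<open>k\<close> spaces alone. Operators on a closed subspace are represented by
  their extension by \<open>0\<close> to the orthogonal complement; this changes neither traces nor
  compressions.\<close>

lemma summable_on_prod_list:
  fixes us :: "('i \<Rightarrow> real) list"
  assumes "\<And>u. u \<in> set us \<Longrightarrow> u summable_on UNIV" "\<And>u i. u \<in> set us \<Longrightarrow> 0 \<le> u i"
  shows "(\<lambda>\<beta>. prod_list (map2 (\<lambda>u. u) us \<beta>)) summable_on {\<beta>. length \<beta> = length us}"
  using assms
proof (induction us)
  case Nil
  then show ?case by simp
next
  case (Cons u us)
  let ?A = "{\<beta> :: 'i list. length \<beta> = length us}"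
  let ?p = "\<lambda>\<beta>. prod_list (map2 (\<lambda>u. u) us \<beta>)"
  have nonneg: "0 \<le> ?p \<beta>" for \<beta>
    by (rule prod_list_nonneg) (use Cons.prems in \<open>auto dest: set_zip_leftD\<close>)
  have p: "?p summable_on ?A"
    by (rule Cons.IH) (use Cons.prems in auto)
  have u: "u summable_on UNIV" "\<And>i. 0 \<le> u i"
    using Cons.prems by auto
  have "(\<lambda>(i, \<beta>). u i * ?p \<beta>) summable_on UNIV \<times> ?A"
  proof (rule summable_on_SigmaI[where g = "\<lambda>i. u i * infsum ?p ?A"])
    show "((\<lambda>\<beta>. case (i, \<beta>) of (i, \<beta>) \<Rightarrow> u i * ?p \<beta>) has_sum u i * infsum ?p ?A) ?A" for i
      using has_sum_cmult_right[OF has_sum_infsum[OF p]] by simp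
    show "(\<lambda>i. u i * infsum ?p ?A) summable_on UNIV"
      by (rule summable_on_cmult_left[OF u(1)])
  qed (use u nonneg in auto)
  moreover have "inj_on (\<lambda>(i, \<beta>). i # \<beta>) (UNIV \<times> ?A)"
    by (auto simp: inj_on_def)
  ultimately have
    "(\<lambda>\<beta>. prod_list (map2 (\<lambda>u. u) (u # us) \<beta>)) summable_on (\<lambda>(i, \<beta>). i # \<beta>) ` (UNIV \<times> ?A)"
    by (simp add: summable_on_reindex o_def case_prod_unfold)
  also have "(\<lambda>(i, \<beta>). i # \<beta>) ` (UNIV \<times> ?A) = {\<beta>. length \<beta> = length (u # us)}"
    by (auto simp: length_Suc_conv image_iff)
  finally show ?case .
qed

lemma l2_etensor:
  fixes fs :: "('i, complex) l2 list" and h :: "'a::complex_hilbert_space"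
  shows "(\<lambda>\<beta>. (norm (if length \<beta> = length fs then prod_list (map2 l2_apply fs \<beta>) *\<^sub>C h else 0))\<^sup>2)
    summable_on UNIV"
proof -
  let ?us = "map (\<lambda>f i. (cmod (l2_apply f i))\<^sup>2) fs"
  have eq: "(cmod (prod_list (map2 l2_apply fs \<beta>)))\<^sup>2 = prod_list (map2 (\<lambda>u. u) ?us \<beta>)"
    if "length \<beta> = length fs" for \<beta>
    using that[symmetric]
    by (induction fs \<beta> rule: list_induct2) (auto simp: norm_mult power_mult_distrib)
  have "(\<lambda>\<beta>. prod_list (map2 (\<lambda>u. u) ?us \<beta>)) summable_on {\<beta>. length \<beta> = length ?us}"
    by (rule summable_on_prod_list) (use l2_apply in auto)
  then have "(\<lambda>\<beta>. prod_list (map2 (\<lambda>u. u) ?us \<beta>) * (norm h)\<^sup>2) summable_on {\<beta>. length \<beta> = length fs}"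
    by (intro summable_on_cmult_left) simp
  then show ?thesis
    by (subst summable_on_cong_neutral[where T = "{\<beta>. length \<beta> = length fs}" and
          g = "\<lambda>\<beta>. prod_list (map2 (\<lambda>u. u) ?us \<beta>) * (norm h)\<^sup>2"])
      (auto simp: eq norm_scaleC power_mult_distrib)
qed

text \<open>The elementary tensor \<open>f\<^sub>1 \<otimes> \<dots> \<otimes> f\<^sub>k \<otimes> h\<close>.\<close>

definition etensor ::
  "('i, complex) l2 list \<Rightarrow> 'a::complex_hilbert_space \<Rightarrow> ('i list, 'a) l2"
  where "etensor fs h = Abs_l2 (\<lambda>\<beta>.
    if length \<beta> = length fs then prod_list (map2 l2_apply fs \<beta>) *\<^sub>C h else 0)"

lemma l2_apply_etensor:
  "l2_apply (etensor fs h) \<beta> =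
    (if length \<beta> = length fs then prod_list (map2 l2_apply fs \<beta>) *\<^sub>C h else 0)"
  unfolding etensor_def by (subst Abs_l2_inverse) (use l2_etensor in auto)

text \<open>The operator \<open>A\<^sub>1 \<otimes> \<dots> \<otimes> A\<^sub>k \<otimes> B\<close>.\<close>

definition tensor_op ::
  "(('i, complex) l2 \<Rightarrow>\<^sub>L ('i, complex) l2) list \<Rightarrow>
    ('a::complex_hilbert_space \<Rightarrow>\<^sub>L 'a) \<Rightarrow> ('i list, 'a) l2 \<Rightarrow>\<^sub>L ('i list, 'a) l2"
  where "tensor_op As B = (THE C. C \<in> bounded_ops \<and>
    (\<forall>fs h. length fs = length As \<longrightarrow>
      blinfun_apply C (etensor fs h) = etensor (map2 blinfun_apply As fs) (blinfun_apply B h)) \<and>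
    (\<forall>x. (\<forall>fs h. length fs = length As \<longrightarrow> cinner x (etensor fs h) = 0) \<longrightarrow>
      blinfun_apply C x = 0))"

definition fock_proj :: "nat \<Rightarrow> nat \<Rightarrow> (nat list, complex) l2 \<Rightarrow>\<^sub>L (nat list, complex) l2"
  where "fock_proj n q =
    proj_onto (complex_vector.span (ket ` {\<alpha> \<in> lists {..<n}. length \<alpha> = q}))"


section \<open>Regular polyballs\<close>

text \<open>A tuple \<open>(X\<^sub>1, \<dots>, X\<^sub>k)\<close> with \<open>X\<^sub>i\<close> in the \<open>n\<^sub>i\<close>-fold power of the bounded operators is a list
  of \<open>k\<close> lists of lengths \<open>n\<^sub>1, \<dots>, n\<^sub>k\<close>; multi-indices of natural numbers are lists of length \<open>k\<close>.\<close>

definition cp_map :: "('a::complex_hilbert_space \<Rightarrow>\<^sub>L 'a) list \<Rightarrow> ('a \<Rightarrow>\<^sub>L 'a) \<Rightarrow> 'a \<Rightarrow>\<^sub>L 'a"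
  where "cp_map Xi Y = (\<Sum>A\<leftarrow>Xi. A o\<^sub>L Y o\<^sub>L adj A)"

definition comp_list :: "('b \<Rightarrow> 'b) list \<Rightarrow> 'b \<Rightarrow> 'b"
  where "comp_list Fs = foldr (\<circ>) Fs id"

definition regular_polyball ::
  "nat list \<Rightarrow> ('a::complex_hilbert_space \<Rightarrow>\<^sub>L 'a) list list set"
  where "regular_polyball ns = {X. map length X = ns \<and>
    (\<forall>Xi\<in>set X. set Xi \<subseteq> bounded_ops) \<and>
    (\<forall>s<length X. \<forall>t<length X. s \<noteq> t \<longrightarrow>
      (\<forall>A\<in>set (X ! s). \<forall>B\<in>set (X ! t). A o\<^sub>L B = B o\<^sub>L A)) \<and>
    (\<forall>ps. length ps = length X \<and> set ps \<subseteq> {0, 1} \<longrightarrow>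
      positive_op (comp_list (map2 (\<lambda>p Xi. (\<lambda>Y. Y - cp_map Xi Y) ^^ p) ps X) id_blinfun))}"

definition defect_map ::
  "('a::complex_hilbert_space \<Rightarrow>\<^sub>L 'a) list list \<Rightarrow> ('a \<Rightarrow>\<^sub>L 'a) \<Rightarrow> 'a \<Rightarrow>\<^sub>L 'a"
  where "defect_map X = comp_list (map (\<lambda>Xi Y. Y - cp_map Xi Y) X)"

definition trace_class_defect :: "('a::complex_hilbert_space \<Rightarrow>\<^sub>L 'a) list list \<Rightarrow> bool"
  where "trace_class_defect T \<longleftrightarrow> trace_class (defect_map T id_blinfun)"

definition defect_space :: "('a::complex_hilbert_space \<Rightarrow>\<^sub>L 'a) list list \<Rightarrow> 'a set"
  where "defect_space T = closure (range (blinfun_apply (defect_map T id_blinfun)))"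

definition cp_powers ::
  "('a::complex_hilbert_space \<Rightarrow>\<^sub>L 'a) list list \<Rightarrow> nat list \<Rightarrow> ('a \<Rightarrow>\<^sub>L 'a) \<Rightarrow> 'a \<Rightarrow>\<^sub>L 'a"
  where "cp_powers T qs = comp_list (map2 (\<lambda>q Ti. cp_map Ti ^^ q) qs T)"

definition word_op :: "('a::complex_hilbert_space \<Rightarrow>\<^sub>L 'a) list \<Rightarrow> nat list \<Rightarrow> 'a \<Rightarrow>\<^sub>L 'a"
  where "word_op Ti \<alpha> = foldr (\<lambda>j A. (Ti ! j) o\<^sub>L A) \<alpha> id_blinfun"

text \<open>The values lie in the subspace \<open>F\<^sup>2(H\<^sub>1) \<otimes> \<dots> \<otimes> F\<^sup>2(H\<^sub>k) \<otimes> defect_space T\<close>; the kernel is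
  taken as an operator into the ambient space \<open>(nat list list, 'a) l2\<close>.\<close>

definition berezin_kernel ::
  "('a::complex_hilbert_space \<Rightarrow>\<^sub>L 'a) list list \<Rightarrow> 'a \<Rightarrow>\<^sub>L (nat list list, 'a) l2"
  where "berezin_kernel T = Blinfun (\<lambda>h.
    \<Sum>\<^sub>\<infinity>\<beta>\<in>listset (map (\<lambda>Ti. lists {..<length Ti}) T).
      etensor (map ket \<beta>)
        (blinfun_apply (op_sqrt (defect_map T id_blinfun) o\<^sub>L
          foldr (o\<^sub>L) (map2 (\<lambda>Ti \<alpha>. adj (word_op Ti \<alpha>)) T \<beta>) id_blinfun) h))"

definition curvature :: "('a::complex_hilbert_space \<Rightarrow>\<^sub>L 'a) list list \<Rightarrow> complex"
  where "curvature T = lim (\<lambda>m.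
    1 / of_nat ((m + length T) choose length T) *
    (\<Sum>qs | length qs = length T \<and> sum_list qs \<le> m.
      op_trace (adj (berezin_kernel T) o\<^sub>L
        tensor_op (map2 (\<lambda>Ti q. fock_proj (length Ti) q) T qs) (proj_onto (defect_space T)) o\<^sub>L
        berezin_kernel T) /
      op_trace (tensor_op (map2 (\<lambda>Ti q. fock_proj (length Ti) q) T qs)
        (id_blinfun :: complex \<Rightarrow>\<^sub>L complex))))"


section \<open>Limits in several indices\<close>

text \<open>\<open>has_iterated_lim k f L\<close>: the limits over the first up to the \<open>k\<close>-th index, the last
  one being the innermost, exist and yield \<open>L\<close>.\<close>

primrec has_iterated_lim ::
  "nat \<Rightarrow> (nat list \<Rightarrow> 'b::topological_space) \<Rightarrow> 'b \<Rightarrow> bool"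
  where
    "has_iterated_lim 0 f L \<longleftrightarrow> f [] = L"
  | "has_iterated_lim (Suc k) f L \<longleftrightarrow>
      (\<exists>g. (\<forall>q. has_iterated_lim k (\<lambda>qs. f (q # qs)) (g q)) \<and> g \<longlonglongrightarrow> L)"

text \<open>The filter of the net of multi-indices of length \<open>k\<close> directed by the coordinatewise order.\<close>

definition multi_at_top :: "nat \<Rightarrow> nat list filter"
  where "multi_at_top k =
    (INF N\<in>{N. length N = k}. principal {qs. length qs = k \<and> list_all2 (\<le>) N qs})"

end

theory Submission
  imports Defs
begin

text \<open>The operator \<open>\<Delta>(I)\<close> is positive with finite trace, every entry of \<open>T\<^sub>i\<close> is a contraction
  and the maps \<open>\<Phi>\<^sub>i\<close> commute. Write \<open>\<Phi>\<^bsup>q\<^esup>\<close> for the composition of the \<open>q\<^sub>i\<close>-th powers of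
  the \<open>\<Phi>\<^sub>i\<close>. Since \<open>trace \<Phi>\<^sub>i(Y) \<le> n\<^sub>i trace Y\<close> for positive \<open>Y\<close>, the normalised traces of
  \<open>\<Phi>\<^bsup>q\<^esup>(\<Delta>(I))\<close> decrease in every coordinate of \<open>q\<close> and converge as a net to their infimum. The
  other expressions are averages of these traces: uniform ones over simplices in the first two
  formulas, and weighted ones over boxes in the third, because the composition of the maps
  \<open>id - \<Phi>\<^sub>i\<^bsup>q+1\<^esup>\<close> sends \<open>I\<close> to the sum of \<open>\<Phi>\<^bsup>s\<^esup>(\<Delta>(I))\<close> over the box below \<open>q\<close>. The averages
  in the definition of the curvature are those of the first formula, because the compression
  of a product of homogeneous projections by the Berezin kernel has the same quadratic form as
  \<open>\<Phi>\<^bsup>q\<^esup>(\<Delta>(I))\<close>.\<close>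

text \<open>Adjoints, projections, square roots and tensor operators are definite descriptions, so
  each requires existence and uniqueness before it can be computed with. \<open>op_trace\<close>
  sums diagonal entries in one arbitrary basis, so operators with equal quadratic forms have equal
  traces, and the compression by the Berezin kernel never has to be identified as an operator.
  Traces are handled as real numbers attached to positive operators: with \<open>Y = S S\<close>,
  \<open>S\<close> the positive square root, the trace becomes a sum of squared norms
  \<open>|S e|^2\<close>. Exchanging the order in a double sum then gives both the independence of
  the basis and \<open>trace (A Y adj A) \<le> trace Y\<close> for contractions \<open>A\<close>;
  adding this over the \<open>n_i\<close> entries of a row produces the factor \<open>n_i\<close>.
  The kernel is bounded because every finite partial sum of its squared norm is dominated by the
  form of a box sum of the operators \<open>\<Phi>^s(\<Delta>(I))\<close>, and that box sum lies
  below \<open>I\<close>: each factor \<open>id - \<Phi>_i^(q+1)\<close> only subtracts a positive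
  operator.\<close>

instance complex_hilbert_space \<subseteq> banach ..

section \<open>Adjoints and orthogonal projections\<close>

lemma cinner_add_right: "cinner x (y + z) = cinner x y + cinner x z"
  by (metis cinner_add_left cinner_commute complex_cnj_add)

lemma cinner_scaleC_right: "cinner x (a *\<^sub>C y) = cnj a * cinner x y"
  by (metis cinner_commute cinner_scaleC_left complex_cnj_mult)

lemma cinner_scaleR_left: "cinner (r *\<^sub>R x) y = of_real r * cinner x y"
  by (simp add: scaleR_scaleC cinner_scaleC_left)

lemma cinner_scaleR_right: "cinner x (r *\<^sub>R y) = of_real r * cinner x y"
  by (simp add: scaleR_scaleC cinner_scaleC_right)

lemma cinner_zero_left [simp]: "cinner 0 x = 0"
  using cinner_scaleR_left[of 0 0 x] by simp

lemma cinner_zero_right [simp]: "cinner x 0 = 0"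
  using cinner_scaleR_right[of x 0 0] by simp

lemma cinner_minus_left: "cinner (- x) y = - cinner x y"
  using cinner_scaleR_left[of "-1" x y] by simp

lemma cinner_diff_left: "cinner (x - y) z = cinner x z - cinner y z"
  using cinner_add_left[of x "- y" z] by (simp add: cinner_minus_left)

lemma cinner_diff_right: "cinner x (y - z) = cinner x y - cinner x z"
  by (metis cinner_commute cinner_diff_left complex_cnj_diff)

lemma cinner_sum_left: "cinner (\<Sum>i\<in>I. f i) y = (\<Sum>i\<in>I. cinner (f i) y)"
  by (induction I rule: infinite_finite_induct) (auto simp: cinner_add_left)

lemma cinner_sum_right: "cinner y (\<Sum>i\<in>I. f i) = (\<Sum>i\<in>I. cinner y (f i))"
  by (induction I rule: infinite_finite_induct) (auto simp: cinner_add_right)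

text \<open>Conjugate-linearity in the second slot gives
  \<open>Re (cinner x (\<i> *\<^sub>C y)) = Im (cinner x y)\<close>. The complex form is thereby
  recovered from the real one, which transports continuity and orthogonality.\<close>

lemma cinner_eq_Complex: "cinner x y = Complex (inner x y) (inner x (\<i> *\<^sub>C y))"
  by (simp add: complex_eq_iff inner_eq_Re_cinner cinner_scaleC_right)

lemma Im_cinner_left: "Im (cinner x y) = - inner (\<i> *\<^sub>C x) y"
  by (simp add: inner_eq_Re_cinner cinner_scaleC_left)

lemma cinner_ext: "(\<And>y. cinner x y = cinner x' y) \<Longrightarrow> x = x'"
  by (metis inner_eq_Re_cinner vector_eq_rdot)

lemma scaleR_scaleC_commute: "a *\<^sub>C (r *\<^sub>R x) = r *\<^sub>R (a *\<^sub>C x)"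
  by (simp add: scaleR_scaleC scaleC_scaleC mult.commute)

lemma bounded_linear_scaleC: "bounded_linear (\<lambda>x. a *\<^sub>C x)"
  by (rule bounded_linear_intro[where K = "cmod a"])
    (simp_all add: scaleC_add_right scaleR_scaleC_commute norm_scaleC mult.commute)

lemma tendsto_cinner [tendsto_intros]:
  assumes "(f \<longlongrightarrow> x) F" "(g \<longlongrightarrow> y) F"
  shows "((\<lambda>t. cinner (f t) (g t)) \<longlongrightarrow> cinner x y) F"
  unfolding cinner_eq_Complex
  by (intro tendsto_intros assms bounded_linear.tendsto[OF bounded_linear_scaleC])

text \<open>A minimising sequence for the distance to \<open>M\<close> is Cauchy by the
  parallelogram law, and its limit is the foot of the perpendicular. Only the real inner product is
  involved, so the statement serves both the kernel of a real functional and complex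
  subspaces.\<close>

lemma orthogonal_projection_exists:
  fixes M :: "'a::{real_inner,complete_space} set"
  assumes M: "subspace M" "closed M"
  shows "\<exists>p\<in>M. \<forall>y\<in>M. inner (x - p) y = 0"
proof -
  let ?d = "infdist x M"
  have ne: "M \<noteq> {}" using M(1) subspace_0 by blast
  have d: "?d \<le> norm (x - y)" if "y \<in> M" for y
    using infdist_le[OF that] by (simp add: dist_norm)
  have d0: "0 \<le> ?d" by (rule infdist_nonneg)
  have "\<exists>p\<in>M. (norm (x - p))\<^sup>2 < ?d\<^sup>2 + 1 / real (Suc n)" for n
  proof -
    have "?d < sqrt (?d\<^sup>2 + 1 / real (Suc n))"
      by (rule real_less_rsqrt) simp
    then obtain p where p: "p \<in> M" "dist x p < sqrt (?d\<^sup>2 + 1 / real (Suc n))"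
      using ne by (auto simp: infdist_notempty cINF_less_iff)
    have "(norm (x - p))\<^sup>2 < (sqrt (?d\<^sup>2 + 1 / real (Suc n)))\<^sup>2"
      by (rule power_strict_mono) (use p in \<open>auto simp: dist_norm\<close>)
    also have "\<dots> = ?d\<^sup>2 + 1 / real (Suc n)" by (simp add: add_nonneg_nonneg)
    finally show ?thesis using p by blast
  qed
  then obtain p where p: "\<And>n. p n \<in> M" "\<And>n. (norm (x - p n))\<^sup>2 < ?d\<^sup>2 + 1 / real (Suc n)"
    by metis
  \<comment> \<open>The midpoint of \<open>p n\<close> and \<open>p m\<close> lies in
    \<open>M\<close>, so its distance from \<open>x\<close> is at least \<open>infdist x M\<close>;
    the parallelogram identity then bounds the gap by the two excesses.\<close>
  have par: "(norm (p n - p m))\<^sup>2 \<le> 2 / real (Suc n) + 2 / real (Suc m)" for n m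
  proof -
    have "(1/2) *\<^sub>R (p n + p m) \<in> M"
      using M(1) p(1) by (simp add: subspace_add subspace_scale)
    then have "?d\<^sup>2 \<le> (norm (x - (1/2) *\<^sub>R (p n + p m)))\<^sup>2"
      by (intro power_mono d d0)
    moreover have "(norm (p n - p m))\<^sup>2 = 2 * (norm (x - p n))\<^sup>2 + 2 * (norm (x - p m))\<^sup>2
        - 4 * (norm (x - (1/2) *\<^sub>R (p n + p m)))\<^sup>2"
      unfolding power2_norm_eq_inner by (simp add: inner_simps inner_commute algebra_simps)
    ultimately show ?thesis using p(2)[of n] p(2)[of m] by simp
  qed
  have "Cauchy p"
  proof (rule metric_CauchyI)
    fix e :: real assume "0 < e"
    then obtain N where N: "1 / real (Suc N) < e\<^sup>2 / 4"
      using reals_Archimedean[of "e\<^sup>2 / 4"] by (auto simp: inverse_eq_divide)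
    have "dist (p m) (p n) < e" if "N \<le> m" "N \<le> n" for m n
    proof -
      have "1 / real (Suc m) \<le> 1 / real (Suc N)" "1 / real (Suc n) \<le> 1 / real (Suc N)"
        using that by (simp_all add: frac_le)
      then have "(norm (p m - p n))\<^sup>2 < e\<^sup>2"
        using par[of m n] N by simp
      then show ?thesis
        using \<open>0 < e\<close> by (simp add: dist_norm power2_less_imp_less)
    qed
    then show "\<exists>N. \<forall>m\<ge>N. \<forall>n\<ge>N. dist (p m) (p n) < e" by blast
  qed
  then obtain q where q: "p \<longlonglongrightarrow> q"
    using Cauchy_convergent_iff convergent_def by blast
  have qM: "q \<in> M"
    using M(2) p(1) q closed_sequentially by blast
  have "(norm (x - q))\<^sup>2 \<le> ?d\<^sup>2 + 0"
  proof (rule LIMSEQ_le)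
    show "(\<lambda>n. (norm (x - p n))\<^sup>2) \<longlonglongrightarrow> (norm (x - q))\<^sup>2"
      by (intro tendsto_intros q)
    show "(\<lambda>n. ?d\<^sup>2 + 1 / real (Suc n)) \<longlonglongrightarrow> ?d\<^sup>2 + 0"
      by (intro tendsto_intros lim_1_over_n LIMSEQ_Suc[OF lim_1_over_n])
  qed (use p(2) less_imp_le in blast)
  then have nq: "(norm (x - q))\<^sup>2 \<le> ?d\<^sup>2" by simp
  have "inner (x - q) y = 0" if y: "y \<in> M" for y
  proof (cases "y = 0")
    case False
    let ?b = "inner (x - q) y" and ?c = "inner y y"
    \<comment> \<open>This \<open>t\<close> minimises the quadratic \<open>|x - q - t y|^2\<close>,
      so a nonzero \<open>?b\<close> would push the distance below the infimum.\<close>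
    define t where "t = ?b / ?c"
    have c: "?c > 0" using False by simp
    have "q + t *\<^sub>R y \<in> M"
      using M(1) qM y by (simp add: subspace_add subspace_scale)
    then have "?d\<^sup>2 \<le> (norm (x - (q + t *\<^sub>R y)))\<^sup>2"
      by (intro power_mono d d0)
    also have "\<dots> = (norm (x - q))\<^sup>2 - 2 * t * ?b + t\<^sup>2 * ?c"
      unfolding power2_norm_eq_inner
      by (simp add: inner_simps inner_commute algebra_simps power2_eq_square)
    finally have "0 \<le> - 2 * t * ?b + t\<^sup>2 * ?c" using nq by simp
    also have "\<dots> = - (?b\<^sup>2 / ?c)"
      using c by (simp add: t_def power2_eq_square field_simps)
    finally have "?b\<^sup>2 / ?c \<le> 0" by simp
    then show ?thesis using c by (simp add: divide_le_0_iff)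
  qed simp
  then show ?thesis using qM by blast
qed

text \<open>The residual \<open>w\<close> of a vector outside the kernel is orthogonal to the
  kernel. Subtracting \<open>(f x / f w) w\<close> from \<open>x\<close> lands in the kernel, and
  this determines \<open>inner x w\<close>.\<close>

lemma riesz_representation:
  fixes f :: "'a::{real_inner,complete_space} \<Rightarrow> real"
  assumes "bounded_linear f"
  shows "\<exists>z. \<forall>x. f x = inner x z"
proof (cases "\<forall>x. f x = 0")
  case True
  then show ?thesis by (auto intro: exI[of _ 0])
next
  case False
  then obtain x0 where x0: "f x0 \<noteq> 0" by blast
  interpret f: bounded_linear f by fact
  let ?M = "{x. f x = 0}"
  have "subspace ?M" by (auto simp: subspace_def f.add f.scaleR f.zero)
  moreover have "closed ?M"
    by (intro closed_Collect_eq f.continuous_on continuous_intros)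
  ultimately obtain p where p: "f p = 0" "\<And>y. f y = 0 \<Longrightarrow> inner (x0 - p) y = 0"
    using orthogonal_projection_exists[of ?M x0] by auto
  define w where "w = x0 - p"
  have fw: "f w \<noteq> 0" using x0 p(1) by (simp add: w_def f.diff)
  then have w: "inner w w \<noteq> 0" using f.zero by auto
  have "f x = inner x ((f w / inner w w) *\<^sub>R w)" for x
  proof -
    have "f (x - (f x / f w) *\<^sub>R w) = 0" using fw by (simp add: f.diff f.scaleR)
    then have "inner w (x - (f x / f w) *\<^sub>R w) = 0" using p(2) by (simp add: w_def)
    then have "inner x w = f x / f w * inner w w" by (simp add: inner_simps inner_commute)
    then show ?thesis using fw w by simp
  qed
  then show ?thesis by blast
qed

section \<open>Complex-linear bounded operators, adjoints and projections\<close>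

lemma bounded_opsI: "(\<And>c x. blinfun_apply A (c *\<^sub>C x) = c *\<^sub>C blinfun_apply A x) \<Longrightarrow> A \<in> bounded_ops"
  by (simp add: bounded_ops_def)

lemma bounded_opsD: "A \<in> bounded_ops \<Longrightarrow> blinfun_apply A (c *\<^sub>C x) = c *\<^sub>C blinfun_apply A x"
  by (simp add: bounded_ops_def)

lemma bounded_ops_zero [simp]: "0 \<in> bounded_ops"
  by (simp add: bounded_ops_def)

lemma bounded_ops_id [simp]: "id_blinfun \<in> bounded_ops"
  by (simp add: bounded_ops_def)

lemma bounded_ops_compose: "A \<in> bounded_ops \<Longrightarrow> B \<in> bounded_ops \<Longrightarrow> A o\<^sub>L B \<in> bounded_ops"
  by (simp add: bounded_ops_def)

lemma bounded_ops_add: "A \<in> bounded_ops \<Longrightarrow> B \<in> bounded_ops \<Longrightarrow> A + B \<in> bounded_ops"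
  by (simp add: bounded_ops_def blinfun.add_left scaleC_add_right)

lemma bounded_ops_scaleR: "A \<in> bounded_ops \<Longrightarrow> r *\<^sub>R A \<in> bounded_ops"
  by (simp add: bounded_ops_def blinfun.scaleR_left scaleR_scaleC_commute)

lemma bounded_ops_diff: "A \<in> bounded_ops \<Longrightarrow> B \<in> bounded_ops \<Longrightarrow> A - B \<in> bounded_ops"
  by (simp add: bounded_ops_def blinfun.diff_left complex_vector.scale_right_diff_distrib)

lemma blinfun_eqI_cinner:
  "(\<And>x y. cinner (blinfun_apply A x) y = cinner (blinfun_apply B x) y) \<Longrightarrow> A = B"
  by (rule blinfun_eqI, rule cinner_ext)

text \<open>Riesz applied to the real functional \<open>x \<mapsto> inner (A x) y\<close> produces a
  map \<open>g\<close> that matches real parts. Since \<open>A\<close> commutes with multiplication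
  by \<i>, testing at \<open>\<i> x\<close> matches the imaginary parts too, and complex linearity
  of \<open>g\<close> follows.\<close>

lemma adjoint_exists:
  fixes A :: "'a::complex_hilbert_space \<Rightarrow>\<^sub>L 'b::complex_hilbert_space"
  assumes A: "A \<in> bounded_ops"
  shows "\<exists>B\<in>bounded_ops. \<forall>x y. cinner (blinfun_apply A x) y = cinner x (blinfun_apply B y)"
proof -
  have "\<exists>z. \<forall>x. inner (blinfun_apply A x) y = inner x z" for y
    by (intro riesz_representation bounded_linear_compose[OF bounded_linear_inner_left blinfun.bounded_linear_right])
  then obtain g where g: "\<And>x y. inner (blinfun_apply A x) y = inner x (g y)" by metis
  have cg: "cinner x (g y) = cinner (blinfun_apply A x) y" for x y
  proof -
    have "inner (\<i> *\<^sub>C x) (g y) = inner (\<i> *\<^sub>C blinfun_apply A x) y"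
      by (simp add: g[symmetric] bounded_opsD[OF A])
    then show ?thesis
      by (simp add: complex_eq_iff Im_cinner_left g flip: inner_eq_Re_cinner)
  qed
  have ext: "u = v" if "\<And>x. cinner x u = cinner x v" for u v :: 'a
    by (rule cinner_ext) (metis that cinner_commute)
  have gC: "g (c *\<^sub>C y) = c *\<^sub>C g y" for c y
    by (rule ext) (simp add: cg cinner_scaleC_right)
  have "bounded_linear g"
  proof (rule bounded_linear_intro[where K = "norm A"])
    show "g (y + z) = g y + g z" for y z
      by (rule ext) (simp add: cg cinner_add_right)
    show "g (r *\<^sub>R y) = r *\<^sub>R g y" for r y
      by (simp add: gC scaleR_scaleC)
    show "norm (g y) \<le> norm y * norm A" for y
    proof (cases "g y = 0")
      case False
      have "(norm (g y))\<^sup>2 = inner (blinfun_apply A (g y)) y"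
        by (simp add: g power2_norm_eq_inner)
      also have "\<dots> \<le> norm (blinfun_apply A (g y)) * norm y" by (rule norm_cauchy_schwarz)
      also have "\<dots> \<le> norm A * norm (g y) * norm y" by (intro mult_right_mono norm_blinfun) simp
      finally show ?thesis using False by (simp add: power2_eq_square mult_ac)
    qed simp
  qed
  then have "blinfun_apply (Blinfun g) = g" by (rule bounded_linear_Blinfun_apply)
  then show ?thesis
    by (intro bexI[of _ "Blinfun g"]) (auto simp: cg gC intro: bounded_opsI)
qed

lemma adj_unique:
  assumes "B \<in> bounded_ops" "\<And>x y. cinner (blinfun_apply A x) y = cinner x (blinfun_apply B y)"
  shows "adj A = B"
  unfolding adj_def
proof (rule the_equality)
  fix C assume C: "C \<in> bounded_ops \<and>
    (\<forall>x y. cinner (blinfun_apply A x) y = cinner x (blinfun_apply C y))"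
  show "C = B"
    by (rule blinfun_eqI_cinner) (metis C assms(2) cinner_commute)
qed (use assms in auto)

lemma
  assumes "A \<in> bounded_ops"
  shows adj_in_bounded_ops: "adj A \<in> bounded_ops"
    and cinner_adj_right: "cinner x (blinfun_apply (adj A) y) = cinner (blinfun_apply A x) y"
  using adjoint_exists[OF assms] adj_unique by metis+

lemma cinner_adj_left:
  "A \<in> bounded_ops \<Longrightarrow> cinner (blinfun_apply (adj A) y) x = cinner y (blinfun_apply A x)"
  by (metis cinner_adj_right cinner_commute)

lemma adj_compose:
  "A \<in> bounded_ops \<Longrightarrow> B \<in> bounded_ops \<Longrightarrow> adj (A o\<^sub>L B) = adj B o\<^sub>L adj A"
  by (rule adj_unique) (auto simp: cinner_adj_right adj_in_bounded_ops bounded_ops_compose)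

lemma proj_onto_props:
  fixes M :: "'a::complex_hilbert_space set"
  assumes "complex_vector.subspace M" "closed M"
  shows "proj_onto M \<in> bounded_ops" "blinfun_apply (proj_onto M) x \<in> M"
    "y \<in> M \<Longrightarrow> cinner (x - blinfun_apply (proj_onto M) x) y = 0"
proof -
  note S = complex_vector.subspace_0[OF assms(1)] complex_vector.subspace_add[OF assms(1)]
    complex_vector.subspace_scale[OF assms(1)]
  have sub: "subspace M"
    using S by (auto simp: subspace_def scaleR_scaleC)
  obtain p where p: "\<And>x. p x \<in> M" "\<And>x y. y \<in> M \<Longrightarrow> inner (x - p x) y = 0"
    using orthogonal_projection_exists[OF sub assms(2)] by metis
  \<comment> \<open>\<open>M\<close> contains \<open>\<i> *\<^sub>C y\<close> together with
    \<open>y\<close>; real orthogonality to both also kills the imaginary part.\<close>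
  have pc: "cinner (x - p x) y = 0" if "y \<in> M" for x y
    using p(2)[OF that] p(2)[OF S(3)[OF that]] by (simp add: cinner_eq_Complex zero_complex.code)
  have uni: "u = v" if "u \<in> M" "v \<in> M" "\<And>y. y \<in> M \<Longrightarrow> cinner (x - u) y = 0"
    "\<And>y. y \<in> M \<Longrightarrow> cinner (x - v) y = 0" for x u v
  proof -
    have m: "u - v \<in> M" using that(1,2) sub by (simp add: subspace_diff)
    have "cinner (u - v) (u - v) = cinner (x - v) (u - v) - cinner (x - u) (u - v)"
      by (simp add: cinner_diff_left)
    also have "\<dots> = 0" using that(3,4)[OF m] by simp
    finally show ?thesis by (simp add: cinner_self)
  qed
  have pC: "p (c *\<^sub>C x) = c *\<^sub>C p x" for c x
  proof (rule uni[of _ _ "c *\<^sub>C x"])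
    fix y assume y: "y \<in> M"
    have "c *\<^sub>C x - c *\<^sub>C p x = c *\<^sub>C (x - p x)"
      by (simp add: complex_vector.scale_right_diff_distrib)
    then show "cinner (c *\<^sub>C x - c *\<^sub>C p x) y = 0" by (simp add: cinner_scaleC_left pc y)
  qed (auto simp: p pc S)
  have "bounded_linear p"
  proof (rule bounded_linear_intro[where K = 1])
    show "p (x + y) = p x + p y" for x y
    proof (rule uni[of _ _ "x + y"])
      fix z assume z: "z \<in> M"
      have "x + y - (p x + p y) = (x - p x) + (y - p y)" by simp
      then show "cinner (x + y - (p x + p y)) z = 0"
        by (simp only: cinner_add_left pc[OF z]) simp
    qed (auto simp: p pc S)
    show "p (r *\<^sub>R x) = r *\<^sub>R p x" for r x by (simp add: pC scaleR_scaleC)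
    show "norm (p x) \<le> norm x * 1" for x
    proof -
      have "inner (x - p x) (p x) = 0" by (simp add: p)
      then have "(norm x)\<^sup>2 = (norm (x - p x))\<^sup>2 + (norm (p x))\<^sup>2"
        unfolding power2_norm_eq_inner by (simp add: inner_simps inner_commute)
      then show ?thesis by (simp add: power2_le_imp_le)
    qed
  qed
  then have app: "blinfun_apply (Blinfun p) = p" by (rule bounded_linear_Blinfun_apply)
  let ?Q = "\<lambda>P. P \<in> bounded_ops \<and>
    (\<forall>x. blinfun_apply P x \<in> M \<and> (\<forall>y\<in>M. cinner (x - blinfun_apply P x) y = 0))"
  have "?Q (Blinfun p)"
    by (auto simp: app p pc pC intro: bounded_opsI)
  moreover have "P = P'" if "?Q P" "?Q P'" for P P'
    by (rule blinfun_eqI, rule uni) (use that in auto)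
  ultimately have "?Q (proj_onto M)"
    unfolding proj_onto_def by (intro theI'[of ?Q] ex1I[of ?Q]) blast+
  then show "proj_onto M \<in> bounded_ops" "blinfun_apply (proj_onto M) x \<in> M"
    "y \<in> M \<Longrightarrow> cinner (x - blinfun_apply (proj_onto M) x) y = 0" by auto
qed

text \<open>The candidate itself supplies existence, so a projection onto a bare span can be
  identified directly; \<open>fock_proj_eq\<close> uses it in this way.\<close>

lemma proj_onto_unique:
  fixes M :: "'a::complex_hilbert_space set"
  assumes "complex_vector.subspace M" "P \<in> bounded_ops" "\<And>x. blinfun_apply P x \<in> M"
    "\<And>x y. y \<in> M \<Longrightarrow> cinner (x - blinfun_apply P x) y = 0"
  shows "proj_onto M = P"
  unfolding proj_onto_def
proof (rule the_equality)
  fix Q assume Q: "Q \<in> bounded_ops \<and>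
    (\<forall>x. blinfun_apply Q x \<in> M \<and> (\<forall>y\<in>M. cinner (x - blinfun_apply Q x) y = 0))"
  show "Q = P"
  proof (rule blinfun_eqI)
    fix x
    let ?u = "blinfun_apply Q x" and ?v = "blinfun_apply P x"
    have m: "?u - ?v \<in> M" using Q assms(1,3) by (simp add: complex_vector.subspace_diff)
    have "cinner (?u - ?v) (?u - ?v) = cinner (x - ?v) (?u - ?v) - cinner (x - ?u) (?u - ?v)"
      by (simp add: cinner_diff_left)
    also have "\<dots> = 0" using Q assms(4) m by simp
    finally show "?u = ?v" by (simp add: cinner_self)
  qed
qed (use assms in auto)

section \<open>Positive operators and their square roots\<close>

definition hermitian :: "('a::complex_hilbert_space \<Rightarrow>\<^sub>L 'a) \<Rightarrow> bool"
  where "hermitian A \<longleftrightarrow> A \<in> bounded_ops \<and>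
    (\<forall>x y. cinner (blinfun_apply A x) y = cinner x (blinfun_apply A y))"

lemma hermitian_inner:
  "hermitian A \<Longrightarrow> inner (blinfun_apply A x) y = inner x (blinfun_apply A y)"
  by (simp add: hermitian_def inner_eq_Re_cinner)

lemma adj_hermitian: "hermitian A \<Longrightarrow> adj A = A"
  by (rule adj_unique) (auto simp: hermitian_def)

lemma hermitian_diff: "hermitian A \<Longrightarrow> hermitian B \<Longrightarrow> hermitian (A - B)"
  by (simp add: hermitian_def bounded_ops_diff blinfun.diff_left cinner_diff_left cinner_diff_right)

text \<open>Polarisation: the quadratic form is real at \<open>x + y\<close> and at
  \<open>x + \<i> *\<^sub>C y\<close>, which gives the symmetry of the imaginary and of the real
  part respectively.\<close>

lemma positive_op_hermitian:
  assumes "positive_op A"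
  shows "hermitian A"
proof -
  have A: "A \<in> bounded_ops" and nn: "\<And>x. cinner (blinfun_apply A x) x \<in> \<real>\<^sub>\<ge>\<^sub>0"
    using assms by (auto simp: positive_op_def)
  have "cinner (blinfun_apply A x) y = cnj (cinner (blinfun_apply A y) x)" for x y
  proof -
    have im: "Im (cinner (blinfun_apply A z) z) = 0" for z
      using nn[of z] by (simp add: complex_nonneg_Reals_iff)
    have "Im (cinner (blinfun_apply A x) y) + Im (cinner (blinfun_apply A y) x) = 0"
      using im[of "x + y"] im[of x] im[of y]
      by (simp add: blinfun.add_right cinner_add_left cinner_add_right)
    moreover have "Re (cinner (blinfun_apply A y) x) - Re (cinner (blinfun_apply A x) y) = 0"
      using im[of "x + \<i> *\<^sub>C y"] im[of x] im[of "\<i> *\<^sub>C y"]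
      by (simp add: blinfun.add_right cinner_add_left cinner_add_right bounded_opsD[OF A]
          cinner_scaleC_left cinner_scaleC_right)
    ultimately show ?thesis by (simp add: complex_eq_iff)
  qed
  then show ?thesis
    unfolding hermitian_def using A by (metis cinner_commute)
qed

lemma positive_op_iff:
  "positive_op A \<longleftrightarrow> hermitian A \<and> (\<forall>x. 0 \<le> inner (blinfun_apply A x) x)"
proof
  assume "positive_op A"
  then show "hermitian A \<and> (\<forall>x. 0 \<le> inner (blinfun_apply A x) x)"
    by (simp add: positive_op_hermitian)
      (simp add: positive_op_def complex_nonneg_Reals_iff inner_eq_Re_cinner)
next
  assume *: "hermitian A \<and> (\<forall>x. 0 \<le> inner (blinfun_apply A x) x)"
  have "Im (cinner (blinfun_apply A x) x) = 0" for x
  proof -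
    have "cinner (blinfun_apply A x) x = cnj (cinner (blinfun_apply A x) x)"
      using * unfolding hermitian_def by (metis cinner_commute)
    then show ?thesis by (simp add: complex_eq_iff)
  qed
  then show "positive_op A"
    using * by (auto simp: positive_op_def complex_nonneg_Reals_iff hermitian_def inner_eq_Re_cinner)
qed

lemma positive_op_bounded_ops: "positive_op A \<Longrightarrow> A \<in> bounded_ops"
  by (simp add: positive_op_def)

lemma positive_op_inner_nonneg: "positive_op A \<Longrightarrow> 0 \<le> inner (blinfun_apply A x) x"
  by (simp add: positive_op_iff)

lemma cinner_positive_op:
  "positive_op A \<Longrightarrow> cinner (blinfun_apply A x) x = of_real (inner (blinfun_apply A x) x)"
  by (simp add: positive_op_def complex_nonneg_Reals_iff inner_eq_Re_cinner complex_eq_iff)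

lemma positive_op_add: "positive_op A \<Longrightarrow> positive_op B \<Longrightarrow> positive_op (A + B)"
  by (simp add: positive_op_def bounded_ops_add blinfun.add_left cinner_add_left)

lemma positive_op_conj:
  assumes "positive_op Y" "A \<in> bounded_ops"
  shows "positive_op (A o\<^sub>L Y o\<^sub>L adj A)"
proof -
  have "cinner (blinfun_apply (A o\<^sub>L Y o\<^sub>L adj A) x) x
      = cinner (blinfun_apply Y (blinfun_apply (adj A) x)) (blinfun_apply (adj A) x)" for x
    by (simp add: cinner_adj_right[OF assms(2)])
  then show ?thesis
    using assms by (auto simp: positive_op_def intro!: bounded_ops_compose adj_in_bounded_ops)
qed

text \<open>The polynomial \<open>t \<mapsto> inner (A (x + t y)) (x + t y)\<close> is nonnegative,
  so its discriminant cannot be positive; a vanishing leading coefficient is treated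
  separately.\<close>

lemma positive_op_cauchy_schwarz:
  assumes "positive_op A"
  shows "(inner (blinfun_apply A x) y)\<^sup>2
    \<le> inner (blinfun_apply A x) x * inner (blinfun_apply A y) y"
proof -
  let ?a = "inner (blinfun_apply A x) x" and ?b = "inner (blinfun_apply A x) y"
    and ?c = "inner (blinfun_apply A y) y"
  have sym: "inner (blinfun_apply A y) x = ?b"
    using hermitian_inner[OF positive_op_hermitian[OF assms]] by (metis inner_commute)
  have pos: "0 \<le> ?a + 2 * t * ?b + t\<^sup>2 * ?c" for t
    using positive_op_inner_nonneg[OF assms, of "x + t *\<^sub>R y"]
    by (simp add: blinfun.add_right blinfun.scaleR_right inner_simps sym power2_eq_square algebra_simps)
  show ?thesis
  proof (cases "?c = 0")
    case True
    have "?b = 0"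
    proof (rule ccontr)
      assume b: "?b \<noteq> 0"
      \<comment> \<open>With \<open>?c = 0\<close> the form is affine in \<open>t\<close>, and this
        value of \<open>t\<close> drives it down to \<open>- ?a - 2\<close>.\<close>
      have "0 \<le> ?a + 2 * (- (?a + 1) / ?b) * ?b"
        using pos[of "- (?a + 1) / ?b"] True by simp
      also have "\<dots> = - ?a - 2" using b by (simp add: field_simps)
      finally show False using positive_op_inner_nonneg[OF assms, of x] by simp
    qed
    then show ?thesis using True by simp
  next
    case False
    then have c: "?c > 0" using positive_op_inner_nonneg[OF assms, of y] by simp
    have "0 \<le> ?a + 2 * (- ?b / ?c) * ?b + (- ?b / ?c)\<^sup>2 * ?c" by (rule pos)
    also have "\<dots> = ?a - ?b\<^sup>2 / ?c" using c by (simp add: power2_eq_square field_simps)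
    finally show ?thesis using c by (simp add: field_simps)
  qed
qed

lemma positive_op_null:
  assumes "positive_op A" "inner (blinfun_apply A x) x = 0"
  shows "blinfun_apply A x = 0"
  using positive_op_cauchy_schwarz[OF assms(1), of x "blinfun_apply A x"] assms(2) by simp

text \<open>Cauchy-Schwarz for the form of \<open>A\<close> at the pair \<open>x\<close>,
  \<open>A x\<close> gives \<open>|A x|^4 \<le> |x|^2 |A x|^2\<close>.\<close>

lemma norm_positive_op_le:
  assumes "positive_op A" "\<And>x. inner (blinfun_apply A x) x \<le> (norm x)\<^sup>2"
  shows "norm A \<le> 1"
proof (rule norm_blinfun_bound)
  fix x
  let ?y = "blinfun_apply A x"
  have "(inner ?y ?y)\<^sup>2 \<le> inner (blinfun_apply A x) x * inner (blinfun_apply A ?y) ?y"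
    by (rule positive_op_cauchy_schwarz[OF assms(1)])
  also have "\<dots> \<le> (norm x)\<^sup>2 * (norm ?y)\<^sup>2"
    by (intro mult_mono assms positive_op_inner_nonneg) auto
  finally have "((norm ?y)\<^sup>2)\<^sup>2 \<le> (norm x)\<^sup>2 * (norm ?y)\<^sup>2"
    by (simp add: power2_norm_eq_inner)
  then have "(norm ?y)\<^sup>2 \<le> (norm x)\<^sup>2"
    unfolding power2_eq_square[of "(norm ?y)\<^sup>2"]
    by (cases "?y = 0") (simp, rule mult_right_le_imp_le[of _ "(norm ?y)\<^sup>2"], simp_all)
  then show "norm ?y \<le> 1 * norm x" using power2_le_imp_le[of "norm ?y" "norm x"] by simp
qed simp

lemma hermitian_id: "hermitian id_blinfun"
  by (simp add: hermitian_def)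

lemma id_minus_positive_op:
  assumes "positive_op A" "\<And>x. inner (blinfun_apply A x) x \<le> (norm x)\<^sup>2"
  shows "positive_op (id_blinfun - A)"
proof -
  have "hermitian (id_blinfun - A)"
    by (intro hermitian_diff hermitian_id positive_op_hermitian assms)
  then show ?thesis
    using assms(2) by (simp add: positive_op_iff blinfun.diff_left inner_diff_left flip: power2_norm_eq_inner)
qed

text \<open>For a contraction \<open>A\<close> the iteration converges in norm to a solution of \<open>2 Y = A + Y\<^sup>2\<close>,
  that is \<open>(1 - Y)\<^sup>2 = 1 - A\<close>: its increments are dominated by those of the same iteration
  started with the scalar \<open>1\<close>, which is increasing and bounded.\<close>

fun sqrt_iter :: "('a::complex_hilbert_space \<Rightarrow>\<^sub>L 'a) \<Rightarrow> nat \<Rightarrow> 'a \<Rightarrow>\<^sub>L 'a"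
  where
    "sqrt_iter A 0 = 0"
  | "sqrt_iter A (Suc n) = (1/2) *\<^sub>R (A + (sqrt_iter A n o\<^sub>L sqrt_iter A n))"

fun sqrt_bound :: "nat \<Rightarrow> real"
  where
    "sqrt_bound 0 = 0"
  | "sqrt_bound (Suc n) = (1 + (sqrt_bound n)\<^sup>2) / 2"

lemma sqrt_bound_range: "0 \<le> sqrt_bound n \<and> sqrt_bound n \<le> 1"
  by (induction n) (auto simp: power_le_one)

lemma sqrt_bound_Suc: "sqrt_bound n \<le> sqrt_bound (Suc n)"
  using zero_le_power2[of "sqrt_bound n - 1"] by (simp add: power2_eq_square algebra_simps)

lemma norm_sqrt_iter:
  assumes "norm A \<le> 1"
  shows "norm (sqrt_iter A n) \<le> sqrt_bound n"
proof (induction n)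
  case (Suc n)
  have "norm (sqrt_iter A n o\<^sub>L sqrt_iter A n) \<le> norm (sqrt_iter A n) * norm (sqrt_iter A n)"
    by (rule norm_blinfun_compose)
  also have "\<dots> \<le> sqrt_bound n * sqrt_bound n"
    by (intro mult_mono Suc) (auto simp: sqrt_bound_range)
  finally have "norm (A + (sqrt_iter A n o\<^sub>L sqrt_iter A n)) \<le> 1 + (sqrt_bound n)\<^sup>2"
    using assms by (intro norm_triangle_le) (simp add: power2_eq_square)
  then show ?case by simp
qed simp

text \<open>The identity \<open>Y Y - X X = (Y - X) Y + X (Y - X)\<close> needs no commutativity.
  The scalar increments obey the same identity with nonnegative factors, so the domination passes
  from one step to the next.\<close>

lemma norm_sqrt_iter_diff:
  assumes "norm A \<le> 1"
  shows "norm (sqrt_iter A (Suc n) - sqrt_iter A n) \<le> sqrt_bound (Suc n) - sqrt_bound n"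
proof (induction n)
  case (Suc n)
  let ?Y = "sqrt_iter A (Suc n)" and ?X = "sqrt_iter A n"
    and ?y = "sqrt_bound (Suc n)" and ?x = "sqrt_bound n"
  note [simp del] = sqrt_iter.simps sqrt_bound.simps
  have "sqrt_iter A (Suc (Suc n)) - ?Y = (1/2) *\<^sub>R (((?Y - ?X) o\<^sub>L ?Y) + (?X o\<^sub>L (?Y - ?X)))"
    unfolding sqrt_iter.simps(2)[of A "Suc n"]
    by (subst (3) sqrt_iter.simps(2), intro blinfun_eqI)
      (simp add: blinfun.bilinear_simps algebra_simps)
  also have "norm \<dots> \<le> (1/2) * (norm (?Y - ?X) * norm ?Y + norm ?X * norm (?Y - ?X))"
    by (simp, intro norm_triangle_le add_mono norm_blinfun_compose)
  also have "\<dots> \<le> (1/2) * ((?y - ?x) * ?y + ?x * (?y - ?x))"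
    using Suc norm_sqrt_iter[OF assms, of "Suc n"] norm_sqrt_iter[OF assms, of n]
      sqrt_bound_range[of n] sqrt_bound_range[of "Suc n"] sqrt_bound_Suc[of n]
    by (intro mult_left_mono add_mono mult_mono) auto
  also have "\<dots> = sqrt_bound (Suc (Suc n)) - ?y"
    by (subst (5) sqrt_bound.simps, subst (3) sqrt_bound.simps)
      (simp add: power2_eq_square field_simps)
  finally show ?case .
qed (use assms in auto)

lemma convergent_sqrt_iter:
  assumes "norm A \<le> 1"
  shows "convergent (sqrt_iter A)"
proof -
  have mono: "incseq sqrt_bound"
    by (rule incseq_SucI) (rule sqrt_bound_Suc)
  have "convergent sqrt_bound"
    using mono sqrt_bound_range by (intro Bseq_mono_convergent[OF BseqI'[of _ 1]]) (auto simp: incseq_def)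
  then have C: "Cauchy sqrt_bound" by (rule convergent_Cauchy)
  have *: "norm (sqrt_iter A (n + d) - sqrt_iter A n) \<le> sqrt_bound (n + d) - sqrt_bound n" for n d
  proof (induction d)
    case (Suc d)
    have "norm (sqrt_iter A (Suc (n + d)) - sqrt_iter A n)
        \<le> norm (sqrt_iter A (Suc (n + d)) - sqrt_iter A (n + d)) + norm (sqrt_iter A (n + d) - sqrt_iter A n)"
      using norm_triangle_ineq[of "sqrt_iter A (Suc (n + d)) - sqrt_iter A (n + d)"
          "sqrt_iter A (n + d) - sqrt_iter A n"] by simp
    then show ?case using Suc norm_sqrt_iter_diff[OF assms, of "n + d"] by simp
  qed simp
  have "Cauchy (sqrt_iter A)"
  proof (rule CauchyI')
    fix e :: real assume "0 < e"
    then obtain M where M: "\<And>m n. M \<le> m \<Longrightarrow> M \<le> n \<Longrightarrow> norm (sqrt_bound m - sqrt_bound n) < e"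
      using CauchyD[OF C] by blast
    have "dist (sqrt_iter A m) (sqrt_iter A n) < e" if "M \<le> m" "m < n" for m n
      using *[of m "n - m"] M[of m n] that
      by (simp add: dist_norm norm_minus_commute)
    then show "\<exists>M. \<forall>m\<ge>M. \<forall>n>m. dist (sqrt_iter A m) (sqrt_iter A n) < e" by blast
  qed
  then show ?thesis by (rule Cauchy_convergent)
qed

lemma hermitian_sqrt_iter:
  assumes "hermitian A"
  shows "hermitian (sqrt_iter A n)"
  by (induction n)
    (use assms in \<open>auto simp: hermitian_def blinfun.bilinear_simps cinner_add_left cinner_add_right
      cinner_scaleR_left cinner_scaleR_right intro!: bounded_ops_add bounded_ops_scaleR bounded_ops_compose\<close>)

text \<open>Each iterate is a polynomial in \<open>A\<close>, so whatever commutes with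
  \<open>A\<close> commutes with the iterates and later with their norm limit. Uniqueness of the
  square root rests on this.\<close>

lemma sqrt_iter_commute:
  assumes "C o\<^sub>L A = A o\<^sub>L C"
  shows "C o\<^sub>L sqrt_iter A n = sqrt_iter A n o\<^sub>L C"
proof (induction n)
  case (Suc n)
  have "blinfun_apply C (blinfun_apply A x) = blinfun_apply A (blinfun_apply C x)"
    "blinfun_apply C (blinfun_apply (sqrt_iter A n) x) = blinfun_apply (sqrt_iter A n) (blinfun_apply C x)"
    for x using assms Suc by (metis blinfun_apply_blinfun_compose)+
  then show ?case
    by (intro blinfun_eqI) (simp add: blinfun.bilinear_simps)
qed (auto intro: blinfun_eqI simp: blinfun.bilinear_simps)

text \<open>With \<open>A = I - D\<close> and a fixed point \<open>2 Y = A + Y Y\<close>, the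
  operator \<open>S = I - Y\<close> squares to \<open>I - A = D\<close>. Positivity of
  \<open>S\<close> comes from \<open>norm Y \<le> 1\<close>, which the scalar bounds preserve in the
  limit.\<close>

lemma sqrt_exists_contraction:
  fixes D :: "'a::complex_hilbert_space \<Rightarrow>\<^sub>L 'a"
  assumes "positive_op D" "\<And>x. inner (blinfun_apply D x) x \<le> (norm x)\<^sup>2"
  shows "\<exists>S. positive_op S \<and> S o\<^sub>L S = D \<and> (\<forall>C. C o\<^sub>L D = D o\<^sub>L C \<longrightarrow> C o\<^sub>L S = S o\<^sub>L C)"
proof -
  define A where "A = id_blinfun - D"
  have pA: "positive_op A"
    unfolding A_def by (rule id_minus_positive_op) (use assms in auto)
  have nA: "norm A \<le> 1"
    by (rule norm_positive_op_le[OF pA])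
      (use assms in \<open>auto simp: A_def blinfun.diff_left inner_diff_left power2_norm_eq_inner positive_op_inner_nonneg\<close>)
  obtain Y where Y: "sqrt_iter A \<longlonglongrightarrow> Y"
    using convergent_sqrt_iter[OF nA] convergent_def by blast
  note bb = bounded_bilinear.tendsto[OF bounded_bilinear_blinfun_compose]
  have "(\<lambda>n. sqrt_iter A (Suc n)) \<longlonglongrightarrow> (1/2) *\<^sub>R (A + (Y o\<^sub>L Y))"
    unfolding sqrt_iter.simps by (intro tendsto_intros bb Y)
  then have "(1/2) *\<^sub>R (A + (Y o\<^sub>L Y)) = Y"
    using LIMSEQ_unique LIMSEQ_Suc[OF Y] by blast
  then have "2 *\<^sub>R ((1/2) *\<^sub>R (A + (Y o\<^sub>L Y))) = 2 *\<^sub>R Y" by (rule arg_cong)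
  then have YY: "Y o\<^sub>L Y = 2 *\<^sub>R Y - A" by (simp add: algebra_simps)
  have nY: "norm Y \<le> 1"
    by (rule LIMSEQ_le_const2[OF tendsto_norm[OF Y]])
      (use norm_sqrt_iter[OF nA] sqrt_bound_range order_trans in blast)
  have Yx: "(\<lambda>n. blinfun_apply (sqrt_iter A n) x) \<longlonglongrightarrow> blinfun_apply Y x" for x
    by (intro blinfun.tendsto Y tendsto_const)
  have hY: "hermitian Y"
    unfolding hermitian_def
  proof (intro conjI allI bounded_opsI)
    fix c x y
    note h = hermitian_sqrt_iter[OF positive_op_hermitian[OF pA]]
    have "(\<lambda>n. blinfun_apply (sqrt_iter A n) (c *\<^sub>C x)) \<longlonglongrightarrow> c *\<^sub>C blinfun_apply Y x"
      using bounded_linear.tendsto[OF bounded_linear_scaleC Yx, of c x] h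
      by (simp add: hermitian_def bounded_opsD)
    then show "blinfun_apply Y (c *\<^sub>C x) = c *\<^sub>C blinfun_apply Y x"
      using LIMSEQ_unique Yx by blast
    have "(\<lambda>n. cinner (blinfun_apply (sqrt_iter A n) x) y) \<longlonglongrightarrow> cinner x (blinfun_apply Y y)"
      using tendsto_cinner[OF tendsto_const Yx, of x y] h by (simp add: hermitian_def)
    then show "cinner (blinfun_apply Y x) y = cinner x (blinfun_apply Y y)"
      using LIMSEQ_unique tendsto_cinner[OF Yx tendsto_const] by blast
  qed
  define S where "S = id_blinfun - Y"
  have "hermitian S"
    unfolding S_def by (rule hermitian_diff[OF hermitian_id hY])
  moreover have "0 \<le> inner (blinfun_apply S x) x" for x
  proof -
    have "inner (blinfun_apply Y x) x \<le> norm (blinfun_apply Y x) * norm x"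
      by (rule norm_cauchy_schwarz)
    also have "\<dots> \<le> (1 * norm x) * norm x"
      by (intro mult_right_mono order_trans[OF norm_blinfun] nY) auto
    finally show ?thesis
      by (simp add: S_def blinfun.diff_left inner_diff_left power2_norm_eq_inner flip: power2_eq_square)
  qed
  moreover have "S o\<^sub>L S = D"
  proof (rule blinfun_eqI)
    fix x
    have "blinfun_apply (Y o\<^sub>L Y) x = blinfun_apply (2 *\<^sub>R Y - A) x" by (simp only: YY)
    then show "blinfun_apply (S o\<^sub>L S) x = blinfun_apply D x"
      by (simp add: S_def A_def blinfun.bilinear_simps scaleR_2 algebra_simps)
  qed
  moreover have "C o\<^sub>L S = S o\<^sub>L C" if C: "C o\<^sub>L D = D o\<^sub>L C" for C
  proof -
    have "C o\<^sub>L A = A o\<^sub>L C"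
    proof (rule blinfun_eqI)
      fix x
      have "blinfun_apply C (blinfun_apply D x) = blinfun_apply D (blinfun_apply C x)"
        using C by (metis blinfun_apply_blinfun_compose)
      then show "blinfun_apply (C o\<^sub>L A) x = blinfun_apply (A o\<^sub>L C) x"
        by (simp add: A_def blinfun.bilinear_simps)
    qed
    then have "C o\<^sub>L sqrt_iter A n = sqrt_iter A n o\<^sub>L C" for n
      by (rule sqrt_iter_commute)
    moreover have "(\<lambda>n. C o\<^sub>L sqrt_iter A n) \<longlonglongrightarrow> (C o\<^sub>L Y)" "(\<lambda>n. sqrt_iter A n o\<^sub>L C) \<longlonglongrightarrow> (Y o\<^sub>L C)"
      by (intro bb Y tendsto_const)+
    ultimately have CY: "C o\<^sub>L Y = Y o\<^sub>L C" using LIMSEQ_unique by simp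
    show ?thesis
    proof (rule blinfun_eqI)
      fix x
      have "blinfun_apply C (blinfun_apply Y x) = blinfun_apply Y (blinfun_apply C x)"
        using CY by (metis blinfun_apply_blinfun_compose)
      then show "blinfun_apply (C o\<^sub>L S) x = blinfun_apply (S o\<^sub>L C) x"
        by (simp add: S_def blinfun.bilinear_simps)
    qed
  qed
  ultimately show ?thesis unfolding positive_op_iff by blast
qed

lemma positive_op_scaleR: "positive_op A \<Longrightarrow> 0 \<le> r \<Longrightarrow> positive_op (r *\<^sub>R A)"
  by (auto simp: positive_op_iff hermitian_def bounded_ops_scaleR blinfun.scaleR_left
      cinner_scaleR_left cinner_scaleR_right)

lemma sqrt_exists:
  fixes D :: "'a::complex_hilbert_space \<Rightarrow>\<^sub>L 'a"
  assumes "positive_op D"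
  shows "\<exists>S. positive_op S \<and> S o\<^sub>L S = D \<and> (\<forall>C. C o\<^sub>L D = D o\<^sub>L C \<longrightarrow> C o\<^sub>L S = S o\<^sub>L C)"
proof -
  \<comment> \<open>Dividing by \<open>norm D + 1\<close> brings the form below
    \<open>|x|^2\<close>; the added 1 keeps the divisor positive when \<open>D = 0\<close>.\<close>
  define c where "c = norm D + 1"
  have c: "c > 0" by (simp add: c_def add_nonneg_pos)
  then have c': "0 \<le> 1 / c" by simp
  have le: "inner (blinfun_apply ((1/c) *\<^sub>R D) x) x \<le> (norm x)\<^sup>2" for x
  proof -
    have "inner (blinfun_apply D x) x \<le> norm (blinfun_apply D x) * norm x"
      by (rule norm_cauchy_schwarz)
    also have "\<dots> \<le> (c * norm x) * norm x"
      by (intro mult_right_mono order_trans[OF norm_blinfun]) (auto simp: c_def)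
    finally show ?thesis using c by (simp add: blinfun.scaleR_left power2_eq_square field_simps)
  qed
  obtain S where S: "positive_op S" "S o\<^sub>L S = (1/c) *\<^sub>R D"
    "\<And>C. C o\<^sub>L ((1/c) *\<^sub>R D) = ((1/c) *\<^sub>R D) o\<^sub>L C \<Longrightarrow> C o\<^sub>L S = S o\<^sub>L C"
    using sqrt_exists_contraction[OF positive_op_scaleR[OF assms c'] le] by blast
  have "(sqrt c *\<^sub>R S) o\<^sub>L (sqrt c *\<^sub>R S) = c *\<^sub>R (S o\<^sub>L S)"
    using c by (intro blinfun_eqI) (simp add: blinfun.bilinear_simps)
  also have "\<dots> = D" using c by (simp add: S(2))
  finally have "(sqrt c *\<^sub>R S) o\<^sub>L (sqrt c *\<^sub>R S) = D" .
  moreover have "C o\<^sub>L (sqrt c *\<^sub>R S) = (sqrt c *\<^sub>R S) o\<^sub>L C" if C: "C o\<^sub>L D = D o\<^sub>L C" for C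
  proof -
    note bb = bounded_bilinear.scaleR_left[OF bounded_bilinear_blinfun_compose]
      bounded_bilinear.scaleR_right[OF bounded_bilinear_blinfun_compose]
    have "C o\<^sub>L S = S o\<^sub>L C"
      by (rule S(3)) (simp only: bb C)
    then show ?thesis by (simp only: bb)
  qed
  moreover have "positive_op (sqrt c *\<^sub>R S)"
    using positive_op_scaleR[OF S(1)] c by simp
  ultimately show ?thesis by blast
qed

text \<open>\<open>B\<close> commutes with \<open>B B = S S\<close>, hence with \<open>S\<close>, so
  \<open>(S + B) (S - B) = 0\<close>. For \<open>z\<close> in the range of \<open>S - B\<close> the
  two nonnegative forms therefore vanish, so \<open>S z = B z = 0\<close> and
  \<open>(S - B) (S - B) = 0\<close>; self-adjointness of \<open>S - B\<close> finishes.\<close>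

lemma sqrt_unique:
  assumes S: "positive_op S" "\<And>C. C o\<^sub>L (S o\<^sub>L S) = (S o\<^sub>L S) o\<^sub>L C \<Longrightarrow> C o\<^sub>L S = S o\<^sub>L C"
    and B: "positive_op B" "B o\<^sub>L B = S o\<^sub>L S"
  shows "B = S"
proof -
  have "B o\<^sub>L S = S o\<^sub>L B"
    by (rule S(2), unfold B(2)[symmetric], rule blinfun_eqI) simp
  then have comm: "blinfun_apply B (blinfun_apply S x) = blinfun_apply S (blinfun_apply B x)" for x
    by (metis blinfun_apply_blinfun_compose)
  have sq: "blinfun_apply B (blinfun_apply B x) = blinfun_apply S (blinfun_apply S x)" for x
    using B(2) by (metis blinfun_apply_blinfun_compose)
  define X where "X = S - B"
  have hX: "hermitian X"
    unfolding X_def by (intro hermitian_diff positive_op_hermitian S B)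
  have "blinfun_apply X x = 0" for x
  proof -
    let ?z = "blinfun_apply X x"
    have "blinfun_apply S ?z + blinfun_apply B ?z = 0"
      by (simp add: X_def blinfun.bilinear_simps comm sq)
    then have "inner (blinfun_apply S ?z) ?z + inner (blinfun_apply B ?z) ?z = 0"
      by (metis inner_add_left inner_zero_left)
    then have "inner (blinfun_apply S ?z) ?z = 0" "inner (blinfun_apply B ?z) ?z = 0"
      using positive_op_inner_nonneg[OF S(1), of ?z] positive_op_inner_nonneg[OF B(1), of ?z] by auto
    then have "blinfun_apply S ?z = 0" "blinfun_apply B ?z = 0"
      using positive_op_null S(1) B(1) by auto
    then have "blinfun_apply X ?z = 0" by (simp add: X_def blinfun.diff_left)
    then have "inner ?z ?z = 0"
      using hermitian_inner[OF hX, of ?z x] by simp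
    then show ?thesis by simp
  qed
  then have "X = 0" by (intro blinfun_eqI) simp
  then show ?thesis by (simp add: X_def)
qed

lemma
  assumes "positive_op D"
  shows op_sqrt_positive: "positive_op (op_sqrt D)"
    and op_sqrt_compose: "op_sqrt D o\<^sub>L op_sqrt D = D"
    and op_sqrt_unique: "positive_op B \<Longrightarrow> B o\<^sub>L B = D \<Longrightarrow> op_sqrt D = B"
proof -
  obtain S where S: "positive_op S" "S o\<^sub>L S = D"
    "\<And>C. C o\<^sub>L D = D o\<^sub>L C \<Longrightarrow> C o\<^sub>L S = S o\<^sub>L C"
    using sqrt_exists[OF assms] by blast
  have uni: "B = S" if "positive_op B" "B o\<^sub>L B = D" for B
  proof (rule sqrt_unique[OF S(1) _ that(1)])
    show "C o\<^sub>L S = S o\<^sub>L C" if "C o\<^sub>L (S o\<^sub>L S) = (S o\<^sub>L S) o\<^sub>L C" for C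
      using that unfolding S(2) by (rule S(3))
    show "B o\<^sub>L B = S o\<^sub>L S" by (simp only: S(2) that)
  qed
  have "op_sqrt D = S"
    unfolding op_sqrt_def by (rule the_equality) (simp_all add: S(1,2) uni)
  then show "positive_op (op_sqrt D)" "op_sqrt D o\<^sub>L op_sqrt D = D"
    "positive_op B \<Longrightarrow> B o\<^sub>L B = D \<Longrightarrow> op_sqrt D = B"
    using S(1,2) uni[of B] by simp_all
qed

lemma inner_op_sqrt:
  assumes "positive_op D"
  shows "inner (blinfun_apply D x) x = (norm (blinfun_apply (op_sqrt D) x))\<^sup>2"
proof -
  have "blinfun_apply D x = blinfun_apply (op_sqrt D) (blinfun_apply (op_sqrt D) x)"
    using op_sqrt_compose[OF assms] by (metis blinfun_apply_blinfun_compose)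
  then show ?thesis
    using hermitian_inner[OF positive_op_hermitian[OF op_sqrt_positive[OF assms]]]
    by (simp add: power2_norm_eq_inner)
qed

lemma op_abs_positive: "positive_op D \<Longrightarrow> op_abs D = D"
proof -
  assume D: "positive_op D"
  have h: "adj D = D" by (intro adj_hermitian positive_op_hermitian D)
  have "positive_op (D o\<^sub>L id_blinfun o\<^sub>L adj D)"
    by (intro positive_op_conj positive_op_bounded_ops D)
      (simp add: positive_op_iff hermitian_id)
  moreover have "D o\<^sub>L id_blinfun o\<^sub>L D = D o\<^sub>L D" by (rule blinfun_eqI) simp
  ultimately have "positive_op (D o\<^sub>L D)" by (simp add: h)
  then show ?thesis
    unfolding op_abs_def h by (rule op_sqrt_unique) (use D in auto)
qed

section \<open>Orthonormal bases and the trace\<close>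

lemma is_onb_cinner: "is_onb E \<Longrightarrow> e \<in> E \<Longrightarrow> f \<in> E \<Longrightarrow> cinner e f = (if e = f then 1 else 0)"
  by (auto simp: is_onb_def pairwise_def cinner_self)

section \<open>Parseval's identity and Hilbert-Schmidt sums\<close>

lemma complex_subspace_orthogonal: "complex_vector.subspace {y. cinner x y = 0}"
  by (rule complex_vector.subspaceI) (auto simp: cinner_add_right cinner_scaleC_right)

lemma cinner_span_eq_0:
  assumes "\<And>y. y \<in> S \<Longrightarrow> cinner x y = 0" "y \<in> complex_vector.span S"
  shows "cinner x y = 0"
  using complex_vector.span_minimal[OF _ complex_subspace_orthogonal, of S x] assms by blast

lemma complex_subspace_closure:
  assumes "complex_vector.subspace M"
  shows "complex_vector.subspace (closure M)"
proof (rule complex_vector.subspaceI)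
  show "0 \<in> closure M"
    using complex_vector.subspace_0[OF assms] closure_subset by blast
next
  fix x y assume "x \<in> closure M" "y \<in> closure M"
  then obtain u v where "\<And>n. u n \<in> M" "u \<longlonglongrightarrow> x" "\<And>n. v n \<in> M" "v \<longlonglongrightarrow> y"
    unfolding closure_sequential by blast
  then have "\<forall>n. u n + v n \<in> M" "(\<lambda>n. u n + v n) \<longlonglongrightarrow> x + y"
    using complex_vector.subspace_add[OF assms] by (auto intro: tendsto_add)
  then show "x + y \<in> closure M"
    unfolding closure_sequential by (intro exI[of _ "\<lambda>n. u n + v n"] conjI)
next
  fix c x assume "x \<in> closure M"
  then obtain u where u: "\<And>n. u n \<in> M" "u \<longlonglongrightarrow> x" unfolding closure_sequential by blast
  have "\<forall>n. c *\<^sub>C u n \<in> M" "(\<lambda>n. c *\<^sub>C u n) \<longlonglongrightarrow> c *\<^sub>C x"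
    using complex_vector.subspace_scale[OF assms] u bounded_linear.tendsto[OF bounded_linear_scaleC]
    by auto
  then show "c *\<^sub>C x \<in> closure M"
    unfolding closure_sequential by (intro exI[of _ "\<lambda>n. c *\<^sub>C u n"] conjI)
qed

lemma pythagoras_cinner:
  assumes "cinner x y = 0"
  shows "(norm (x + y))\<^sup>2 = (norm x)\<^sup>2 + (norm y)\<^sup>2"
proof -
  have "inner x y = 0" using assms by (simp add: inner_eq_Re_cinner)
  then show ?thesis unfolding power2_norm_eq_inner by (simp add: inner_simps inner_commute)
qed

lemma orthonormal_expansion:
  fixes x :: "'a::complex_hilbert_space"
  assumes E: "is_onb E" and F: "finite F" "F \<subseteq> E"
  defines "p \<equiv> (\<Sum>e\<in>F. cinner x e *\<^sub>C e)"
  shows "y \<in> complex_vector.span F \<Longrightarrow> cinner (x - p) y = 0"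
    and "(norm x)\<^sup>2 - (\<Sum>e\<in>F. (cmod (cinner x e))\<^sup>2) = (norm (x - p))\<^sup>2"
proof -
  have pF: "p \<in> complex_vector.span F"
    unfolding p_def
    by (intro complex_vector.span_sum complex_vector.span_scale complex_vector.span_base)
  have pf: "cinner p f = cinner x f" if "f \<in> F" for f
  proof -
    have "cinner p f = (\<Sum>e\<in>F. cinner x e * cinner e f)"
      by (simp add: p_def cinner_sum_left cinner_scaleC_left)
    also have "\<dots> = (\<Sum>e\<in>F. if e = f then cinner x e else 0)"
      using that by (intro sum.cong refl) (simp add: is_onb_cinner[OF E] subsetD[OF F(2)])
    finally show ?thesis using F that by simp
  qed
  show orth: "cinner (x - p) y = 0" if "y \<in> complex_vector.span F" for y
    by (rule cinner_span_eq_0[OF _ that]) (simp add: cinner_diff_left pf)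
  have "cinner p p = (\<Sum>e\<in>F. cnj (cinner x e) * cinner p e)"
    by (subst (2) p_def) (simp add: cinner_sum_right cinner_scaleC_right)
  also have "\<dots> = (\<Sum>e\<in>F. of_real ((cmod (cinner x e))\<^sup>2))"
    by (intro sum.cong) (simp_all only: pf complex_norm_square mult.commute)
  finally have "of_real ((norm p)\<^sup>2) = (of_real (\<Sum>e\<in>F. (cmod (cinner x e))\<^sup>2) :: complex)"
    by (simp add: cinner_self)
  then have "(norm p)\<^sup>2 = (\<Sum>e\<in>F. (cmod (cinner x e))\<^sup>2)" by (simp only: of_real_eq_iff)
  moreover have "(norm x)\<^sup>2 = (norm (x - p))\<^sup>2 + (norm p)\<^sup>2"
    using pythagoras_cinner[OF orth[OF pF]] by simp
  ultimately show "(norm x)\<^sup>2 - (\<Sum>e\<in>F. (cmod (cinner x e))\<^sup>2) = (norm (x - p))\<^sup>2" by simp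
qed

text \<open>Density supplies \<open>y\<close> near \<open>x\<close> in the span of a finite
  \<open>F\<close>. For every finite \<open>G\<close> between \<open>F\<close> and \<open>E\<close>
  the expansion over \<open>G\<close> is the projection of \<open>x\<close> onto the span of
  \<open>G\<close>, hence at least as close to \<open>x\<close> as \<open>y\<close>; its squared
  distance from \<open>x\<close> is exactly the error of the partial sum.\<close>

lemma parseval:
  assumes E: "is_onb E"
  shows "((\<lambda>e. (cmod (cinner x e))\<^sup>2) has_sum (norm x)\<^sup>2) E"
  unfolding has_sum_def
proof (rule tendstoI)
  fix r :: real assume r: "0 < r"
  have "x \<in> closure (complex_vector.span E)" using E by (simp add: is_onb_def)
  then obtain y where y: "y \<in> complex_vector.span E" "dist y x < sqrt r"
    using real_sqrt_gt_zero[OF r] unfolding closure_approachable by blast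
  obtain F r' where F: "finite F" "F \<subseteq> E" and y': "y = (\<Sum>e\<in>F. r' e *\<^sub>C e)"
    using y(1) unfolding complex_vector.span_explicit by blast
  have yF: "y \<in> complex_vector.span F"
    unfolding y'
    by (intro complex_vector.span_sum complex_vector.span_scale complex_vector.span_base)
  have "dist (\<Sum>e\<in>G. (cmod (cinner x e))\<^sup>2) ((norm x)\<^sup>2) < r"
    if G: "finite G" "F \<subseteq> G" "G \<subseteq> E" for G
  proof -
    define p where "p = (\<Sum>e\<in>G. cinner x e *\<^sub>C e)"
    note oe = orthonormal_expansion[where x = x, OF E G(1,3), folded p_def]
    have "y \<in> complex_vector.span G" using yF complex_vector.span_mono[OF G(2)] by blast
    moreover have "p \<in> complex_vector.span G"
      unfolding p_def
      by (intro complex_vector.span_sum complex_vector.span_scale complex_vector.span_base)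
    ultimately have "cinner (x - p) (p - y) = 0"
      by (intro oe(1) complex_vector.span_diff)
    then have "(norm (x - p))\<^sup>2 \<le> (norm (x - y))\<^sup>2"
      using pythagoras_cinner[of "x - p" "p - y"] by simp
    also have "\<dots> < (sqrt r)\<^sup>2"
      using y(2) by (intro power_strict_mono) (auto simp: dist_norm norm_minus_commute)
    also have "\<dots> = r" using r by simp
    finally have "(norm x)\<^sup>2 - (\<Sum>e\<in>G. (cmod (cinner x e))\<^sup>2) < r" using oe(2) by simp
    moreover have "0 \<le> (norm x)\<^sup>2 - (\<Sum>e\<in>G. (cmod (cinner x e))\<^sup>2)"
      using oe(2) by simp
    ultimately show ?thesis by (simp add: dist_real_def)
  qed
  then show "\<forall>\<^sub>F G in finite_subsets_at_top E. dist (\<Sum>e\<in>G. (cmod (cinner x e))\<^sup>2) ((norm x)\<^sup>2) < r"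
    unfolding eventually_finite_subsets_at_top using F by blast
qed

text \<open>The nonnegative numbers \<open>|cinner (A e) f|^2\<close> are summed over
  \<open>E \<times> F\<close> in both orders, and Parseval evaluates the inner sums. Two different
  bases yield basis independence of traces; a single basis with a general \<open>A\<close> yields
  the estimate for conjugated operators.\<close>

lemma hilbert_schmidt_adj:
  assumes E: "is_onb E" and F: "is_onb F" and A: "A \<in> bounded_ops"
    and s: "((\<lambda>e. (norm (blinfun_apply A e))\<^sup>2) has_sum s) E"
  shows "((\<lambda>f. (norm (blinfun_apply (adj A) f))\<^sup>2) has_sum s) F"
proof -
  let ?g = "\<lambda>(e, f). (cmod (cinner (blinfun_apply A e) f))\<^sup>2"
  have inner_sum: "((\<lambda>f. ?g (e, f)) has_sum (norm (blinfun_apply A e))\<^sup>2) F" for e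
    using parseval[OF F] by simp
  have "?g summable_on E \<times> F"
    by (rule summable_on_SigmaI[OF inner_sum]) (use s has_sum_imp_summable in auto)
  then have "(?g has_sum s) (E \<times> F)"
    by (rule has_sum_SigmaI[OF inner_sum s])
  then have sw: "((\<lambda>(f, e). ?g (e, f)) has_sum s) (F \<times> E)"
    by (subst (asm) has_sum_swap) simp
  show ?thesis
  proof (rule has_sum_SigmaD[OF sw])
    fix f
    have "cmod (cinner (blinfun_apply A e) f) = cmod (cinner (blinfun_apply (adj A) f) e)" for e
      by (metis cinner_adj_right[OF A] cinner_commute complex_mod_cnj)
    then show "((\<lambda>e. (\<lambda>(f, e). ?g (e, f)) (f, e)) has_sum (norm (blinfun_apply (adj A) f))\<^sup>2) E"
      using parseval[OF E, of "blinfun_apply (adj A) f"] by simp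
  qed
qed

definition finite_trace :: "'a::complex_hilbert_space set \<Rightarrow> ('a \<Rightarrow>\<^sub>L 'a) \<Rightarrow> bool"
  where "finite_trace E Y \<longleftrightarrow> positive_op Y \<and> (\<lambda>e. inner (blinfun_apply Y e) e) summable_on E"

definition pos_trace :: "'a::complex_hilbert_space set \<Rightarrow> ('a \<Rightarrow>\<^sub>L 'a) \<Rightarrow> real"
  where "pos_trace E Y = (\<Sum>\<^sub>\<infinity>e\<in>E. inner (blinfun_apply Y e) e)"

lemma pos_trace_nonneg: "finite_trace E Y \<Longrightarrow> 0 \<le> pos_trace E Y"
  unfolding pos_trace_def finite_trace_def by (intro infsum_nonneg positive_op_inner_nonneg) simp

lemma finite_trace_zero: "finite_trace E 0" "pos_trace E 0 = 0"
  by (auto simp: finite_trace_def positive_op_def pos_trace_def)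

lemma
  assumes "finite_trace E Y" "finite_trace E Z"
  shows finite_trace_add: "finite_trace E (Y + Z)"
    and pos_trace_add: "pos_trace E (Y + Z) = pos_trace E Y + pos_trace E Z"
  using assms
  by (auto simp: finite_trace_def pos_trace_def positive_op_add blinfun.add_left inner_add_left
      infsum_add intro: summable_on_add)

lemma
  assumes "\<And>i. i \<in> I \<Longrightarrow> finite_trace E (f i)"
  shows finite_trace_sum: "finite_trace E (\<Sum>i\<in>I. f i)"
    and pos_trace_sum: "pos_trace E (\<Sum>i\<in>I. f i) = (\<Sum>i\<in>I. pos_trace E (f i))"
proof -
  have "finite_trace E (\<Sum>i\<in>I. f i) \<and> pos_trace E (\<Sum>i\<in>I. f i) = (\<Sum>i\<in>I. pos_trace E (f i))"
    using assms
    by (induction I rule: infinite_finite_induct)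
      (auto simp: finite_trace_zero finite_trace_add pos_trace_add)
  then show "finite_trace E (\<Sum>i\<in>I. f i)"
    "pos_trace E (\<Sum>i\<in>I. f i) = (\<Sum>i\<in>I. pos_trace E (f i))" by auto
qed

text \<open>The trace of \<open>Y\<close> is the sum of \<open>|S e|^2\<close> with \<open>S\<close>
  its positive square root, and \<open>S\<close> is its own adjoint, so
  \<open>hilbert_schmidt_adj\<close> carries the sum from \<open>E\<close> to
  \<open>F\<close>.\<close>

lemma
  assumes "is_onb E" "is_onb F" "finite_trace E Y"
  shows finite_trace_onb_change: "finite_trace F Y"
    and pos_trace_onb_change: "pos_trace F Y = pos_trace E Y"
proof -
  have Y: "positive_op Y" using assms(3) by (simp add: finite_trace_def)
  note S = op_sqrt_positive[OF Y]
  have "((\<lambda>e. (norm (blinfun_apply (op_sqrt Y) e))\<^sup>2) has_sum pos_trace E Y) E"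
    using assms(3) by (simp add: finite_trace_def pos_trace_def flip: inner_op_sqrt[OF Y])
  from hilbert_schmidt_adj[OF assms(1,2) positive_op_bounded_ops[OF S] this]
  have "((\<lambda>e. inner (blinfun_apply Y e) e) has_sum pos_trace E Y) F"
    by (simp add: adj_hermitian positive_op_hermitian S flip: inner_op_sqrt[OF Y])
  then show "finite_trace F Y" "pos_trace F Y = pos_trace E Y"
    unfolding finite_trace_def pos_trace_def using Y has_sum_imp_summable infsumI by blast+
qed

text \<open>With \<open>S\<close> the square root of \<open>Y\<close>, the trace on the left is the
  sum of \<open>|S (adj A e)|^2\<close>, where \<open>adj A\<close> has moved the basis vectors and
  no termwise comparison is possible. Passing to the adjoint turns it into the sum of
  \<open>|A (S e)|^2\<close>, which is bounded term by term.\<close>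

lemma
  assumes E: "is_onb E" and Y: "finite_trace E Y" and A: "A \<in> bounded_ops" "norm A \<le> 1"
  shows finite_trace_conj: "finite_trace E (A o\<^sub>L Y o\<^sub>L adj A)"
    and pos_trace_conj_le: "pos_trace E (A o\<^sub>L Y o\<^sub>L adj A) \<le> pos_trace E Y"
proof -
  have pY: "positive_op Y" using Y by (simp add: finite_trace_def)
  define S where "S = op_sqrt Y"
  have S: "positive_op S" "\<And>x. inner (blinfun_apply Y x) x = (norm (blinfun_apply S x))\<^sup>2"
    unfolding S_def using op_sqrt_positive[OF pY] inner_op_sqrt[OF pY] by auto
  have bS: "S \<in> bounded_ops" "A o\<^sub>L S \<in> bounded_ops"
    using S(1) A(1) by (auto intro: positive_op_bounded_ops bounded_ops_compose)
  have sS: "(\<lambda>e. (norm (blinfun_apply S e))\<^sup>2) summable_on E"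
    using Y by (simp add: finite_trace_def S(2))
  have le: "(norm (blinfun_apply (A o\<^sub>L S) e))\<^sup>2 \<le> (norm (blinfun_apply S e))\<^sup>2" for e
  proof (rule power_mono)
    have "norm (blinfun_apply A (blinfun_apply S e)) \<le> norm A * norm (blinfun_apply S e)"
      by (rule norm_blinfun)
    also have "\<dots> \<le> 1 * norm (blinfun_apply S e)" by (intro mult_right_mono A) simp
    finally show "norm (blinfun_apply (A o\<^sub>L S) e) \<le> norm (blinfun_apply S e)" by simp
  qed simp
  have sAS: "(\<lambda>e. (norm (blinfun_apply (A o\<^sub>L S) e))\<^sup>2) summable_on E"
    by (rule summable_on_comparison_test[OF sS]) (use le in auto)
  have adjAS: "adj (A o\<^sub>L S) = S o\<^sub>L adj A"
    by (simp add: adj_compose A bS adj_hermitian positive_op_hermitian S(1))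
  have quad: "inner (blinfun_apply (A o\<^sub>L Y o\<^sub>L adj A) x) x = (norm (blinfun_apply (S o\<^sub>L adj A) x))\<^sup>2" for x
    using cinner_adj_right[OF A(1), of "blinfun_apply Y (blinfun_apply (adj A) x)" x]
    by (simp add: S(2)[symmetric] inner_eq_Re_cinner)
  have hs: "((\<lambda>e. inner (blinfun_apply (A o\<^sub>L Y o\<^sub>L adj A) e) e)
      has_sum (\<Sum>\<^sub>\<infinity>e\<in>E. (norm (blinfun_apply (A o\<^sub>L S) e))\<^sup>2)) E"
    unfolding quad adjAS[symmetric]
    by (rule hilbert_schmidt_adj[OF E E bS(2) has_sum_infsum[OF sAS]])
  then show "finite_trace E (A o\<^sub>L Y o\<^sub>L adj A)"
    using positive_op_conj[OF pY A(1)] has_sum_imp_summable by (auto simp: finite_trace_def)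
  have "pos_trace E (A o\<^sub>L Y o\<^sub>L adj A) = (\<Sum>\<^sub>\<infinity>e\<in>E. (norm (blinfun_apply (A o\<^sub>L S) e))\<^sup>2)"
    unfolding pos_trace_def using hs by (rule infsumI)
  also have "\<dots> \<le> pos_trace E Y"
    unfolding pos_trace_def S(2) by (rule infsum_mono[OF sAS sS le])
  finally show "pos_trace E (A o\<^sub>L Y o\<^sub>L adj A) \<le> pos_trace E Y" .
qed

text \<open>\<open>op_abs\<close> fixes positive operators, so the basis hidden in
  \<open>trace_class\<close> already gives a finite trace and only has to be exchanged for
  \<open>E\<close>.\<close>

lemma trace_class_finite_trace:
  assumes "trace_class Y" "positive_op Y" "is_onb E"
  shows "finite_trace E Y"
proof -
  obtain F where F: "is_onb F" "(\<lambda>e. cinner (blinfun_apply Y e) e) summable_on F"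
    using assms op_abs_positive[OF assms(2)] by (auto simp: trace_class_def)
  have "finite_trace F Y"
    using summable_on_Re[OF F(2)] assms(2) by (simp add: finite_trace_def inner_eq_Re_cinner)
  then show ?thesis by (rule finite_trace_onb_change[OF F(1) assms(3)])
qed

lemma op_trace_eq_pos_trace:
  assumes "finite_trace (SOME E. is_onb E) Y"
  shows "op_trace Y = of_real (pos_trace (SOME E. is_onb E) Y)"
proof -
  let ?E = "SOME E. is_onb E"
  have "((\<lambda>e. inner (blinfun_apply Y e) e) has_sum pos_trace ?E Y) ?E"
    using assms by (simp add: finite_trace_def pos_trace_def)
  from has_sum_of_real[OF this] show ?thesis
    unfolding op_trace_def using assms
    by (intro infsumI) (simp add: finite_trace_def cinner_positive_op)
qed

section \<open>Square-summable families and tensor products\<close>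

lemma l2_ext: "(\<And>i. l2_apply x i = l2_apply y i) \<Longrightarrow> x = y"
  by (simp add: fun_eq_iff flip: l2_apply_inject)

lemma cinner_l2_single:
  assumes "\<And>j. j \<noteq> i \<Longrightarrow> l2_apply y j = 0"
  shows "cinner x y = cinner (l2_apply x i) (l2_apply y i)"
proof -
  have "cinner x y = (\<Sum>\<^sub>\<infinity>j\<in>{i}. cinner (l2_apply x j) (l2_apply y j))"
    unfolding cinner_l2.rep_eq by (rule infsum_cong_neutral) (use assms in auto)
  then show ?thesis by simp
qed

lemma l2_norm_summable: "(\<lambda>i. (norm (l2_apply x i))\<^sup>2) summable_on UNIV"
  using l2_apply[of x] by simp

text \<open>Projection onto the coordinates in \<open>S\<close>, tensored with \<open>B\<close>.
  Both the homogeneous projections and the tensor operators of the curvature turn out to have this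
  form, which makes them diagonal in the index.\<close>

definition l2_restrict ::
  "'i set \<Rightarrow> ('a::complex_hilbert_space \<Rightarrow>\<^sub>L 'a) \<Rightarrow> ('i, 'a) l2 \<Rightarrow>\<^sub>L ('i, 'a) l2"
  where "l2_restrict S B = Blinfun (\<lambda>x. Abs_l2 (\<lambda>i. if i \<in> S then blinfun_apply B (l2_apply x i) else 0))"

lemma l2_apply_l2_restrict [simp]:
  "l2_apply (blinfun_apply (l2_restrict S B) x) i = (if i \<in> S then blinfun_apply B (l2_apply x i) else 0)"
proof -
  let ?r = "\<lambda>x i. if i \<in> S then blinfun_apply B (l2_apply x i) else 0"
  have le: "(norm (?r x i))\<^sup>2 \<le> (norm B)\<^sup>2 * (norm (l2_apply x i))\<^sup>2" for x i
    using power_mono[OF norm_blinfun norm_ge_zero, of B "l2_apply x i" 2]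
    by (auto simp: power_mult_distrib)
  have sB: "(\<lambda>i. (norm B)\<^sup>2 * (norm (l2_apply x i))\<^sup>2) summable_on UNIV" for x :: "('b, 'a) l2"
    by (intro summable_on_cmult_right l2_norm_summable)
  have summ: "(\<lambda>i. (norm (?r x i))\<^sup>2) summable_on UNIV" for x
    by (rule summable_on_comparison_test[OF sB[of x]]) (rule le, simp)
  have app: "l2_apply (Abs_l2 (?r x)) = ?r x" for x
    using summ by (intro Abs_l2_inverse) simp
  have "bounded_linear (\<lambda>x. Abs_l2 (?r x))"
  proof (rule bounded_linear_intro[where K = "norm B"])
    show "Abs_l2 (?r (x + y)) = Abs_l2 (?r x) + Abs_l2 (?r y)" for x y
      by (rule l2_ext) (simp add: app plus_l2.rep_eq blinfun.add_right)
    show "Abs_l2 (?r (c *\<^sub>R x)) = c *\<^sub>R Abs_l2 (?r x)" for c x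
      by (rule l2_ext) (simp add: app scaleR_l2.rep_eq blinfun.scaleR_right)
    show "norm (Abs_l2 (?r x)) \<le> norm x * norm B" for x
    proof (rule power2_le_imp_le)
      have "(norm (Abs_l2 (?r x)))\<^sup>2 \<le> (\<Sum>\<^sub>\<infinity>i. (norm B)\<^sup>2 * (norm (l2_apply x i))\<^sup>2)"
        unfolding norm_l2_square app by (rule infsum_mono[OF summ sB le])
      also have "\<dots> = (norm x * norm B)\<^sup>2"
        by (simp add: infsum_cmult_right' norm_l2_square power_mult_distrib mult.commute)
      finally show "(norm (Abs_l2 (?r x)))\<^sup>2 \<le> (norm x * norm B)\<^sup>2" .
    qed simp
  qed
  then show ?thesis
    unfolding l2_restrict_def by (simp only: bounded_linear_Blinfun_apply app)
qed

lemma l2_restrict_bounded_ops: "B \<in> bounded_ops \<Longrightarrow> l2_restrict S B \<in> bounded_ops"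
  by (intro bounded_opsI l2_ext) (simp add: scaleC_l2.rep_eq bounded_opsD)

section \<open>Basis vectors, Fock projections and tensor operators in coordinates\<close>

lemma etensor_ket:
  "l2_apply (etensor (map ket \<beta>) h) \<gamma> = (if \<gamma> = \<beta> then h else 0)"
proof (cases "length \<gamma> = length \<beta>")
  case True
  then have "prod_list (map2 l2_apply (map ket \<beta>) \<gamma>) = (if \<gamma> = \<beta> then 1 else 0)"
    by (induction \<gamma> \<beta> rule: list_induct2) (auto simp: ket.rep_eq)
  then show ?thesis using True by (simp add: l2_apply_etensor)
qed (auto simp: l2_apply_etensor)

lemma cinner_etensor_ket: "cinner x (etensor (map ket \<beta>) h) = cinner (l2_apply x \<beta>) h"
  by (subst cinner_l2_single[of \<beta>]) (simp_all add: etensor_ket)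

lemma cinner_ket: "cinner x (ket i) = l2_apply x i"
  by (subst cinner_l2_single[of i]) (simp_all add: ket.rep_eq cinner_complex_def)

text \<open>For density, the residual of any vector after projection onto the closed span is
  orthogonal to every \<open>ket i\<close>; its coordinates are these inner products, so it
  vanishes.\<close>

lemma is_onb_ket: "is_onb (range ket)"
  unfolding is_onb_def
proof (intro conjI ballI)
  show "pairwise (\<lambda>x y. cinner x y = 0) (range ket)"
    by (auto simp: pairwise_def cinner_ket ket.rep_eq)
  show "norm x = 1" if "x \<in> range ket" for x :: "('a, complex) l2"
  proof -
    have "cinner x x = 1" using that by (auto simp: cinner_ket ket.rep_eq)
    then have "(norm x)\<^sup>2 = 1" unfolding cinner_self by (metis of_real_eq_1_iff)
    then show ?thesis by (simp add: power2_eq_1_iff) (metis norm_ge_zero not_one_le_zero neg_0_le_iff_le)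
  qed
  let ?M = "closure (complex_vector.span (range ket)) :: ('a, complex) l2 set"
  have M: "complex_vector.subspace ?M" "closed ?M"
    by (simp_all add: complex_subspace_closure)
  have "x \<in> ?M" for x
  proof -
    let ?p = "blinfun_apply (proj_onto ?M) x"
    have "ket i \<in> ?M" for i
      using complex_vector.span_base[of "ket i" "range ket"] closure_subset by blast
    then have "l2_apply (x - ?p) i = 0" for i
      using proj_onto_props(3)[OF M] by (simp flip: cinner_ket)
    then have "x - ?p = 0" by (intro l2_ext) (simp add: zero_l2.rep_eq)
    then show ?thesis using proj_onto_props(2)[OF M, of x] by simp
  qed
  then show "?M = UNIV" by blast
qed

text \<open>Only finitely many words have a given length, so truncating a family to them is a finite
  combination of kets and lies in the span itself.\<close>

lemma fock_proj_eq:
  "fock_proj n q = l2_restrict {\<alpha> \<in> lists {..<n}. length \<alpha> = q} id_blinfun"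
  unfolding fock_proj_def
proof (rule proj_onto_unique)
  let ?W = "{\<alpha> \<in> lists {..<n}. length \<alpha> = q}"
  let ?P = "l2_restrict ?W id_blinfun :: (nat list, complex) l2 \<Rightarrow>\<^sub>L _"
  show "complex_vector.subspace (complex_vector.span (ket ` ?W))"
    by simp
  show "?P \<in> bounded_ops" by (simp add: l2_restrict_bounded_ops)
  have finW: "finite ?W"
    using finite_lists_length_eq[of "{..<n}" q] by (simp add: lists_eq_set)
  show "blinfun_apply ?P x \<in> complex_vector.span (ket ` ?W)" for x
  proof -
    have *: "l2_apply (\<Sum>\<alpha>\<in>F. l2_apply x \<alpha> *\<^sub>C ket \<alpha>) \<gamma> = (if \<gamma> \<in> F then l2_apply x \<gamma> else 0)"
      if "finite F" for F \<gamma>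
      using that
      by (induction F) (auto simp: zero_l2.rep_eq plus_l2.rep_eq scaleC_l2.rep_eq ket.rep_eq scaleC_complex_def)
    have "blinfun_apply ?P x = (\<Sum>\<alpha>\<in>?W. l2_apply x \<alpha> *\<^sub>C ket \<alpha>)"
      by (rule l2_ext) (simp add: *[OF finW])
    then show ?thesis
      by (simp only:, intro complex_vector.span_sum complex_vector.span_scale)
        (auto intro: complex_vector.span_base)
  qed
  show "cinner (x - blinfun_apply ?P x) y = 0" if "y \<in> complex_vector.span (ket ` ?W)" for x y
    by (rule cinner_span_eq_0[OF _ that]) (auto simp: cinner_ket minus_l2.rep_eq)
qed

lemma in_listset_iff: "\<beta> \<in> listset Ss \<longleftrightarrow> list_all2 (\<in>) \<beta> Ss"
  by (induction Ss arbitrary: \<beta>) (auto simp: set_Cons_def list_all2_Cons2)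

text \<open>If two candidates for the tensor product operator differ by \<open>\<Delta>\<close>, then the range of
  \<open>\<Delta>\<^sup>*\<close> is orthogonal to the elementary tensors, hence \<open>\<Delta> \<Delta>\<^sup>* = 0\<close>.\<close>

lemma tensor_op_restrict:
  fixes B :: "'a::complex_hilbert_space \<Rightarrow>\<^sub>L 'a" and Ss :: "'i set list"
  assumes B: "B \<in> bounded_ops"
  shows "tensor_op (map (\<lambda>S. l2_restrict S id_blinfun) Ss) B = l2_restrict (listset Ss) B"
proof -
  let ?As = "map (\<lambda>S. l2_restrict S id_blinfun) Ss :: (('i, complex) l2 \<Rightarrow>\<^sub>L _) list"
  let ?Q = "\<lambda>C. C \<in> bounded_ops \<and>
    (\<forall>fs h. length fs = length ?As \<longrightarrow>
      blinfun_apply C (etensor fs h) = etensor (map2 blinfun_apply ?As fs) (blinfun_apply B h)) \<and>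
    (\<forall>x. (\<forall>fs h. length fs = length ?As \<longrightarrow> cinner x (etensor fs h) = 0) \<longrightarrow> blinfun_apply C x = 0)"
  let ?C = "l2_restrict (listset Ss) B"
  have tens: "blinfun_apply ?C (etensor fs h) = etensor (map2 blinfun_apply ?As fs) (blinfun_apply B h)"
    if fs: "length fs = length ?As" for fs h
  proof (rule l2_ext)
    fix \<beta>
    show "l2_apply (blinfun_apply ?C (etensor fs h)) \<beta>
        = l2_apply (etensor (map2 blinfun_apply ?As fs) (blinfun_apply B h)) \<beta>"
    proof (cases "length \<beta> = length Ss")
      case True
      have "length \<beta> = length fs" "length fs = length Ss" using True fs by auto
      then have "prod_list (map2 l2_apply (map2 blinfun_apply ?As fs) \<beta>)
          = (if list_all2 (\<in>) \<beta> Ss then prod_list (map2 l2_apply fs \<beta>) else 0)"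
        by (induction \<beta> fs Ss rule: list_induct3) auto
      then show ?thesis
        using True fs by (simp add: l2_apply_etensor in_listset_iff bounded_opsD[OF B])
    next
      case False
      then have "\<beta> \<notin> listset Ss" by (auto simp: in_listset_iff dest: list_all2_lengthD)
      then show ?thesis using False fs by (simp add: l2_apply_etensor)
    qed
  qed
  have van: "blinfun_apply ?C x = 0"
    if x: "\<And>fs h. length fs = length ?As \<Longrightarrow> cinner x (etensor fs h) = 0" for x
  proof (rule l2_ext)
    fix \<beta>
    have "l2_apply x \<beta> = 0" if "\<beta> \<in> listset Ss"
    proof -
      have "length \<beta> = length Ss" using that by (auto simp: in_listset_iff dest: list_all2_lengthD)
      then have "cinner (l2_apply x \<beta>) h = 0" for h
        using x[of "map ket \<beta>" h] by (simp add: cinner_etensor_ket)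
      then have "cinner (l2_apply x \<beta>) (l2_apply x \<beta>) = 0" by blast
      then show ?thesis by (simp add: cinner_self)
    qed
    then show "l2_apply (blinfun_apply ?C x) \<beta> = l2_apply 0 \<beta>" by (simp add: zero_l2.rep_eq)
  qed
  have QC: "?Q ?C" using B tens van by (simp add: l2_restrict_bounded_ops)
  have uni: "C = ?C" if C: "?Q C" for C
  proof -
    define D where "D = C - ?C"
    have bD: "D \<in> bounded_ops" unfolding D_def using C QC by (intro bounded_ops_diff) auto
    have "blinfun_apply (adj D) y = 0" for y
    proof -
      let ?w = "blinfun_apply (adj D) y"
      have w: "cinner ?w (etensor fs h) = 0" if "length fs = length ?As" for fs h
      proof -
        have "blinfun_apply D (etensor fs h) = 0"
          using C tens[OF that] that by (simp add: D_def blinfun.diff_left)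
        then show ?thesis by (simp add: cinner_adj_left[OF bD])
      qed
      have "blinfun_apply C ?w = 0" using C w by blast
      moreover have "blinfun_apply ?C ?w = 0" by (rule van) (rule w)
      ultimately have "blinfun_apply D ?w = 0" by (simp add: D_def blinfun.diff_left)
      then have "cinner ?w ?w = 0" by (simp add: cinner_adj_left[OF bD])
      then show ?thesis by (simp add: cinner_self)
    qed
    then have "cinner (blinfun_apply D x) y = cinner (blinfun_apply 0 x) y" for x y
      by (simp flip: cinner_adj_right[OF bD])
    then have "D = 0" by (rule blinfun_eqI_cinner)
    then show ?thesis by (simp add: D_def)
  qed
  show ?thesis unfolding tensor_op_def by (rule the_equality, rule QC, rule uni)
qed

text \<open>In the basis of kets the diagonal is the indicator of \<open>W\<close>; the basis used
  by \<open>op_trace\<close> is unspecified, so the value is carried over by the change of basis for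
  positive operators.\<close>

lemma op_trace_l2_restrict:
  assumes "finite W"
  shows "op_trace (l2_restrict W (id_blinfun :: complex \<Rightarrow>\<^sub>L complex)) = of_nat (card W)"
proof -
  let ?P = "l2_restrict W (id_blinfun :: complex \<Rightarrow>\<^sub>L complex)"
  let ?E = "SOME E :: ('a, complex) l2 set. is_onb E"
  have E: "is_onb ?E" by (rule someI[of is_onb]) (rule is_onb_ket)
  have "cinner (blinfun_apply ?P x) y = cinner x (blinfun_apply ?P y)" for x y
    unfolding cinner_l2.rep_eq by (intro infsum_cong) simp
  moreover have "0 \<le> inner (blinfun_apply ?P x) x" for x
    unfolding inner_l2.rep_eq by (intro infsum_nonneg) simp
  ultimately have pos: "positive_op ?P"
    by (simp add: positive_op_iff hermitian_def l2_restrict_bounded_ops)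
  have val: "inner (blinfun_apply ?P (ket i)) (ket i) = (if i \<in> W then 1 else 0)" for i
    unfolding inner_eq_Re_cinner cinner_ket by (simp add: ket.rep_eq)
  have inj: "inj (ket :: 'a \<Rightarrow> _)"
    by (rule injI) (metis ket.rep_eq zero_neq_one)
  have "((\<lambda>i. if i \<in> W then 1 else 0 :: real) has_sum (\<Sum>i\<in>W. 1)) W"
    by (rule has_sum_finiteI) (use assms in auto)
  then have "((\<lambda>i. if i \<in> W then 1 else 0 :: real) has_sum real (card W)) UNIV"
    by (subst has_sum_cong_neutral[where T = W and g = "\<lambda>i. if i \<in> W then 1 else 0"]) auto
  then have hs: "((\<lambda>e. inner (blinfun_apply ?P e) e) has_sum real (card W)) (range ket)"
    by (subst has_sum_reindex[OF inj]) (simp add: o_def val)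
  then have ft: "finite_trace (range ket) ?P"
    using pos has_sum_imp_summable by (auto simp: finite_trace_def)
  have "pos_trace (range ket) ?P = card W"
    unfolding pos_trace_def using hs by (rule infsumI)
  then show ?thesis
    using finite_trace_onb_change[OF is_onb_ket E ft] pos_trace_onb_change[OF is_onb_ket E ft]
    by (simp add: op_trace_eq_pos_trace)
qed

text \<open>The part of \<open>x\<close> left over by a finite set \<open>F\<close> has squared norm
  \<open>|x|^2\<close> minus the partial sum over \<open>F\<close>, so norm convergence reduces to
  convergence of a scalar series.\<close>

lemma has_sum_etensor_ket:
  assumes J: "\<And>\<beta>. \<beta> \<notin> J \<Longrightarrow> l2_apply x \<beta> = 0"
  shows "((\<lambda>\<beta>. etensor (map ket \<beta>) (l2_apply x \<beta>)) has_sum x) J"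
  unfolding has_sum_def
proof (rule tendstoI)
  fix r :: real assume r: "0 < r"
  let ?f = "\<lambda>\<beta>. (norm (l2_apply x \<beta>))\<^sup>2"
  let ?s = "\<lambda>F. \<Sum>\<beta>\<in>F. etensor (map ket \<beta>) (l2_apply x \<beta>)"
  have fs: "(?f has_sum (norm x)\<^sup>2) UNIV"
    unfolding norm_l2_square by (rule has_sum_infsum) (rule l2_norm_summable)
  then have fJ: "(?f has_sum (norm x)\<^sup>2) J"
    by (subst has_sum_cong_neutral[where T = UNIV and g = ?f]) (use J in auto)
  have diff: "(norm (x - ?s F))\<^sup>2 = (norm x)\<^sup>2 - sum ?f F" if F: "finite F" for F
  proof -
    have app: "l2_apply (?s F) \<gamma> = (if \<gamma> \<in> F then l2_apply x \<gamma> else 0)" for \<gamma>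
      using F by (induction F) (auto simp: zero_l2.rep_eq plus_l2.rep_eq etensor_ket)
    have "(?f has_sum (norm x)\<^sup>2 - sum ?f F) (UNIV - F)"
      by (rule has_sum_Diff[OF fs has_sum_finite[OF F]]) simp
    then have "((\<lambda>\<beta>. (norm (l2_apply (x - ?s F) \<beta>))\<^sup>2) has_sum (norm x)\<^sup>2 - sum ?f F) UNIV"
      by (subst has_sum_cong_neutral[where T = "UNIV - F" and g = ?f]) (auto simp: minus_l2.rep_eq app)
    then show ?thesis unfolding norm_l2_square by (rule infsumI)
  qed
  have "\<forall>\<^sub>F F in finite_subsets_at_top J. dist (sum ?f F) ((norm x)\<^sup>2) < r\<^sup>2"
    using fJ r unfolding has_sum_def by (intro tendstoD) auto
  moreover have "\<forall>\<^sub>F F in finite_subsets_at_top J. finite F \<and> F \<subseteq> J"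
    by (rule eventually_finite_subsets_at_top_weakI) auto
  ultimately show "\<forall>\<^sub>F F in finite_subsets_at_top J. dist (?s F) x < r"
  proof eventually_elim
    case (elim F)
    have "(norm (x - ?s F))\<^sup>2 < r\<^sup>2"
      using diff elim zero_le_power2[of "norm (x - ?s F)"] by (simp add: dist_real_def)
    then have "norm (x - ?s F) < r" using r by (simp add: power2_less_imp_less)
    then show ?case by (simp add: dist_norm norm_minus_commute)
  qed
qed

text \<open>The bound on finite partial sums makes \<open>h \<mapsto> (V \<beta> h)\<close> a
  contraction into the square-summable families. The infinite sum inside \<open>Blinfun\<close> is
  the coordinate expansion of that family, so the abstract operator really acts by it.\<close>

lemma l2_kernel_operator:
  fixes V :: "'i list \<Rightarrow> 'a::complex_hilbert_space \<Rightarrow>\<^sub>L 'b::complex_hilbert_space"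
  assumes V: "\<And>\<beta>. \<beta> \<in> J \<Longrightarrow> V \<beta> \<in> bounded_ops"
    and bound: "\<And>F h. finite F \<Longrightarrow> F \<subseteq> J \<Longrightarrow> (\<Sum>\<beta>\<in>F. (norm (blinfun_apply (V \<beta>) h))\<^sup>2) \<le> (norm h)\<^sup>2"
  defines "K \<equiv> Blinfun (\<lambda>h. \<Sum>\<^sub>\<infinity>\<beta>\<in>J. etensor (map ket \<beta>) (blinfun_apply (V \<beta>) h))"
  shows "K \<in> bounded_ops"
    and "l2_apply (blinfun_apply K h) \<beta> = (if \<beta> \<in> J then blinfun_apply (V \<beta>) h else 0)"
proof -
  let ?v = "\<lambda>h \<beta>. if \<beta> \<in> J then blinfun_apply (V \<beta>) h else 0"
  have bound': "(\<Sum>\<beta>\<in>F. (norm (?v h \<beta>))\<^sup>2) \<le> (norm h)\<^sup>2" if F: "finite F" for F h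
  proof -
    have "(\<Sum>\<beta>\<in>F. (norm (?v h \<beta>))\<^sup>2) = (\<Sum>\<beta>\<in>F \<inter> J. (norm (blinfun_apply (V \<beta>) h))\<^sup>2)"
      by (rule sum.mono_neutral_cong_right) (use F in auto)
    then show ?thesis using bound[of "F \<inter> J" h] F by simp
  qed
  have summ: "(\<lambda>\<beta>. (norm (?v h \<beta>))\<^sup>2) summable_on UNIV" for h
    by (rule nonneg_bdd_above_summable_on)
      (use bound' in \<open>auto simp: bdd_above_def\<close>)
  define g where "g h = Abs_l2 (?v h)" for h
  have app: "l2_apply (g h) = ?v h" for h
    unfolding g_def using summ by (intro Abs_l2_inverse) simp
  have bg: "bounded_linear g"
  proof (rule bounded_linear_intro[where K = 1])
    show "g (x + y) = g x + g y" for x y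
      by (rule l2_ext) (simp add: app plus_l2.rep_eq blinfun.add_right)
    show "g (c *\<^sub>R x) = c *\<^sub>R g x" for c x
      by (rule l2_ext) (simp add: app scaleR_l2.rep_eq blinfun.scaleR_right)
    show "norm (g x) \<le> norm x * 1" for x
    proof (rule power2_le_imp_le)
      show "(norm (g x))\<^sup>2 \<le> (norm x * 1)\<^sup>2"
        unfolding norm_l2_square app using infsum_le_finite_sums[OF summ] bound' by simp
    qed simp
  qed
  have "(\<Sum>\<^sub>\<infinity>\<beta>\<in>J. etensor (map ket \<beta>) (blinfun_apply (V \<beta>) h)) = g h" for h
  proof -
    have "((\<lambda>\<beta>. etensor (map ket \<beta>) (l2_apply (g h) \<beta>)) has_sum g h) J"
      by (rule has_sum_etensor_ket) (simp add: app)
    then have "((\<lambda>\<beta>. etensor (map ket \<beta>) (blinfun_apply (V \<beta>) h)) has_sum g h) J"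
      by (subst has_sum_cong[where g = "\<lambda>\<beta>. etensor (map ket \<beta>) (l2_apply (g h) \<beta>)"])
        (auto simp: app)
    then show ?thesis by (rule infsumI)
  qed
  then have K: "blinfun_apply K = g" unfolding K_def by (simp add: bounded_linear_Blinfun_apply bg)
  show "l2_apply (blinfun_apply K h) \<beta> = ?v h \<beta>" by (simp add: K app)
  show "K \<in> bounded_ops"
    by (intro bounded_opsI l2_ext) (simp add: K app scaleC_l2.rep_eq bounded_opsD V)
qed

lemma cinner_kernel_compression:
  assumes K: "K \<in> bounded_ops" and W: "finite W"
  shows "cinner (blinfun_apply (adj K o\<^sub>L l2_restrict W B o\<^sub>L K) h) h
    = (\<Sum>\<beta>\<in>W. cinner (blinfun_apply B (l2_apply (blinfun_apply K h) \<beta>)) (l2_apply (blinfun_apply K h) \<beta>))"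
proof -
  let ?k = "blinfun_apply K h"
  have "cinner (blinfun_apply (adj K o\<^sub>L l2_restrict W B o\<^sub>L K) h) h
      = cinner (blinfun_apply (l2_restrict W B) ?k) ?k"
    by (simp add: cinner_adj_left[OF K])
  also have "\<dots> = (\<Sum>\<^sub>\<infinity>\<beta>\<in>W. cinner (blinfun_apply B (l2_apply ?k \<beta>)) (l2_apply ?k \<beta>))"
    unfolding cinner_l2.rep_eq by (rule infsum_cong_neutral) auto
  finally show ?thesis using W by simp
qed

section \<open>Completely positive maps of a polyball\<close>

lemma comp_list_simps [simp]:
  "comp_list [] = id" "comp_list (F # Fs) = F \<circ> comp_list Fs"
  by (simp_all add: comp_list_def)

lemma cp_map_simps:
  "cp_map [] Y = 0" "cp_map (A # Xi) Y = (A o\<^sub>L Y o\<^sub>L adj A) + cp_map Xi Y"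
  by (simp_all add: cp_map_def)

lemmas compose_bilinear =
  bounded_bilinear.add_left[OF bounded_bilinear_blinfun_compose]
  bounded_bilinear.add_right[OF bounded_bilinear_blinfun_compose]
  bounded_bilinear.scaleR_left[OF bounded_bilinear_blinfun_compose]
  bounded_bilinear.scaleR_right[OF bounded_bilinear_blinfun_compose]
  bounded_bilinear.zero_left[OF bounded_bilinear_blinfun_compose]
  bounded_bilinear.zero_right[OF bounded_bilinear_blinfun_compose]

lemma linear_cp_map: "linear (cp_map Xi)"
  by (induction Xi)
    (auto intro!: linearI simp: cp_map_simps compose_bilinear linear_add linear_scale algebra_simps)

lemma linear_funpow:
  fixes f :: "'a::real_vector \<Rightarrow> 'a"
  shows "linear f \<Longrightarrow> linear (f ^^ n)"
  by (induction n) (simp_all add: linear_iff)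

lemma linear_comp_list: "(\<And>F. F \<in> set Fs \<Longrightarrow> linear F) \<Longrightarrow> linear (comp_list Fs)"
  by (induction Fs) (auto intro!: linear_compose simp: linear_id)

lemma cp_powers_simps [simp]:
  "cp_powers [] [] = id"
  "cp_powers (Ti # T) (q # qs) = (cp_map Ti ^^ q) \<circ> cp_powers T qs"
  by (simp_all add: cp_powers_def)

lemma linear_cp_powers: "linear (cp_powers T qs)"
  unfolding cp_powers_def
  by (rule linear_comp_list) (auto intro: linear_funpow linear_cp_map)

lemma cp_map_positive:
  "set Xi \<subseteq> bounded_ops \<Longrightarrow> positive_op Y \<Longrightarrow> positive_op (cp_map Xi Y)"
  by (induction Xi)
    (auto simp: cp_map_simps positive_op_def[of 0] intro!: positive_op_add positive_op_conj)

text \<open>Only \<open>A B\<close> and \<open>adj B adj A\<close> are rearranged, and the second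
  rearrangement is the adjoint of the first; \<open>A\<close> and \<open>adj B\<close> never have to
  commute.\<close>

lemma cp_map_conj_commute:
  assumes "A \<in> bounded_ops" "set Xi \<subseteq> bounded_ops" "\<And>B. B \<in> set Xi \<Longrightarrow> A o\<^sub>L B = B o\<^sub>L A"
  shows "A o\<^sub>L cp_map Xi Y o\<^sub>L adj A = cp_map Xi (A o\<^sub>L Y o\<^sub>L adj A)"
  using assms(2,3)
proof (induction Xi)
  case (Cons B Xi)
  have B: "B \<in> bounded_ops" "A o\<^sub>L B = B o\<^sub>L A" using Cons.prems by auto
  have *: "adj B o\<^sub>L adj A = adj A o\<^sub>L adj B"
    by (simp only: B assms(1) flip: adj_compose)
  have "A o\<^sub>L (B o\<^sub>L Y o\<^sub>L adj B) o\<^sub>L adj A = B o\<^sub>L (A o\<^sub>L Y o\<^sub>L adj A) o\<^sub>L adj B"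
  proof (rule blinfun_eqI)
    fix x
    have "blinfun_apply (A o\<^sub>L (B o\<^sub>L Y o\<^sub>L adj B) o\<^sub>L adj A) x
        = blinfun_apply (A o\<^sub>L B) (blinfun_apply Y (blinfun_apply (adj B o\<^sub>L adj A) x))" by simp
    then show "blinfun_apply (A o\<^sub>L (B o\<^sub>L Y o\<^sub>L adj B) o\<^sub>L adj A) x
        = blinfun_apply (B o\<^sub>L (A o\<^sub>L Y o\<^sub>L adj A) o\<^sub>L adj B) x"
      by (simp only: * B) simp
  qed
  then show ?case using Cons by (simp add: cp_map_simps compose_bilinear)
qed (simp add: cp_map_simps compose_bilinear)

lemma cp_map_commute:
  assumes "set Xi \<subseteq> bounded_ops" "set Zi \<subseteq> bounded_ops"
    "\<And>A B. A \<in> set Xi \<Longrightarrow> B \<in> set Zi \<Longrightarrow> A o\<^sub>L B = B o\<^sub>L A"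
  shows "cp_map Xi (cp_map Zi Y) = cp_map Zi (cp_map Xi Y)"
  using assms(1,3)
proof (induction Xi)
  case (Cons A Xi)
  have "cp_map Xi (cp_map Zi Y) = cp_map Zi (cp_map Xi Y)"
    using Cons.prems by (intro Cons.IH) auto
  moreover have "A o\<^sub>L cp_map Zi Y o\<^sub>L adj A = cp_map Zi (A o\<^sub>L Y o\<^sub>L adj A)"
    using Cons.prems assms(2) by (intro cp_map_conj_commute) auto
  ultimately show ?case
    by (simp add: cp_map_simps linear_add[OF linear_cp_map])
qed (simp add: cp_map_simps linear_0[OF linear_cp_map])

lemma funpow_commute:
  assumes "\<And>x. f (g x) = g (f x)"
  shows "f ((g ^^ n) x) = (g ^^ n) (f x)"
  by (induction n) (auto simp: assms)

lemma comp_list_commute: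
  assumes "\<And>F x. F \<in> set Fs \<Longrightarrow> g (F x) = F (g x)"
  shows "g (comp_list Fs x) = comp_list Fs (g x)"
  using assms by (induction Fs) auto

text \<open>A recursive form of the polyball conditions, shaped for induction over \<open>T\<close>:
  it passes to tails and provides a positive defect for every suffix.\<close>

primrec polyball_rows :: "('a::complex_hilbert_space \<Rightarrow>\<^sub>L 'a) list list \<Rightarrow> bool" where
  "polyball_rows [] \<longleftrightarrow> True"
| "polyball_rows (Ti # T) \<longleftrightarrow> set Ti \<subseteq> bounded_ops \<and> (\<forall>A\<in>set Ti. norm A \<le> 1) \<and>
    (\<forall>X\<in>set T. \<forall>A\<in>set Ti. \<forall>B\<in>set X. A o\<^sub>L B = B o\<^sub>L A) \<and>
    positive_op (defect_map (Ti # T) id_blinfun) \<and> polyball_rows T"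

lemma defect_map_simps [simp]:
  "defect_map [] Y = Y"
  "defect_map (Ti # T) Y = defect_map T Y - cp_map Ti (defect_map T Y)"
  by (simp_all add: defect_map_def)

text \<open>Positivity says that the squares \<open>|adj B x|^2\<close> over all entries
  \<open>B\<close> add up to at most \<open>|x|^2\<close>, so \<open>adj A\<close> is a contraction;
  then \<open>|A x|^2 = inner x (adj A (A x)) \<le> |x| |A x|\<close>.\<close>

lemma norm_row_entry_le:
  assumes Xi: "set Xi \<subseteq> bounded_ops" and pos: "positive_op (id_blinfun - cp_map Xi id_blinfun)"
    and A: "A \<in> set Xi"
  shows "norm A \<le> 1"
proof (rule norm_blinfun_bound)
  have quad: "inner (blinfun_apply (cp_map Zi id_blinfun) x) x
      = (\<Sum>B\<leftarrow>Zi. (norm (blinfun_apply (adj B) x))\<^sup>2)" if "set Zi \<subseteq> bounded_ops" for Zi and x :: 'a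
    using that
  proof (induction Zi)
    case (Cons B Zi)
    then have "inner (blinfun_apply B (blinfun_apply (adj B) x)) x = (norm (blinfun_apply (adj B) x))\<^sup>2"
      using cinner_adj_right[of B "blinfun_apply (adj B) x" x]
      by (simp add: power2_norm_eq_inner inner_eq_Re_cinner)
    with Cons show ?case by (simp add: cp_map_simps blinfun.add_left inner_add_left)
  qed (simp add: cp_map_simps)
  have adj_le: "norm (blinfun_apply (adj A) x) \<le> norm x" for x
  proof (rule power2_le_imp_le)
    have "(norm (blinfun_apply (adj A) x))\<^sup>2 \<le> (\<Sum>B\<leftarrow>Xi. (norm (blinfun_apply (adj B) x))\<^sup>2)"
      using A by (intro member_le_sum_list) auto
    also have "\<dots> \<le> (norm x)\<^sup>2"
      using positive_op_inner_nonneg[OF pos, of x] quad[OF Xi, of x]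
      by (simp add: blinfun.diff_left inner_diff_left power2_norm_eq_inner)
    finally show "(norm (blinfun_apply (adj A) x))\<^sup>2 \<le> (norm x)\<^sup>2" .
  qed simp
  fix x
  let ?y = "blinfun_apply A x"
  have "(norm ?y)\<^sup>2 = inner x (blinfun_apply (adj A) ?y)"
    using cinner_adj_right[of A x ?y] A Xi by (auto simp: power2_norm_eq_inner inner_eq_Re_cinner)
  also have "\<dots> \<le> norm x * norm (blinfun_apply (adj A) ?y)" by (rule norm_cauchy_schwarz)
  also have "\<dots> \<le> norm x * norm ?y" by (intro mult_left_mono adj_le) simp
  finally show "norm ?y \<le> 1 * norm x"
    by (cases "?y = 0") (simp_all add: power2_eq_square)
qed simp

text \<open>The positivity clause is read off at three kinds of exponents: a leading 0 passes to the
  tail, a 1 followed by zeros bounds the entries of the first row, and all ones give the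
  defect.\<close>

lemma regular_polyball_rows:
  "T \<in> regular_polyball ns \<Longrightarrow> polyball_rows T"
proof (induction T arbitrary: ns)
  case (Cons Ti T)
  obtain n ns' where ns: "ns = n # ns'" "length Ti = n" "map length T = ns'"
    using Cons.prems by (auto simp: regular_polyball_def)
  have ops: "\<And>X. X \<in> set (Ti # T) \<Longrightarrow> set X \<subseteq> bounded_ops"
    and comm: "\<And>s t A B. s < length (Ti # T) \<Longrightarrow> t < length (Ti # T) \<Longrightarrow> s \<noteq> t \<Longrightarrow>
      A \<in> set ((Ti # T) ! s) \<Longrightarrow> B \<in> set ((Ti # T) ! t) \<Longrightarrow> A o\<^sub>L B = B o\<^sub>L A"
    and pos: "\<And>ps. length ps = length (Ti # T) \<Longrightarrow> set ps \<subseteq> {0, 1} \<Longrightarrow>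
      positive_op (comp_list (map2 (\<lambda>p Xi. (\<lambda>Y. Y - cp_map Xi Y) ^^ p) ps (Ti # T)) id_blinfun)"
    using Cons.prems unfolding regular_polyball_def by blast+
  have "T \<in> regular_polyball ns'"
    unfolding regular_polyball_def
  proof (intro CollectI conjI allI impI ballI)
    show "map length T = ns'" by (rule ns)
    show "set Xi \<subseteq> bounded_ops" if "Xi \<in> set T" for Xi using ops that by simp
    show "A o\<^sub>L B = B o\<^sub>L A" if "s < length T" "t < length T" "s \<noteq> t" "A \<in> set (T ! s)" "B \<in> set (T ! t)"
      for s t A B using comm[of "Suc s" "Suc t" A B] that by simp
    show "positive_op (comp_list (map2 (\<lambda>p Xi. (\<lambda>Y. Y - cp_map Xi Y) ^^ p) ps T) id_blinfun)"
      if "length ps = length T \<and> set ps \<subseteq> {0, 1}" for ps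
      using pos[of "0 # ps"] that by simp
  qed
  then have rows: "polyball_rows T" by (rule Cons.IH)
  have "comp_list (map2 (\<lambda>p Xi. (\<lambda>Y. Y - cp_map Xi Y) ^^ p) (replicate (length Z) 0) Z) Y = Y"
    for Z and Y :: "'a \<Rightarrow>\<^sub>L 'a" by (induction Z) auto
  then have "positive_op (id_blinfun - cp_map Ti id_blinfun)"
    using pos[of "1 # replicate (length T) 0"] by (simp add: set_replicate_conv_if)
  then have "\<forall>A\<in>set Ti. norm A \<le> 1" using norm_row_entry_le ops by auto
  moreover have "A o\<^sub>L B = B o\<^sub>L A" if X: "X \<in> set T" and "A \<in> set Ti" "B \<in> set X" for A B X
  proof -
    obtain t where "t < length T" "T ! t = X" using X by (auto simp: in_set_conv_nth)
    then show ?thesis using comm[of 0 "Suc t" A B] that by simp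
  qed
  moreover have "comp_list (map2 (\<lambda>p Xi. (\<lambda>Y. Y - cp_map Xi Y) ^^ p) (replicate (length Z) 1) Z) Y
    = defect_map Z Y" for Z and Y :: "'a \<Rightarrow>\<^sub>L 'a" by (induction Z) auto
  then have "positive_op (defect_map (Ti # T) id_blinfun)"
    using pos[of "replicate (length (Ti # T)) 1"] by (metis length_replicate set_replicate_conv_if
        empty_subsetI insert_subset insertI1 insertI2)
  ultimately show ?case using rows ops by auto
qed simp

lemma polyball_rows_ops: "polyball_rows T \<Longrightarrow> Ti \<in> set T \<Longrightarrow> set Ti \<subseteq> bounded_ops"
  by (induction T) auto

lemma positive_op_defect: "polyball_rows T \<Longrightarrow> positive_op (defect_map T id_blinfun)"
  by (cases T) (auto simp: positive_op_iff hermitian_id)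

lemma cp_map_funpow_positive:
  "set Xi \<subseteq> bounded_ops \<Longrightarrow> positive_op Y \<Longrightarrow> positive_op ((cp_map Xi ^^ q) Y)"
  by (induction q) (auto intro: cp_map_positive)

lemma cp_powers_positive:
  assumes "polyball_rows T" "length qs = length T" "positive_op Y"
  shows "positive_op (cp_powers T qs Y)"
  using assms(2,1) by (induction qs T rule: list_induct2) (auto simp: assms(3) cp_map_funpow_positive)

lemma cp_powers_commute:
  assumes "polyball_rows (Ti # T)" "length qs = length T"
  shows "cp_map Ti (cp_powers T qs Y) = cp_powers T qs (cp_map Ti Y)"
  unfolding cp_powers_def
proof (rule comp_list_commute)
  fix F Y assume "F \<in> set (map2 (\<lambda>q Ti. cp_map Ti ^^ q) qs T)"
  then obtain q X where X: "F = cp_map X ^^ q" "X \<in> set T"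
    by (auto dest: set_zip_rightD)
  then have "set X \<subseteq> bounded_ops" using assms(1) polyball_rows_ops by auto
  then have "cp_map Ti (cp_map X Y) = cp_map X (cp_map Ti Y)" for Y
    using assms(1) X(2) unfolding polyball_rows.simps by (intro cp_map_commute) blast+
  then show "cp_map Ti (F Y) = F (cp_map Ti Y)" unfolding X(1) by (rule funpow_commute)
qed

lemma funpow_cp_powers_commute:
  assumes "polyball_rows (Ti # T)" "length qs = length T"
  shows "(cp_map Ti ^^ q) (cp_powers T qs Y) = cp_powers T qs ((cp_map Ti ^^ q) Y)"
  by (induction q) (simp_all add: cp_powers_commute[OF assms])

subsection \<open>Box sums\<close>

lemma set_Cons_image: "set_Cons A B = (\<lambda>(a, b). a # b) ` (A \<times> B)"
  by (auto simp: set_Cons_def)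

lemma sum_set_Cons:
  "(\<Sum>x\<in>set_Cons A B. f x) = (\<Sum>a\<in>A. \<Sum>b\<in>B. f (a # b))"
proof -
  have "inj_on (\<lambda>(a, b). a # b) (A \<times> B)" by (auto simp: inj_on_def)
  then show ?thesis
    by (simp add: set_Cons_image sum.reindex case_prod_unfold o_def sum.cartesian_product)
qed

lemma finite_listset: "(\<And>S. S \<in> set Ss \<Longrightarrow> finite S) \<Longrightarrow> finite (listset Ss)"
  by (induction Ss) (auto simp: set_Cons_image)

abbreviation idx_box :: "nat list \<Rightarrow> nat list set"
  where "idx_box qs \<equiv> listset (map (\<lambda>q. {..q}) qs)"

lemma in_box_iff: "ss \<in> idx_box qs \<longleftrightarrow> list_all2 (\<le>) ss qs"
  by (simp add: in_listset_iff list_all2_map2)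

definition box_defect ::
  "('a::complex_hilbert_space \<Rightarrow>\<^sub>L 'a) list list \<Rightarrow> nat list \<Rightarrow> 'a \<Rightarrow>\<^sub>L 'a"
  where "box_defect T qs = comp_list (map2 (\<lambda>q Ti Y. Y - (cp_map Ti ^^ (q + 1)) Y) qs T) id_blinfun"

lemma box_defect_simps [simp]:
  "box_defect [] [] = id_blinfun"
  "box_defect (Ti # T) (q # qs) = box_defect T qs - (cp_map Ti ^^ Suc q) (box_defect T qs)"
  by (simp_all add: box_defect_def del: funpow.simps)

text \<open>The head factor telescopes: \<open>C - \<Phi>^(q+1) C\<close> is the sum of
  \<open>\<Phi>^s (C - \<Phi> C)\<close> over \<open>s \<le> q\<close>. By induction
  \<open>C\<close> is the box sum of the tail, and because \<open>\<Phi>\<close> commutes with the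
  tail powers, \<open>C - \<Phi> C\<close> is the same sum with the defect of the longer
  tuple.\<close>

lemma box_defect_eq_sum:
  assumes "length qs = length T" "polyball_rows T"
  shows "box_defect T qs = (\<Sum>ss\<in>idx_box qs. cp_powers T ss (defect_map T id_blinfun))"
  using assms
proof (induction qs T rule: list_induct2)
  case (Cons q qs Ti T)
  let ?\<Phi> = "cp_map Ti" and ?C = "box_defect T qs" and ?D = "defect_map T id_blinfun"
  have lin: "linear (?\<Phi> ^^ s)" for s by (intro linear_funpow linear_cp_map)
  have "box_defect (Ti # T) (q # qs) = (\<Sum>s\<le>q. (?\<Phi> ^^ s) ?C - (?\<Phi> ^^ Suc s) ?C)"
    by (subst sum_telescope) simp
  also have "\<dots> = (\<Sum>s\<le>q. (?\<Phi> ^^ s) (?C - ?\<Phi> ?C))"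
    by (simp add: linear_diff[OF lin] funpow_swap1)
  also have "?C - ?\<Phi> ?C = (\<Sum>ss\<in>idx_box qs. cp_powers T ss (defect_map (Ti # T) id_blinfun))"
  proof -
    have "length ss = length T" if "ss \<in> idx_box qs" for ss
      using that Cons.hyps by (auto simp: in_box_iff dest: list_all2_lengthD)
    then have "cp_map Ti (cp_powers T ss ?D) = cp_powers T ss (cp_map Ti ?D)" if "ss \<in> idx_box qs" for ss
      using that Cons.prems by (intro cp_powers_commute)
    then show ?thesis
      using Cons.prems
      by (simp add: Cons.IH linear_sum[OF linear_cp_map] linear_diff[OF linear_cp_powers]
          sum_subtractf)
  qed
  finally show ?case
    by (simp only: linear_sum[OF lin] list.map listset.simps sum_set_Cons cp_powers_simps o_apply)
qed simp

text \<open>Positivity comes from the box sum; the upper bound holds since every further factor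
  subtracts a positive operator. The bound is uniform in \<open>qs\<close>, which later makes the
  Berezin kernel a contraction.\<close>

lemma box_defect_bounds:
  assumes "length qs = length T" "polyball_rows T"
  shows "positive_op (box_defect T qs)"
    and "inner (blinfun_apply (box_defect T qs) x) x \<le> (norm x)\<^sup>2"
proof -
  \<comment> \<open>Stated for an arbitrary tuple, because the induction below applies it to the
    tail.\<close>
  have pos: "positive_op (box_defect T qs)" if "length qs = length T" "polyball_rows T" for T :: "('a \<Rightarrow>\<^sub>L 'a) list list" and qs
  proof -
    have "positive_op (cp_powers T ss (defect_map T id_blinfun))" if "ss \<in> idx_box qs" for ss
      using that \<open>length qs = length T\<close> \<open>polyball_rows T\<close>
      by (intro cp_powers_positive positive_op_defect) (auto simp: in_box_iff dest: list_all2_lengthD)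
    moreover have "positive_op (\<Sum>i\<in>I. f i)" if "\<And>i. i \<in> I \<Longrightarrow> positive_op (f i)" for I and f :: "nat list \<Rightarrow> 'a \<Rightarrow>\<^sub>L 'a"
      using that by (induction I rule: infinite_finite_induct) (auto simp: positive_op_add positive_op_def[of 0])
    ultimately show ?thesis by (simp add: box_defect_eq_sum that)
  qed
  then show "positive_op (box_defect T qs)" using assms .
  show "inner (blinfun_apply (box_defect T qs) x) x \<le> (norm x)\<^sup>2"
    using assms
  proof (induction qs T rule: list_induct2)
    case Nil
    then show ?case by (simp add: power2_norm_eq_inner)
  next
    case (Cons q qs Ti T)
    have "positive_op ((cp_map Ti ^^ Suc q) (box_defect T qs))"
      using Cons by (intro cp_map_funpow_positive pos) auto
    from positive_op_inner_nonneg[OF this, of x] show ?case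
      using Cons by (simp add: blinfun.diff_left inner_diff_left del: funpow.simps)
  qed
qed

subsection \<open>Monotonicity of the traces\<close>

lemma finite_trace_cp_map:
  assumes "is_onb E" "finite_trace E Y" "set Xi \<subseteq> bounded_ops" "\<forall>A\<in>set Xi. norm A \<le> 1"
  shows "finite_trace E (cp_map Xi Y) \<and> pos_trace E (cp_map Xi Y) \<le> length Xi * pos_trace E Y"
  using assms(3,4)
proof (induction Xi)
  case (Cons A Xi)
  have "finite_trace E (A o\<^sub>L Y o\<^sub>L adj A)" "pos_trace E (A o\<^sub>L Y o\<^sub>L adj A) \<le> pos_trace E Y"
    using Cons.prems by (auto intro!: finite_trace_conj pos_trace_conj_le assms(1,2))
  then show ?case
    using Cons by (simp add: cp_map_simps finite_trace_add pos_trace_add algebra_simps)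
qed (simp add: cp_map_simps finite_trace_zero)

lemma finite_trace_funpow:
  assumes "is_onb E" "finite_trace E Y" "set Xi \<subseteq> bounded_ops" "\<forall>A\<in>set Xi. norm A \<le> 1"
  shows "finite_trace E ((cp_map Xi ^^ q) Y)
    \<and> pos_trace E ((cp_map Xi ^^ q) Y) \<le> real (length Xi) ^ q * pos_trace E Y"
proof (induction q)
  case (Suc q)
  have "pos_trace E (cp_map Xi ((cp_map Xi ^^ q) Y)) \<le> length Xi * pos_trace E ((cp_map Xi ^^ q) Y)"
    using finite_trace_cp_map[OF assms(1) _ assms(3,4)] Suc by blast
  also have "\<dots> \<le> length Xi * (real (length Xi) ^ q * pos_trace E Y)"
    using Suc by (intro mult_left_mono) auto
  finally show ?case
    using finite_trace_cp_map[OF assms(1) _ assms(3,4)] Suc by (simp add: mult.assoc)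
qed (use assms in auto)

lemma finite_trace_cp_powers:
  assumes "is_onb E" "length qs = length T" "polyball_rows T" "finite_trace E Y"
  shows "finite_trace E (cp_powers T qs Y)"
  using assms(2,3)
  by (induction qs T rule: list_induct2) (auto simp: assms(1,4) finite_trace_funpow)

text \<open>The normaliser \<open>n_1^(q_1) ... n_k^(q_k)\<close>, which is also the rank of the
  tensor product of the homogeneous projections.\<close>

definition word_count :: "'b list list \<Rightarrow> nat list \<Rightarrow> nat"
  where "word_count T qs = prod_list (map2 (\<lambda>Ti q. length Ti ^ q) T qs)"

lemma word_count_simps [simp]:
  "word_count [] [] = 1" "word_count (Ti # T) (q # qs) = length Ti ^ q * word_count T qs"
  by (simp_all add: word_count_def)

lemma word_count_pos:
  assumes "\<forall>Ti\<in>set T. Ti \<noteq> []" "length qs = length T"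
  shows "word_count T qs > 0"
  using assms(2,1) by (induction qs T rule: list_induct2) auto

text \<open>Raising the head exponent from \<open>q\<close> to \<open>r\<close> costs at most the
  factor \<open>n^(r-q)\<close>, exactly what the normaliser gains. The operator \<open>Y\<close> is
  arbitrary in the induction so that \<open>\<Phi>^q Y\<close> can take its place in the
  tail.\<close>

lemma pos_trace_cp_powers_antimono:
  assumes E: "is_onb E" and "list_all2 (\<le>) qs rs" "length qs = length T" "polyball_rows T"
    "\<forall>Ti\<in>set T. Ti \<noteq> []" "finite_trace E Y"
  shows "pos_trace E (cp_powers T rs Y) / word_count T rs \<le> pos_trace E (cp_powers T qs Y) / word_count T qs"
  using assms(2-)
proof (induction qs rs arbitrary: T Y rule: list_all2_induct)
  case (Cons q qs r rs)
  obtain Ti T' where T: "T = Ti # T'" using Cons.prems(1) by (cases T) auto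
  have len: "length qs = length T'" "length rs = length T'"
    using Cons T by (auto dest: list_all2_lengthD)
  have row: "set Ti \<subseteq> bounded_ops" "\<forall>A\<in>set Ti. norm A \<le> 1" "polyball_rows T'" "polyball_rows (Ti # T')"
    using Cons.prems(2) unfolding T polyball_rows.simps by blast+
  have n: "length Ti > 0" using Cons.prems(3) T by simp
  let ?n = "real (length Ti)" and ?c = "real (word_count T' rs)"
  let ?Z = "(cp_map Ti ^^ q) Y"
  have c: "?c > 0" using word_count_pos[OF _ len(2)] Cons.prems(3) T by simp
  have Z: "finite_trace E ?Z" using finite_trace_funpow[OF E Cons.prems(4) row(1,2)] by blast
  \<comment> \<open>The part \<open>\<Phi>^q\<close> of the head power moves innermost, leaving
    \<open>\<Phi>^(r-q)\<close> outside to be estimated.\<close>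
  have "pos_trace E (cp_powers T (r # rs) Y) = pos_trace E ((cp_map Ti ^^ (r - q)) (cp_powers T' rs ?Z))"
    using funpow_cp_powers_commute[OF row(4) len(2)] Cons.hyps(1)
    by (simp add: T) (metis funpow_add le_add_diff_inverse2 o_apply)
  also have "\<dots> \<le> ?n ^ (r - q) * pos_trace E (cp_powers T' rs ?Z)"
    using finite_trace_funpow[OF E finite_trace_cp_powers[OF E len(2) row(3) Z] row(1,2)] by blast
  finally have "pos_trace E (cp_powers T (r # rs) Y) / (?n ^ r * ?c)
      \<le> ?n ^ (r - q) * pos_trace E (cp_powers T' rs ?Z) / (?n ^ r * ?c)"
    using n c by (intro divide_right_mono) auto
  also have "\<dots> = (pos_trace E (cp_powers T' rs ?Z) / ?c) / ?n ^ q"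
    using n Cons.hyps(1) by (simp add: power_diff field_simps)
  also have "\<dots> \<le> (pos_trace E (cp_powers T' qs ?Z) / word_count T' qs) / ?n ^ q"
    using n Cons.prems(3) T by (intro divide_right_mono Cons.IH len row Z) auto
  also have "\<dots> = pos_trace E (cp_powers T (q # qs) Y) / word_count T (q # qs)"
    using funpow_cp_powers_commute[OF row(4) len(1)] by (simp add: T mult.commute)
  finally show ?case by (simp add: T)
qed simp

section \<open>The Berezin kernel\<close>

abbreviation words :: "nat \<Rightarrow> nat \<Rightarrow> nat list set"
  where "words n q \<equiv> {\<alpha> \<in> lists {..<n}. length \<alpha> = q}"

definition word_tuples :: "'b list list \<Rightarrow> nat list \<Rightarrow> nat list list set"
  where "word_tuples T qs = listset (map2 (\<lambda>Ti q. words (length Ti) q) T qs)"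

text \<open>The product of adjoint words that stands behind the square root of the defect in the
  Berezin kernel.\<close>

definition row_word ::
  "('a::complex_hilbert_space \<Rightarrow>\<^sub>L 'a) list list \<Rightarrow> nat list list \<Rightarrow> 'a \<Rightarrow>\<^sub>L 'a"
  where "row_word T \<beta> = foldr (o\<^sub>L) (map2 (\<lambda>Ti \<alpha>. adj (word_op Ti \<alpha>)) T \<beta>) id_blinfun"

abbreviation all_word_tuples :: "'b list list \<Rightarrow> nat list list set"
  where "all_word_tuples T \<equiv> listset (map (\<lambda>Ti. lists {..<length Ti}) T)"

section \<open>Words and word tuples graded by length\<close>

lemma finite_words: "finite (words n q)"
  using finite_lists_length_eq[of "{..<n}" q] by (simp add: lists_eq_set)

lemma words_0: "words n 0 = {[]}"
  by auto

lemma words_Suc: "words n (Suc q) = set_Cons {..<n} (words n q)"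
  by (auto simp: set_Cons_def length_Suc_conv)

lemma card_words: "card (words n q) = n ^ q"
  using card_lists_length_eq[of "{..<n}" q] by (simp add: lists_eq_set)

lemma word_tuples_simps [simp]:
  "word_tuples [] [] = {[]}"
  "word_tuples (Ti # T) (q # qs) = set_Cons (words (length Ti) q) (word_tuples T qs)"
  by (simp_all add: word_tuples_def)

lemma finite_word_tuples: "finite (word_tuples T qs)"
  unfolding word_tuples_def by (rule finite_listset) (auto simp: finite_words)

lemma card_word_tuples: "length qs = length T \<Longrightarrow> card (word_tuples T qs) = word_count T qs"
proof (induction qs T rule: list_induct2)
  case (Cons q qs Ti T)
  then show ?case
    using sum_set_Cons[of "\<lambda>_. 1::nat" "words (length Ti) q" "word_tuples T qs"]
    by (simp add: card_words del: mem_Collect_eq)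
qed simp

text \<open>The sets \<open>word_tuples T qs\<close> thus partition all word tuples by degree, which
  allows finite sums to be regrouped.\<close>

lemma in_word_tuples_iff:
  "length qs = length T \<Longrightarrow>
    \<beta> \<in> word_tuples T qs \<longleftrightarrow> \<beta> \<in> all_word_tuples T \<and> map length \<beta> = qs"
  by (induction qs T arbitrary: \<beta> rule: list_induct2) (auto simp: set_Cons_def)

lemma row_word_simps [simp]:
  "row_word [] [] = id_blinfun"
  "row_word (Ti # T) (\<alpha> # \<beta>) = adj (word_op Ti \<alpha>) o\<^sub>L row_word T \<beta>"
  by (simp_all add: row_word_def)

lemma word_op_simps [simp]:
  "word_op Ti [] = id_blinfun" "word_op Ti (j # \<alpha>) = Ti ! j o\<^sub>L word_op Ti \<alpha>"
  by (simp_all add: word_op_def)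

lemma word_op_bounded:
  assumes "set Ti \<subseteq> bounded_ops" "\<alpha> \<in> lists {..<length Ti}"
  shows "word_op Ti \<alpha> \<in> bounded_ops"
  using assms(2) by (induction \<alpha>) (use assms(1) in \<open>auto intro!: bounded_ops_compose\<close>)

lemma row_word_bounded:
  assumes "polyball_rows T" "\<beta> \<in> all_word_tuples T"
  shows "row_word T \<beta> \<in> bounded_ops"
  using assms
  by (induction T arbitrary: \<beta>)
    (auto simp: set_Cons_def intro!: bounded_ops_compose adj_in_bounded_ops word_op_bounded)

lemma blinfun_compose_commute2:
  assumes "A o\<^sub>L B = B o\<^sub>L A" "A o\<^sub>L C = C o\<^sub>L A"
  shows "A o\<^sub>L (B o\<^sub>L C) = (B o\<^sub>L C) o\<^sub>L A"
proof (rule blinfun_eqI)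
  fix x
  have "blinfun_apply A (blinfun_apply B y) = blinfun_apply B (blinfun_apply A y)"
    "blinfun_apply A (blinfun_apply C y) = blinfun_apply C (blinfun_apply A y)" for y
    using assms by (metis blinfun_apply_blinfun_compose)+
  then show "blinfun_apply (A o\<^sub>L (B o\<^sub>L C)) x = blinfun_apply ((B o\<^sub>L C) o\<^sub>L A) x" by simp
qed

lemma word_op_commute:
  assumes "\<And>B. B \<in> set Xi \<Longrightarrow> A o\<^sub>L B = B o\<^sub>L A" "\<alpha> \<in> lists {..<length Xi}"
  shows "A o\<^sub>L word_op Xi \<alpha> = word_op Xi \<alpha> o\<^sub>L A"
  using assms(2)
proof (induction \<alpha>)
  case (Cons j \<alpha>)
  then show ?case
    unfolding word_op_simps by (intro blinfun_compose_commute2) (auto intro: assms(1))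
qed (auto intro: blinfun_eqI)

text \<open>Expanding the form of \<open>cp_powers\<close> applies the adjoint words of the first
  row to the vector first, whereas \<open>row_word\<close> applies them last; commutation across
  rows, transferred to adjoints, reconciles the two orders.\<close>

lemma row_word_commute:
  assumes "set Ti \<subseteq> bounded_ops" "\<alpha> \<in> lists {..<length Ti}"
    "\<And>X A B. X \<in> set T \<Longrightarrow> A \<in> set Ti \<Longrightarrow> B \<in> set X \<Longrightarrow> A o\<^sub>L B = B o\<^sub>L A"
    "polyball_rows T" "\<beta> \<in> all_word_tuples T"
  shows "adj (word_op Ti \<alpha>) o\<^sub>L row_word T \<beta> = row_word T \<beta> o\<^sub>L adj (word_op Ti \<alpha>)"
  using assms(3-5)
proof (induction T arbitrary: \<beta>)
  case Nil
  then show ?case by (auto intro: blinfun_eqI)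
next
  case (Cons X T)
  obtain \<gamma> \<delta> where \<beta>: "\<beta> = \<gamma> # \<delta>" "\<gamma> \<in> lists {..<length X}" "\<delta> \<in> all_word_tuples T"
    using Cons.prems(3) by (auto simp: set_Cons_def)
  have X: "set X \<subseteq> bounded_ops" "polyball_rows T" using Cons.prems(2) by auto
  have "word_op X \<gamma> o\<^sub>L B = B o\<^sub>L word_op X \<gamma>" if "B \<in> set Ti" for B
    using Cons.prems(1) that by (intro word_op_commute[symmetric] \<beta>) auto
  then have "word_op X \<gamma> o\<^sub>L word_op Ti \<alpha> = word_op Ti \<alpha> o\<^sub>L word_op X \<gamma>"
    using assms(2) by (intro word_op_commute)
  then have "adj (word_op X \<gamma> o\<^sub>L word_op Ti \<alpha>) = adj (word_op Ti \<alpha> o\<^sub>L word_op X \<gamma>)" by simp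
  then have "adj (word_op Ti \<alpha>) o\<^sub>L adj (word_op X \<gamma>) = adj (word_op X \<gamma>) o\<^sub>L adj (word_op Ti \<alpha>)"
    by (simp add: adj_compose word_op_bounded assms X \<beta>)
  moreover have "adj (word_op Ti \<alpha>) o\<^sub>L row_word T \<delta> = row_word T \<delta> o\<^sub>L adj (word_op Ti \<alpha>)"
    using Cons.prems(1) by (intro Cons.IH X \<beta>) auto
  ultimately show ?case unfolding \<beta>(1) row_word_simps by (rule blinfun_compose_commute2)
qed

lemma inner_cp_map:
  assumes "set Xi \<subseteq> bounded_ops"
  shows "inner (blinfun_apply (cp_map Xi Y) x) x
    = (\<Sum>j<length Xi. inner (blinfun_apply Y (blinfun_apply (adj (Xi ! j)) x)) (blinfun_apply (adj (Xi ! j)) x))"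
  using assms
proof (induction Xi)
  case (Cons A Xi)
  have "inner (blinfun_apply A (blinfun_apply Y (blinfun_apply (adj A) x))) x
      = inner (blinfun_apply Y (blinfun_apply (adj A) x)) (blinfun_apply (adj A) x)"
    using Cons.prems by (simp add: inner_eq_Re_cinner cinner_adj_right)
  then show ?case
    using Cons unfolding length_Cons sum.lessThan_Suc_shift
    by (simp add: cp_map_simps blinfun.add_left inner_add_left)
qed (simp add: cp_map_simps)

text \<open>The outermost application of the map splits off the first letter of a word, since
  \<open>adj (word_op Xi (j # \<alpha>))\<close> applies \<open>adj (Xi ! j)\<close> before the
  adjoint of the remaining word.\<close>

lemma inner_cp_map_funpow:
  assumes "set Xi \<subseteq> bounded_ops"
  shows "inner (blinfun_apply ((cp_map Xi ^^ q) Y) x) x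
    = (\<Sum>\<alpha>\<in>words (length Xi) q. inner (blinfun_apply Y (blinfun_apply (adj (word_op Xi \<alpha>)) x))
        (blinfun_apply (adj (word_op Xi \<alpha>)) x))"
proof (induction q arbitrary: x)
  case 0
  then show ?case
    unfolding words_0 by (simp add: adj_hermitian hermitian_id)
next
  case (Suc q)
  have "adj (word_op Xi (j # \<alpha>)) = adj (word_op Xi \<alpha>) o\<^sub>L adj (Xi ! j)"
    if "j < length Xi" "\<alpha> \<in> words (length Xi) q" for j \<alpha>
    using that assms by (auto intro!: adj_compose word_op_bounded)
  then have "(\<Sum>\<alpha>\<in>words (length Xi) (Suc q). inner (blinfun_apply Y (blinfun_apply (adj (word_op Xi \<alpha>)) x))
        (blinfun_apply (adj (word_op Xi \<alpha>)) x))
    = (\<Sum>j<length Xi. \<Sum>\<alpha>\<in>words (length Xi) q.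
        inner (blinfun_apply Y (blinfun_apply (adj (word_op Xi \<alpha>)) (blinfun_apply (adj (Xi ! j)) x)))
        (blinfun_apply (adj (word_op Xi \<alpha>)) (blinfun_apply (adj (Xi ! j)) x)))"
    unfolding words_Suc sum_set_Cons by (intro sum.cong refl) simp
  then show ?case
    by (simp add: inner_cp_map[OF assms] Suc)
qed

lemma inner_cp_powers:
  assumes "length qs = length T" "polyball_rows T"
  shows "inner (blinfun_apply (cp_powers T qs Y) x) x
    = (\<Sum>\<beta>\<in>word_tuples T qs. inner (blinfun_apply Y (blinfun_apply (row_word T \<beta>) x))
        (blinfun_apply (row_word T \<beta>) x))"
  using assms
proof (induction qs T arbitrary: x rule: list_induct2)
  case (Cons q qs Ti T)
  have rows: "set Ti \<subseteq> bounded_ops" "polyball_rows T"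
    "\<And>X A B. X \<in> set T \<Longrightarrow> A \<in> set Ti \<Longrightarrow> B \<in> set X \<Longrightarrow> A o\<^sub>L B = B o\<^sub>L A"
    using Cons.prems unfolding polyball_rows.simps by blast+
  have comm: "blinfun_apply (row_word (Ti # T) (\<alpha> # \<beta>)) x
      = blinfun_apply (row_word T \<beta>) (blinfun_apply (adj (word_op Ti \<alpha>)) x)"
    if "\<alpha> \<in> words (length Ti) q" "\<beta> \<in> word_tuples T qs" for \<alpha> \<beta>
  proof -
    have "adj (word_op Ti \<alpha>) o\<^sub>L row_word T \<beta> = row_word T \<beta> o\<^sub>L adj (word_op Ti \<alpha>)"
      using that in_word_tuples_iff[OF Cons.hyps] by (intro row_word_commute rows) auto
    then show ?thesis by simp
  qed
  have "inner (blinfun_apply (cp_powers (Ti # T) (q # qs) Y) x) x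
      = (\<Sum>\<alpha>\<in>words (length Ti) q. \<Sum>\<beta>\<in>word_tuples T qs.
          inner (blinfun_apply Y (blinfun_apply (row_word T \<beta>) (blinfun_apply (adj (word_op Ti \<alpha>)) x)))
            (blinfun_apply (row_word T \<beta>) (blinfun_apply (adj (word_op Ti \<alpha>)) x)))"
    by (simp add: inner_cp_map_funpow[OF rows(1)] Cons.IH[OF rows(2)])
  also have "\<dots> = (\<Sum>\<beta>\<in>word_tuples (Ti # T) (q # qs). inner (blinfun_apply Y (blinfun_apply (row_word (Ti # T) \<beta>) x))
        (blinfun_apply (row_word (Ti # T) \<beta>) x))"
    unfolding word_tuples_simps sum_set_Cons by (intro sum.cong refl) (simp only: comm)
  finally show ?case .
qed simp

text \<open>The terms are nonnegative, so the sum may be enlarged to all word tuples with degrees in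
  some box. Grouped by degree, these add up to the form of \<open>box_defect\<close>, which lies
  below the identity.\<close>

lemma sum_row_word_le:
  fixes T :: "('a::complex_hilbert_space \<Rightarrow>\<^sub>L 'a) list list"
  assumes T: "polyball_rows T" and F: "finite F" "F \<subseteq> all_word_tuples T"
  defines "D \<equiv> defect_map T id_blinfun"
  shows "(\<Sum>\<beta>\<in>F. inner (blinfun_apply D (blinfun_apply (row_word T \<beta>) x)) (blinfun_apply (row_word T \<beta>) x))
    \<le> (norm x)\<^sup>2"
proof -
  let ?f = "\<lambda>\<beta>. inner (blinfun_apply D (blinfun_apply (row_word T \<beta>) x)) (blinfun_apply (row_word T \<beta>) x)"
  \<comment> \<open>The total number of letters occurring in \<open>F\<close> is a crude but
    sufficient bound for the length of each word in it.\<close>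
  define N where "N = (\<Sum>\<beta>\<in>F. \<Sum>\<alpha>\<leftarrow>\<beta>. length \<alpha>)"
  define Ns where "Ns = replicate (length T) N"
  have len: "length Ns = length T" by (simp add: Ns_def)
  have len': "length ss = length T" if "ss \<in> idx_box Ns" for ss
    using that len by (auto simp: in_box_iff dest: list_all2_lengthD)
  have lenF: "length \<beta> = length T" if "\<beta> \<in> F" for \<beta>
    using subsetD[OF F(2) that] by (auto simp: in_listset_iff dest: list_all2_lengthD)
  have box: "map length \<beta> \<in> idx_box Ns" if \<beta>: "\<beta> \<in> F" for \<beta>
  proof -
    have "length \<alpha> \<le> N" if "\<alpha> \<in> set \<beta>" for \<alpha>
    proof -
      have "length \<alpha> \<le> (\<Sum>\<alpha>\<leftarrow>\<beta>. length \<alpha>)" using that by (intro member_le_sum_list) auto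
      also have "\<dots> \<le> N" unfolding N_def using F(1) \<beta> by (intro member_le_sum) auto
      finally show ?thesis .
    qed
    then show ?thesis
      unfolding in_box_iff Ns_def list_all2_conv_all_nth by (simp add: lenF[OF \<beta>])
  qed
  have "F \<subseteq> (\<Union>ss\<in>idx_box Ns. word_tuples T ss)"
  proof
    fix \<beta> assume \<beta>: "\<beta> \<in> F"
    have "\<beta> \<in> word_tuples T (map length \<beta>)"
      using F(2) \<beta> lenF[OF \<beta>] by (subst in_word_tuples_iff) auto
    then show "\<beta> \<in> (\<Union>ss\<in>idx_box Ns. word_tuples T ss)" using box[OF \<beta>] by blast
  qed
  moreover have fin: "finite (idx_box Ns)" by (rule finite_listset) auto
  moreover have nn: "0 \<le> ?f \<beta>" for \<beta>
    unfolding D_def by (intro positive_op_inner_nonneg positive_op_defect T)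
  ultimately have "(\<Sum>\<beta>\<in>F. ?f \<beta>) \<le> (\<Sum>\<beta>\<in>(\<Union>ss\<in>idx_box Ns. word_tuples T ss). ?f \<beta>)"
    by (intro sum_mono2) (auto simp: finite_word_tuples)
  also have "\<dots> = (\<Sum>ss\<in>idx_box Ns. \<Sum>\<beta>\<in>word_tuples T ss. ?f \<beta>)"
    by (rule sum.UNION_disjoint[OF fin]) (auto simp: finite_word_tuples in_word_tuples_iff len')
  also have "\<dots> = (\<Sum>ss\<in>idx_box Ns. inner (blinfun_apply (cp_powers T ss D) x) x)"
    by (intro sum.cong refl) (simp add: inner_cp_powers T len')
  also have "\<dots> = inner (blinfun_apply (box_defect T Ns) x) x"
    by (simp add: box_defect_eq_sum[OF len T] D_def blinfun.sum_left inner_sum_left)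
  also have "\<dots> \<le> (norm x)\<^sup>2" by (rule box_defect_bounds(2)[OF len T])
  finally show ?thesis .
qed

text \<open>The general kernel construction applies with
  \<open>V \<beta> = S o row_word T \<beta>\<close>, because \<open>|S y|^2\<close> is the form of
  the defect at \<open>y\<close>.\<close>

lemma berezin_kernel_apply:
  assumes T: "polyball_rows T"
  defines "S \<equiv> op_sqrt (defect_map T id_blinfun)"
  shows "berezin_kernel T \<in> bounded_ops"
    and "l2_apply (blinfun_apply (berezin_kernel T) h) \<beta>
      = (if \<beta> \<in> all_word_tuples T then blinfun_apply S (blinfun_apply (row_word T \<beta>) h) else 0)"
proof -
  let ?V = "\<lambda>\<beta>. S o\<^sub>L row_word T \<beta>"
  note D = positive_op_defect[OF T]
  have V: "?V \<beta> \<in> bounded_ops" if "\<beta> \<in> all_word_tuples T" for \<beta>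
    unfolding S_def using that
    by (intro bounded_ops_compose row_word_bounded T positive_op_bounded_ops op_sqrt_positive D)
  have bound: "(\<Sum>\<beta>\<in>F. (norm (blinfun_apply (?V \<beta>) h))\<^sup>2) \<le> (norm h)\<^sup>2"
    if "finite F" "F \<subseteq> all_word_tuples T" for F h
    using sum_row_word_le[OF T that, of h] by (simp add: S_def inner_op_sqrt[OF D])
  have K: "berezin_kernel T = Blinfun (\<lambda>h. \<Sum>\<^sub>\<infinity>\<beta>\<in>all_word_tuples T. etensor (map ket \<beta>) (blinfun_apply (?V \<beta>) h))"
    by (simp add: berezin_kernel_def S_def row_word_def)
  show "berezin_kernel T \<in> bounded_ops"
    unfolding K by (rule l2_kernel_operator(1)[OF V bound])
  show "l2_apply (blinfun_apply (berezin_kernel T) h) \<beta>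
      = (if \<beta> \<in> all_word_tuples T then blinfun_apply S (blinfun_apply (row_word T \<beta>) h) else 0)"
    unfolding K by (subst l2_kernel_operator(2)[OF V bound]) auto
qed

text \<open>The defect space is built from the range of \<open>D\<close>, but the kernel takes
  values in the range of its square root \<open>S\<close>. The residual
  \<open>z = S x - P (S x)\<close> is orthogonal to \<open>D z\<close>, so
  \<open>|S z|^2 = 0\<close>; hence \<open>z\<close> is orthogonal to \<open>S x\<close>, to its
  projection, and to itself.\<close>

lemma proj_closure_range_sqrt:
  assumes D: "positive_op D"
  defines "P \<equiv> proj_onto (closure (range (blinfun_apply D)))"
  shows "P \<in> bounded_ops" "blinfun_apply P (blinfun_apply (op_sqrt D) x) = blinfun_apply (op_sqrt D) x"
proof -
  let ?M = "closure (range (blinfun_apply D))"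
  let ?S = "op_sqrt D"
  have "complex_vector.subspace (range (blinfun_apply D))"
  proof (rule complex_vector.subspaceI)
    show "0 \<in> range (blinfun_apply D)" by (rule range_eqI[of _ _ 0]) simp
  qed (auto simp flip: blinfun.add_right bounded_opsD[OF positive_op_bounded_ops[OF D]])
  then have M: "complex_vector.subspace ?M" "closed ?M" by (simp_all add: complex_subspace_closure)
  show bP: "P \<in> bounded_ops" unfolding P_def by (rule proj_onto_props(1)[OF M])
  have S: "hermitian ?S" by (intro positive_op_hermitian op_sqrt_positive D)
  let ?z = "blinfun_apply ?S x - blinfun_apply P (blinfun_apply ?S x)"
  have orth: "cinner ?z y = 0" if "y \<in> ?M" for y
    unfolding P_def by (rule proj_onto_props(3)[OF M that])
  have "blinfun_apply D ?z \<in> ?M" by (rule subsetD[OF closure_subset rangeI])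
  then have "cinner ?z (blinfun_apply D ?z) = 0" by (rule orth)
  then have "inner (blinfun_apply D ?z) ?z = 0"
    by (metis inner_commute inner_eq_Re_cinner zero_complex.sel(1))
  then have "blinfun_apply ?S ?z = 0" by (simp add: inner_op_sqrt[OF D])
  then have "cinner ?z (blinfun_apply ?S x) = 0"
    using S by (metis hermitian_def cinner_zero_left)
  moreover have "cinner ?z (blinfun_apply P (blinfun_apply ?S x)) = 0"
    unfolding P_def by (rule orth[unfolded P_def]) (rule proj_onto_props(2)[OF M])
  ultimately have "cinner ?z ?z = 0" by (simp only: cinner_diff_right) simp
  then show "blinfun_apply P (blinfun_apply ?S x) = blinfun_apply ?S x" by (simp add: cinner_self)
qed

lemma tensor_op_fock_proj:
  assumes "B \<in> bounded_ops"
  shows "tensor_op (map2 (\<lambda>Ti q. fock_proj (length Ti) q) T qs) B = l2_restrict (word_tuples T qs) B"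
proof -
  have "map2 (\<lambda>Ti q. fock_proj (length Ti) q) T qs
      = map (\<lambda>S. l2_restrict S id_blinfun) (map2 (\<lambda>Ti q. words (length Ti) q) T qs)"
    by (simp add: fock_proj_eq case_prod_unfold)
  then show ?thesis by (simp only: tensor_op_restrict[OF assms] word_tuples_def)
qed

text \<open>Only diagonal entries enter \<open>op_trace\<close>, so the trace of the compression is
  compared through quadratic forms alone.\<close>

lemma op_trace_cong:
  "(\<And>x. cinner (blinfun_apply A x) x = cinner (blinfun_apply B x) x) \<Longrightarrow> op_trace A = op_trace B"
  by (simp add: op_trace_def)

text \<open>The component of the kernel at a word tuple is fixed by the projection onto the defect
  space, so its contribution is its squared norm, a value of the form of the defect. Adding over
  word tuples of degree \<open>qs\<close> gives the form of \<open>cp_powers\<close>.\<close>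

lemma op_trace_berezin_compression:
  assumes T: "polyball_rows T" and len: "length qs = length T"
  shows "op_trace (adj (berezin_kernel T) o\<^sub>L
      tensor_op (map2 (\<lambda>Ti q. fock_proj (length Ti) q) T qs) (proj_onto (defect_space T)) o\<^sub>L
      berezin_kernel T) = op_trace (cp_powers T qs (defect_map T id_blinfun))"
proof (rule op_trace_cong)
  fix x
  let ?D = "defect_map T id_blinfun"
  note D = positive_op_defect[OF T]
  note P = proj_closure_range_sqrt[OF D, folded defect_space_def]
  have S: "cinner (blinfun_apply (op_sqrt ?D) y) (blinfun_apply (op_sqrt ?D) y)
      = of_real (inner (blinfun_apply ?D y) y)" for y
    by (simp add: cinner_self inner_op_sqrt[OF D])
  have "cinner (blinfun_apply (adj (berezin_kernel T) o\<^sub>L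
      tensor_op (map2 (\<lambda>Ti q. fock_proj (length Ti) q) T qs) (proj_onto (defect_space T)) o\<^sub>L
      berezin_kernel T) x) x
    = (\<Sum>\<beta>\<in>word_tuples T qs. of_real (inner (blinfun_apply ?D (blinfun_apply (row_word T \<beta>) x))
        (blinfun_apply (row_word T \<beta>) x)))"
    unfolding tensor_op_fock_proj[OF P(1)]
      cinner_kernel_compression[OF berezin_kernel_apply(1)[OF T] finite_word_tuples]
    by (intro sum.cong refl) (simp add: berezin_kernel_apply(2)[OF T] in_word_tuples_iff len P(2) S)
  also have "\<dots> = of_real (inner (blinfun_apply (cp_powers T qs ?D) x) x)"
    by (simp add: inner_cp_powers[OF len T])
  also have "\<dots> = cinner (blinfun_apply (cp_powers T qs ?D) x) x"
    by (rule cinner_positive_op[symmetric]) (rule cp_powers_positive[OF T len D])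
  finally show "cinner (blinfun_apply (adj (berezin_kernel T) o\<^sub>L
      tensor_op (map2 (\<lambda>Ti q. fock_proj (length Ti) q) T qs) (proj_onto (defect_space T)) o\<^sub>L
      berezin_kernel T) x) x = cinner (blinfun_apply (cp_powers T qs ?D) x) x" .
qed

lemma op_trace_fock_proj:
  assumes "length qs = length T"
  shows "op_trace (tensor_op (map2 (\<lambda>Ti q. fock_proj (length Ti) q) T qs)
    (id_blinfun :: complex \<Rightarrow>\<^sub>L complex)) = of_nat (word_count T qs)"
  by (simp add: tensor_op_fock_proj op_trace_l2_restrict finite_word_tuples card_word_tuples assms)

section \<open>Limits of coordinatewise decreasing families\<close>

definition decreasing_family :: "nat \<Rightarrow> (nat list \<Rightarrow> real) \<Rightarrow> bool"
  where "decreasing_family k f \<longleftrightarrow> (\<forall>qs. length qs = k \<longrightarrow> 0 \<le> f qs) \<and>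
    (\<forall>qs rs. length qs = k \<longrightarrow> list_all2 (\<le>) qs rs \<longrightarrow> f rs \<le> f qs)"

text \<open>The common value of all the limits in the theorem, once \<open>f\<close> is the family
  of normalised traces.\<close>

definition family_inf :: "nat \<Rightarrow> (nat list \<Rightarrow> real) \<Rightarrow> real"
  where "family_inf k f = Inf (f ` {qs. length qs = k})"

lemma family_inf_le:
  assumes "decreasing_family k f" "length qs = k"
  shows "family_inf k f \<le> f qs"
  unfolding family_inf_def
  by (rule cInf_lower) (use assms in \<open>auto simp: decreasing_family_def bdd_below_def\<close>)

lemma family_inf_approx:
  assumes "decreasing_family k f" "0 < e"
  obtains N where "length N = k" "\<And>qs. list_all2 (\<le>) N qs \<Longrightarrow> f qs < family_inf k f + e"
proof -
  have "f ` {qs. length qs = k} \<noteq> {}"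
    by (auto intro: exI[of _ "replicate k 0"])
  moreover have "family_inf k f < family_inf k f + e" using assms(2) by simp
  ultimately have "\<exists>y\<in>f ` {qs. length qs = k}. y < family_inf k f + e"
    unfolding family_inf_def by (rule cInf_lessD)
  then obtain N where N: "length N = k" "f N < family_inf k f + e" by blast
  have "f qs < family_inf k f + e" if "list_all2 (\<le>) N qs" for qs
  proof -
    have "f qs \<le> f N" using assms(1) N(1) that unfolding decreasing_family_def by blast
    then show ?thesis using N(2) by simp
  qed
  then show ?thesis using N that by blast
qed

lemma family_tendsto_multi_at_top:
  assumes "decreasing_family k f"
  shows "(f \<longlongrightarrow> family_inf k f) (multi_at_top k)"
proof (rule tendstoI)
  fix e :: real assume "0 < e"
  then obtain N where N: "length N = k" "\<And>qs. list_all2 (\<le>) N qs \<Longrightarrow> f qs < family_inf k f + e"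
    using family_inf_approx[OF assms] by blast
  show "\<forall>\<^sub>F qs in multi_at_top k. dist (f qs) (family_inf k f) < e"
    unfolding multi_at_top_def
  proof (rule eventually_INF1[of N])
    have "dist (f qs) (family_inf k f) < e" if "length qs = k" "list_all2 (\<le>) N qs" for qs
      using N(2)[OF that(2)] family_inf_le[OF assms that(1)] by (simp add: dist_real_def)
    then show "\<forall>\<^sub>F qs in principal {qs. length qs = k \<and> list_all2 (\<le>) N qs}.
        dist (f qs) (family_inf k f) < e"
      by (simp add: eventually_principal)
  qed (use N in simp)
qed

subsection \<open>Averages over simplices\<close>

text \<open>Points with all coordinates at least \<open>c\<close> carry asymptotically the whole
  mass of \<open>A m\<close>. There \<open>f\<close> is within \<open>e / 2\<close> of its infimum,
  and elsewhere it is at most its value at the origin. The sets are left general to cover both the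
  solid simplices and their faces.\<close>

lemma average_tendsto_family_inf:
  assumes f: "decreasing_family k f"
    and A: "\<And>m. finite (A m)" "\<And>m. A m \<noteq> {}" "\<And>m. A m \<subseteq> {qs. length qs = k}"
    and good: "\<And>c. (\<lambda>m. real (card {qs \<in> A m. \<forall>q\<in>set qs. c \<le> q}) / card (A m)) \<longlonglongrightarrow> 1"
  shows "(\<lambda>m. (\<Sum>qs\<in>A m. f qs) / card (A m)) \<longlonglongrightarrow> family_inf k f"
proof (rule tendstoI)
  fix e :: real assume "0 < e"
  then have e2: "0 < e / 2" by simp
  let ?L = "family_inf k f"
  obtain N where N: "length N = k" "\<And>qs. list_all2 (\<le>) N qs \<Longrightarrow> f qs < ?L + e / 2"
    using family_inf_approx[OF f e2] by blast
  \<comment> \<open>One threshold for all coordinates; the inserted 0 keeps \<open>Max\<close>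
    meaningful when \<open>k = 0\<close>.\<close>
  define c where "c = Max (insert 0 (set N))"
  define b where "b = f (replicate k 0)"
  define G where "G m = {qs \<in> A m. \<forall>q\<in>set qs. c \<le> q}" for m
  define g where "g m = real (card (G m)) / card (A m)" for m
  have fb: "f qs \<le> b" if "length qs = k" for qs
    using f that unfolding decreasing_family_def b_def
    by (auto simp: list_all2_conv_all_nth)
  have fG: "f qs < ?L + e / 2" if "qs \<in> G m" for qs m
  proof (rule N(2))
    have qs: "length qs = k" "\<And>q. q \<in> set qs \<Longrightarrow> c \<le> q" using that A(3) by (auto simp: G_def)
    have Nc: "x \<le> c" if "x \<in> set N" for x unfolding c_def using that by (intro Max_ge) auto
    have "N ! i \<le> qs ! i" if "i < k" for i
      using Nc[of "N ! i"] qs(2)[of "qs ! i"] qs(1) N(1) that by simp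
    then show "list_all2 (\<le>) N qs" by (simp add: list_all2_conv_all_nth N(1) qs(1))
  qed
  \<comment> \<open>The estimate obtained is \<open>g (L + e/2) + (1 - g) b\<close>; adding
    \<open>(e/2) (1 - g)\<close> leaves \<open>(b - L) (1 - g)\<close> as the only term depending on
    \<open>m\<close>.\<close>
  have bound: "(\<Sum>qs\<in>A m. f qs) / card (A m) \<le> ?L + e / 2 + (b - ?L) * (1 - g m)" for m
  proof -
    have GA: "G m \<subseteq> A m" by (auto simp: G_def)
    have cA: "real (card (A m)) > 0" using A by (simp add: card_gt_0_iff)
    have "(\<Sum>qs\<in>A m. f qs) = (\<Sum>qs\<in>G m. f qs) + (\<Sum>qs\<in>A m - G m. f qs)"
      using sum.subset_diff[OF GA A(1)] by (simp add: add.commute)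
    also have "\<dots> \<le> (\<Sum>qs\<in>G m. ?L + e / 2) + (\<Sum>qs\<in>A m - G m. b)"
      using A(3) by (intro add_mono sum_mono fb less_imp_le[OF fG]) auto
    also have "\<dots> = card (G m) * (?L + e / 2) + (card (A m) - card (G m)) * b"
      using GA A(1) by (simp add: card_Diff_subset finite_subset)
    also have "\<dots> = card (G m) * (?L + e / 2) + (real (card (A m)) - card (G m)) * b"
      using card_mono[OF A(1) GA] by (simp add: of_nat_diff)
    finally have "(\<Sum>qs\<in>A m. f qs) / card (A m)
        \<le> (card (G m) * (?L + e / 2) + (real (card (A m)) - card (G m)) * b) / card (A m)"
      by (rule divide_right_mono) simp
    also have "\<dots> = g m * (?L + e / 2) + (1 - g m) * b"
      using cA by (simp add: g_def add_divide_distrib diff_divide_distrib left_diff_distrib)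
    finally have "(\<Sum>qs\<in>A m. f qs) / card (A m) \<le> g m * (?L + e / 2) + (1 - g m) * b" .
    moreover have "g m \<le> 1" using cA card_mono[OF A(1) GA] by (simp add: g_def)
    then have "0 \<le> (e / 2) * (1 - g m)" using e2 by (intro mult_nonneg_nonneg) auto
    then have "g m * (?L + e / 2) + (1 - g m) * b \<le> ?L + e / 2 + (b - ?L) * (1 - g m)"
      by (simp add: algebra_simps)
    ultimately show ?thesis by linarith
  qed
  have lower: "?L \<le> (\<Sum>qs\<in>A m. f qs) / card (A m)" for m
  proof -
    have "(\<Sum>qs\<in>A m. ?L) \<le> (\<Sum>qs\<in>A m. f qs)"
      using A(3) by (intro sum_mono family_inf_le[OF f]) auto
    then show ?thesis using A by (simp add: card_gt_0_iff field_simps)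
  qed
  have "(\<lambda>m. (b - ?L) * (1 - g m)) \<longlonglongrightarrow> (b - ?L) * (1 - 1)"
    unfolding g_def G_def by (intro tendsto_intros good)
  then have "\<forall>\<^sub>F m in sequentially. (b - ?L) * (1 - g m) < e / 2"
    using e2 by (intro order_tendstoD(2)[where a = "e / 2"]) auto
  then show "\<forall>\<^sub>F m in sequentially. dist ((\<Sum>qs\<in>A m. f qs) / card (A m)) ?L < e"
  proof eventually_elim
    case (elim m)
    then show ?case using bound[of m] lower[of m] by (simp add: dist_real_def)
  qed
qed

text \<open>Passing from \<open>r\<close> to \<open>r + 1\<close> multiplies the quotient by
  \<open>(m + r + 1) / (m + d + r + 1)\<close>, that is by \<open>1 - d / (m + d + r + 1)\<close>,
  which tends to 1.\<close>

lemma binomial_ratio_tendsto: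
  "(\<lambda>m. real ((m + r) choose r) / real ((m + d + r) choose r)) \<longlonglongrightarrow> 1"
proof (induction r)
  case (Suc r)
  have step: "real (Suc n choose Suc r) = real (Suc n) * real (n choose r) / real (Suc r)" for n
    using Suc_times_binomial[of r n] by (simp add: field_simps del: of_nat_Suc binomial_Suc_Suc flip: of_nat_mult)
  have "(\<lambda>m. 1 - real d / real (m + (d + r + 1))) \<longlonglongrightarrow> 1 - 0"
    by (intro tendsto_intros LIMSEQ_ignore_initial_segment[OF lim_const_over_n])
  then have "(\<lambda>m. real ((m + r) choose r) / real ((m + d + r) choose r)
      * (1 - real d / real (m + (d + r + 1)))) \<longlonglongrightarrow> 1 * (1 - 0)"
    by (intro tendsto_mult Suc)
  moreover have "real ((m + r) choose r) / real ((m + d + r) choose r) * (1 - real d / real (m + (d + r + 1)))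
      = real ((m + Suc r) choose Suc r) / real ((m + d + Suc r) choose Suc r)" for m
  proof -
    have "1 - real d / real (m + (d + r + 1)) = real (Suc (m + r)) / real (Suc (m + d + r))"
      by (simp add: field_simps)
    then show ?thesis
      by (simp only: add_Suc_right step) (simp add: mult.commute)
  qed
  ultimately show ?case by simp
qed simp

section \<open>Counting lattice points of simplices and their faces\<close>

lemma finite_sum_list_le: "finite {qs :: nat list. length qs = k \<and> sum_list qs \<le> m}"
proof (rule finite_subset)
  show "{qs :: nat list. length qs = k \<and> sum_list qs \<le> m} \<subseteq> {qs. set qs \<subseteq> {..m} \<and> length qs = k}"
    using member_le_sum_list by (fastforce intro: order_trans)
qed (simp add: finite_lists_length_eq)

lemma card_sum_list_eq:
  assumes "1 \<le> k"
  shows "card {qs :: nat list. length qs = k \<and> sum_list qs = m} = (m + k - 1) choose (k - 1)"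
proof -
  have "(m + k - 1) choose m = (m + k - 1) choose (m + k - 1 - m)"
    by (rule binomial_symmetric) (use assms in simp)
  then show ?thesis using assms by (simp add: card_length_sum_list)
qed

text \<open>Prefixing the slack \<open>m - sum_list qs\<close> turns the inequality into an equation
  in one more coordinate.\<close>

lemma card_sum_list_le:
  "card {qs :: nat list. length qs = k \<and> sum_list qs \<le> m} = (m + k) choose k"
proof -
  let ?A = "{qs :: nat list. length qs = k \<and> sum_list qs \<le> m}"
  have "(\<lambda>qs. (m - sum_list qs) # qs) ` ?A = {qs. length qs = Suc k \<and> sum_list qs = m}"
    by (force simp: length_Suc_conv image_iff)
  moreover have "card ((\<lambda>qs. (m - sum_list qs) # qs) ` ?A) = card ?A"
    by (rule card_image) (auto simp: inj_on_def)
  ultimately have "card ?A = card {qs :: nat list. length qs = Suc k \<and> sum_list qs = m}"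
    by (simp only:)
  then show ?thesis by (simp add: card_sum_list_eq)
qed

text \<open>Subtracting \<open>c\<close> from every coordinate lowers the sum by
  \<open>k * c\<close>. The predicate \<open>P\<close> lets one bijection serve the condition with
  \<open>\<le>\<close> and the one with \<open>=\<close>.\<close>

lemma card_shifted_lists:
  fixes P :: "nat \<Rightarrow> bool" and c k :: nat
  shows "card {qs :: nat list. length qs = k \<and> P (sum_list qs) \<and> (\<forall>q\<in>set qs. c \<le> q)}
    = card {qs :: nat list. length qs = k \<and> P (sum_list qs + k * c)}"
proof -
  let ?B = "{qs :: nat list. length qs = k \<and> P (sum_list qs + k * c)}"
  have s: "sum_list (map (\<lambda>q. q + c) qs) = sum_list qs + length qs * c" for qs :: "nat list"
    by (induction qs) auto
  have "map (\<lambda>q. q + c) ` ?B = {qs. length qs = k \<and> P (sum_list qs) \<and> (\<forall>q\<in>set qs. c \<le> q)}"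
  proof (intro equalityI subsetI)
    fix qs assume qs: "qs \<in> {qs. length qs = k \<and> P (sum_list qs) \<and> (\<forall>q\<in>set qs. c \<le> q)}"
    then have "qs = map (\<lambda>q. q + c) (map (\<lambda>q. q - c) qs)" by (auto intro!: nth_equalityI)
    moreover from this have "map (\<lambda>q. q - c) qs \<in> ?B"
      using qs s[of "map (\<lambda>q. q - c) qs"] by auto
    ultimately show "qs \<in> map (\<lambda>q. q + c) ` ?B" by (rule image_eqI)
  qed (auto simp: s)
  moreover have "card (map (\<lambda>q. q + c) ` ?B) = card ?B"
    by (rule card_image, rule inj_on_subset[OF inj_mapI]) (auto simp: inj_def)
  ultimately show ?thesis by (simp only:)
qed

lemma simplex_average_tendsto:
  assumes f: "decreasing_family k f"
  shows "(\<lambda>m. (\<Sum>qs | length qs = k \<and> sum_list qs \<le> m. f qs) / real ((m + k) choose k)) \<longlonglongrightarrow> family_inf k f"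
proof -
  let ?A = "\<lambda>m. {qs :: nat list. length qs = k \<and> sum_list qs \<le> m}"
  have "(\<lambda>m. (\<Sum>qs\<in>?A m. f qs) / card (?A m)) \<longlonglongrightarrow> family_inf k f"
  proof (rule average_tendsto_family_inf[OF f finite_sum_list_le])
    show "?A m \<noteq> {}" for m by (auto intro: exI[of _ "replicate k 0"] simp: sum_list_replicate)
    fix c
    \<comment> \<open>At index \<open>m + k * c\<close> the shift leaves exactly the simplex of size
      \<open>m\<close>, so no truncated subtraction arises; \<open>LIMSEQ_offset\<close> then
      discards the first \<open>k * c\<close> indices.\<close>
    have "card {qs \<in> ?A (m + k * c). \<forall>q\<in>set qs. c \<le> q} = (m + k) choose k" for m
      using card_shifted_lists[of k "\<lambda>s. s \<le> m + k * c" c] by (simp add: card_sum_list_le conj_assoc)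
    then have "(\<lambda>m. real (card {qs \<in> ?A (m + k * c). \<forall>q\<in>set qs. c \<le> q}) / card (?A (m + k * c))) \<longlonglongrightarrow> 1"
      using binomial_ratio_tendsto[of k "k * c"] by (simp only: card_sum_list_le)
    then show "(\<lambda>m. real (card {qs \<in> ?A m. \<forall>q\<in>set qs. c \<le> q}) / card (?A m)) \<longlonglongrightarrow> 1"
      by (rule LIMSEQ_offset)
  qed auto
  then show ?thesis by (simp only: card_sum_list_le)
qed

lemma simplex_face_average_tendsto:
  assumes f: "decreasing_family k f" and k: "1 \<le> k"
  shows "(\<lambda>m. (\<Sum>qs | length qs = k \<and> sum_list qs = m. f qs) / real ((m + k - 1) choose (k - 1))) \<longlonglongrightarrow> family_inf k f"
proof -
  let ?A = "\<lambda>m. {qs :: nat list. length qs = k \<and> sum_list qs = m}"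
  have "(\<lambda>m. (\<Sum>qs\<in>?A m. f qs) / card (?A m)) \<longlonglongrightarrow> family_inf k f"
  proof (rule average_tendsto_family_inf[OF f])
    show "finite (?A m)" for m
      by (rule finite_subset[OF _ finite_sum_list_le[of k m]]) auto
    show "?A m \<noteq> {}" for m
    proof -
      have "m # replicate (k - 1) 0 \<in> ?A m" using k by (simp add: sum_list_replicate)
      then show ?thesis by blast
    qed
    fix c
    have "card {qs \<in> ?A (m + k * c). \<forall>q\<in>set qs. c \<le> q} = (m + (k - 1)) choose (k - 1)" for m
      using card_shifted_lists[of k "\<lambda>s. s = m + k * c" c] k by (simp add: card_sum_list_eq conj_assoc)
    moreover have "card (?A (m + k * c)) = (m + k * c + (k - 1)) choose (k - 1)" for m
      using k by (simp add: card_sum_list_eq)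
    ultimately have "(\<lambda>m. real (card {qs \<in> ?A (m + k * c). \<forall>q\<in>set qs. c \<le> q}) / card (?A (m + k * c))) \<longlonglongrightarrow> 1"
      using binomial_ratio_tendsto[of "k - 1" "k * c"] by (simp only:)
    then show "(\<lambda>m. real (card {qs \<in> ?A m. \<forall>q\<in>set qs. c \<le> q}) / card (?A m)) \<longlonglongrightarrow> 1"
      by (rule LIMSEQ_offset)
  qed auto
  then show ?thesis by (simp only: card_sum_list_eq[OF k])
qed

subsection \<open>Iterated limits of weighted averages\<close>

lemma has_iterated_lim_cong:
  assumes "\<And>qs. length qs = k \<Longrightarrow> f qs = g qs" "has_iterated_lim k f L"
  shows "has_iterated_lim k g L"
  using assms
proof (induction k arbitrary: f g L)
  case (Suc k)
  from Suc.prems(2) obtain h where h: "\<And>q. has_iterated_lim k (\<lambda>qs. f (q # qs)) (h q)" "h \<longlonglongrightarrow> L"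
    by auto
  have "has_iterated_lim k (\<lambda>qs. g (q # qs)) (h q)" for q
    by (rule Suc.IH[OF _ h(1)]) (simp add: Suc.prems(1))
  then show ?case using h(2) by auto
qed simp

text \<open>Needed with the outer index held fixed: an average over \<open>s \<le> q\<close> of
  inner families is then a finite combination with constant weights.\<close>

lemma has_iterated_lim_sum:
  fixes f :: "'i \<Rightarrow> nat list \<Rightarrow> real"
  assumes "\<And>i. i \<in> I \<Longrightarrow> has_iterated_lim k (f i) (L i)"
  shows "has_iterated_lim k (\<lambda>qs. \<Sum>i\<in>I. c i * f i qs) (\<Sum>i\<in>I. c i * L i)"
  using assms
proof (induction k arbitrary: f L)
  case (Suc k)
  have "\<forall>i\<in>I. \<exists>h. (\<forall>q. has_iterated_lim k (\<lambda>qs. f i (q # qs)) (h q)) \<and> h \<longlonglongrightarrow> L i"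
    using Suc.prems by simp
  then obtain h where h: "\<And>i q. i \<in> I \<Longrightarrow> has_iterated_lim k (\<lambda>qs. f i (q # qs)) (h i q)"
    "\<And>i. i \<in> I \<Longrightarrow> h i \<longlonglongrightarrow> L i"
    using bchoice[of I "\<lambda>i h. (\<forall>q. has_iterated_lim k (\<lambda>qs. f i (q # qs)) (h q)) \<and> h \<longlonglongrightarrow> L i"] by blast
  have "has_iterated_lim k (\<lambda>qs. \<Sum>i\<in>I. c i * f i (q # qs)) (\<Sum>i\<in>I. c i * h i q)" for q
    by (rule Suc.IH) (rule h(1))
  moreover have "(\<lambda>q. \<Sum>i\<in>I. c i * h i q) \<longlonglongrightarrow> (\<Sum>i\<in>I. c i * L i)"
    by (intro tendsto_sum tendsto_mult tendsto_const h(2))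
  ultimately show ?case
    unfolding has_iterated_lim.simps by (intro exI[of _ "\<lambda>q. \<Sum>i\<in>I. c i * h i q"] conjI allI)
qed simp

lemma has_iterated_lim_of_real:
  "has_iterated_lim k f L \<Longrightarrow>
    has_iterated_lim k (\<lambda>qs. of_real (f qs) :: 'a::real_normed_div_algebra) (of_real L)"
proof (induction k arbitrary: f L)
  case (Suc k)
  from Suc.prems obtain h where h: "\<And>q. has_iterated_lim k (\<lambda>qs. f (q # qs)) (h q)" "h \<longlonglongrightarrow> L"
    by auto
  have "(\<lambda>q. of_real (h q) :: 'a) \<longlonglongrightarrow> of_real L" by (intro tendsto_of_real h)
  then show ?case
    unfolding has_iterated_lim.simps using Suc.IH[OF h(1)]
    by (intro exI[of _ "\<lambda>q. of_real (h q)"] conjI allI)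
qed simp

text \<open>A Cesaro argument: weights of at least 1 have divergent total, so the contribution of
  the finitely many early terms is divided away. The bound 1 covers the constant weights of the case
  \<open>n = 1\<close>.\<close>

lemma weighted_average_tendsto:
  fixes w x :: "nat \<Rightarrow> real"
  assumes w: "\<And>s. 1 \<le> w s" and x: "x \<longlonglongrightarrow> L"
  shows "(\<lambda>q. (\<Sum>s\<le>q. w s * x s) / (\<Sum>s\<le>q. w s)) \<longlonglongrightarrow> L"
proof (rule tendstoI)
  fix e :: real assume e: "0 < e"
  then obtain M where M: "\<And>s. M \<le> s \<Longrightarrow> norm (x s - L) < e / 2"
    using LIMSEQ_D[OF x, of "e / 2"] by auto
  let ?W = "\<lambda>q. \<Sum>s\<le>q. w s"
  define C where "C = (\<Sum>s<M. w s * \<bar>x s - L\<bar>)"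
  have w0: "0 \<le> w s" for s using w[of s] by simp
  have Wq: "real q \<le> ?W q" for q
  proof -
    have "(\<Sum>s\<le>q. 1) \<le> ?W q" by (intro sum_mono w)
    then show ?thesis by simp
  qed
  have W0: "0 < ?W q" for q
    using sum_pos[of "{..q}" w] w by (force intro: less_le_trans[OF zero_less_one])
  have bound: "\<bar>(\<Sum>s\<le>q. w s * x s) / ?W q - L\<bar> \<le> C / ?W q + e / 2" for q
  proof -
    have "(\<Sum>s\<le>q. w s * x s) / ?W q - L = (\<Sum>s\<le>q. w s * (x s - L)) / ?W q"
      using W0[of q] by (simp add: field_simps sum_subtractf sum_distrib_left sum_distrib_right)
    also have "\<bar>\<dots>\<bar> \<le> (\<Sum>s\<le>q. w s * \<bar>x s - L\<bar>) / ?W q"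
      using W0[of q] sum_abs[of "\<lambda>s. w s * (x s - L)" "{..q}"]
      by (simp add: abs_mult w0 divide_right_mono)
    also have "(\<Sum>s\<le>q. w s * \<bar>x s - L\<bar>) \<le> C + e / 2 * ?W q"
    proof -
      have "(\<Sum>s\<le>q. w s * \<bar>x s - L\<bar>)
          \<le> (\<Sum>s\<le>q. (if s < M then w s * \<bar>x s - L\<bar> else 0) + e / 2 * w s)"
      proof (rule sum_mono)
        fix s
        show "w s * \<bar>x s - L\<bar> \<le> (if s < M then w s * \<bar>x s - L\<bar> else 0) + e / 2 * w s"
        proof (cases "s < M")
          case True
          then show ?thesis using e w0[of s] by simp
        next
          case False
          then have "\<bar>x s - L\<bar> \<le> e / 2" using M[of s] by simp
          from mult_left_mono[OF this w0[of s]] show ?thesis using False by (simp add: mult.commute)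
        qed
      qed
      also have "\<dots> = (\<Sum>s\<in>{..q} \<inter> {..<M}. w s * \<bar>x s - L\<bar>) + e / 2 * ?W q"
        by (simp add: sum.distrib sum_distrib_left sum.If_cases lessThan_def)
      also have "\<dots> \<le> C + e / 2 * ?W q"
        unfolding C_def by (intro add_right_mono sum_mono2) (auto simp: w0)
      finally show ?thesis .
    qed
    finally show ?thesis using W0[of q] by (simp add: field_simps)
  qed
  have "filterlim ?W at_top sequentially"
    by (rule filterlim_at_top_mono[OF filterlim_real_sequentially]) (simp add: Wq)
  then have "(\<lambda>q. C / ?W q) \<longlonglongrightarrow> 0"
    by (intro real_tendsto_divide_at_top[OF tendsto_const])
  then have "\<forall>\<^sub>F q in sequentially. C / ?W q < e / 2"
    using e by (intro order_tendstoD(2)) auto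
  then show "\<forall>\<^sub>F q in sequentially. dist ((\<Sum>s\<le>q. w s * x s) / ?W q) L < e"
  proof eventually_elim
    case (elim q)
    then show ?case unfolding dist_real_def using bound[of q] by linarith
  qed
qed

lemma decreasing_family_Cons:
  "decreasing_family (Suc k) f \<Longrightarrow> decreasing_family k (\<lambda>qs. f (s # qs))"
  by (auto simp: decreasing_family_def)

text \<open>A near-minimal list \<open>s0 # N'\<close> bounds the infimum of every slice with
  \<open>s0 \<le> s\<close> from above, by monotonicity in the head; no slice goes below the global
  infimum.\<close>

lemma family_inf_Cons_tendsto:
  assumes f: "decreasing_family (Suc k) f"
  shows "(\<lambda>s. family_inf k (\<lambda>qs. f (s # qs))) \<longlonglongrightarrow> family_inf (Suc k) f"
proof (rule tendstoI)
  fix e :: real assume "0 < e"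
  let ?L = "family_inf (Suc k) f"
  obtain N where N: "length N = Suc k" "\<And>qs. list_all2 (\<le>) N qs \<Longrightarrow> f qs < ?L + e"
    using family_inf_approx[OF f \<open>0 < e\<close>] by blast
  obtain s0 N' where N': "N = s0 # N'" "length N' = k" using N(1) by (auto simp: length_Suc_conv)
  have "dist (family_inf k (\<lambda>qs. f (s # qs))) ?L < e" if "s0 \<le> s" for s
  proof -
    have "family_inf k (\<lambda>qs. f (s # qs)) \<le> f (s # N')"
      by (rule family_inf_le[OF decreasing_family_Cons[OF f] N'(2)])
    also have "\<dots> < ?L + e"
      using that by (intro N(2)) (simp add: N' list.rel_refl)
    finally have "family_inf k (\<lambda>qs. f (s # qs)) < ?L + e" .
    moreover have "?L \<le> family_inf k (\<lambda>qs. f (s # qs))"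
    proof (rule ccontr)
      assume "\<not> ?L \<le> family_inf k (\<lambda>qs. f (s # qs))"
      then have pos: "0 < ?L - family_inf k (\<lambda>qs. f (s # qs))" by simp
      obtain M where "length M = k" "f (s # M) < ?L"
        using family_inf_approx[OF decreasing_family_Cons[OF f, of s] pos]
        by (metis add_diff_cancel_left' diff_add_cancel add.commute list.rel_refl order_refl)
      then show False using family_inf_le[OF f, of "s # M"] by simp
    qed
    ultimately show ?thesis by (simp add: dist_real_def)
  qed
  then show "\<forall>\<^sub>F s in sequentially. dist (family_inf k (\<lambda>qs. f (s # qs))) ?L < e"
    unfolding eventually_sequentially by blast
qed

text \<open>Box and weights factor, so the average is an outer average over the head index of inner
  averages over slices. By induction the inner iterated limits are the infima of the slices, which
  converge to the global infimum, and so do their weighted averages.\<close>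

lemma weighted_box_average_iterated_lim:
  assumes "decreasing_family (length ns) f" "\<forall>n\<in>set ns. 1 \<le> n"
  shows "has_iterated_lim (length ns)
    (\<lambda>qs. (\<Sum>ss\<in>idx_box qs. real (prod_list (map2 (^) ns ss)) * f ss)
      / real (prod_list (map2 (\<lambda>n q. \<Sum>s\<le>q. n ^ s) ns qs))) (family_inf (length ns) f)"
  using assms
proof (induction ns arbitrary: f)
  case Nil
  then show ?case by (simp add: family_inf_def)
next
  case (Cons n ns)
  let ?k = "length ns"
  let ?G = "\<lambda>f qs. (\<Sum>ss\<in>idx_box qs. real (prod_list (map2 (^) ns ss)) * f ss)
      / real (prod_list (map2 (\<lambda>n q. \<Sum>s\<le>q. n ^ s) ns qs))"
  let ?L = "\<lambda>s. family_inf ?k (\<lambda>qs. f (s # qs))"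
  let ?W = "\<lambda>q. \<Sum>s\<le>q. real n ^ s"
  have f: "decreasing_family (Suc ?k) f" using Cons.prems by simp
  have "has_iterated_lim ?k (?G (\<lambda>ss. f (s # ss))) (?L s)" for s
    using Cons.prems by (intro Cons.IH decreasing_family_Cons f) auto
  then have "has_iterated_lim ?k (\<lambda>qs. \<Sum>s\<le>q. (real n ^ s / ?W q) * ?G (\<lambda>ss. f (s # ss)) qs)
      (\<Sum>s\<le>q. (real n ^ s / ?W q) * ?L s)" for q
    by (intro has_iterated_lim_sum)
  moreover have "(\<Sum>s\<le>q. (real n ^ s / ?W q) * ?G (\<lambda>ss. f (s # ss)) qs)
    = (\<Sum>ss\<in>idx_box (q # qs). real (prod_list (map2 (^) (n # ns) ss)) * f ss)
      / real (prod_list (map2 (\<lambda>n q. \<Sum>s\<le>q. n ^ s) (n # ns) (q # qs)))" for q qs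
    by (simp add: sum_set_Cons sum_distrib_left sum_distrib_right sum_divide_distrib mult_ac)
  moreover have "(\<lambda>q. \<Sum>s\<le>q. (real n ^ s / ?W q) * ?L s) \<longlonglongrightarrow> family_inf (Suc ?k) f"
  proof -
    have "1 \<le> real n ^ s" for s using Cons.prems(2) by (simp add: one_le_power)
    then have "(\<lambda>q. (\<Sum>s\<le>q. real n ^ s * ?L s) / ?W q) \<longlonglongrightarrow> family_inf (Suc ?k) f"
      by (intro weighted_average_tendsto family_inf_Cons_tendsto f)
    then show ?thesis by (simp add: sum_divide_distrib)
  qed
  ultimately show ?case
    unfolding length_Cons has_iterated_lim.simps
    by (intro exI[of _ "\<lambda>q. \<Sum>s\<le>q. (real n ^ s / ?W q) * ?L s"]) simp
qed

section \<open>The curvature\<close>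

theorem corollary1p4:
  fixes T :: "('h::complex_hilbert_space \<Rightarrow>\<^sub>L 'h) list list" and ns :: "nat list" and k :: nat
  assumes "1 \<le> k" and "length ns = k" and "\<forall>n\<in>set ns. 1 \<le> n"
    and "T \<in> regular_polyball ns"
    and "trace_class_defect T"
  shows
    "((\<lambda>m. 1 / of_nat ((m + k) choose k) *
        (\<Sum>qs | length qs = k \<and> sum_list qs \<le> m.
          1 / of_nat (prod_list (map2 (^) ns qs)) *
          op_trace (cp_powers T qs (defect_map T id_blinfun))))
      \<longlonglongrightarrow> curvature T) \<and>
    ((\<lambda>m. 1 / of_nat ((m + k - 1) choose (k - 1)) *
        (\<Sum>qs | length qs = k \<and> sum_list qs = m.
          1 / of_nat (prod_list (map2 (^) ns qs)) *
          op_trace (cp_powers T qs (defect_map T id_blinfun))))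
      \<longlonglongrightarrow> curvature T) \<and>
    has_iterated_lim k
      (\<lambda>qs. op_trace (comp_list (map2 (\<lambda>q Ti Y. Y - (cp_map Ti ^^ (q + 1)) Y) qs T) id_blinfun) /
        of_nat (prod_list (map2 (\<lambda>n q. \<Sum>s\<le>q. n ^ s) ns qs)))
      (curvature T) \<and>
    ((\<lambda>qs. 1 / of_nat (prod_list (map2 (^) ns qs)) *
        op_trace (cp_powers T qs (defect_map T id_blinfun)))
      \<longlongrightarrow> curvature T) (multi_at_top k)"
proof -
  let ?D = "defect_map T id_blinfun"
  define E where "E = (SOME E :: 'h set. is_onb E)"
  have T: "polyball_rows T" by (rule regular_polyball_rows[OF assms(4)])
  have ns: "ns = map length T" using assms(4) by (auto simp: regular_polyball_def)
  have k: "length T = k" using ns assms(2) by simp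
  have ne: "\<forall>Ti\<in>set T. Ti \<noteq> []" using assms(3) ns by fastforce
  \<comment> \<open>Trace class membership brings an orthonormal basis with it, so the choice made
    inside \<open>op_trace\<close> is a genuine basis.\<close>
  have "\<exists>E :: 'h set. is_onb E"
    using assms(5) by (auto simp: trace_class_defect_def trace_class_def)
  then have E: "is_onb E" unfolding E_def by (rule someI_ex)
  have D: "finite_trace E ?D"
    using assms(5) by (intro trace_class_finite_trace E positive_op_defect T)
      (simp add: trace_class_defect_def)
  have ft: "finite_trace E (cp_powers T qs ?D)" if "length qs = k" for qs
    using that k by (intro finite_trace_cp_powers E T D) simp
  define f where "f qs = pos_trace E (cp_powers T qs ?D) / word_count T qs" for qs
  have wc: "prod_list (map2 (^) ns qs) = word_count T qs" for qs
    by (simp add: word_count_def ns zip_map1 case_prod_unfold o_def)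
  have wc_pos: "word_count T qs > 0" if "length qs = k" for qs
    using word_count_pos[OF ne] that k by simp
  have tr: "1 / of_nat (prod_list (map2 (^) ns qs)) * op_trace (cp_powers T qs ?D) = complex_of_real (f qs)"
    if "length qs = k" for qs
    using op_trace_eq_pos_trace[OF ft[OF that, unfolded E_def]]
    by (simp add: wc f_def E_def)
  have f: "decreasing_family k f"
    unfolding decreasing_family_def
  proof (intro conjI allI impI)
    show "0 \<le> f qs" if "length qs = k" for qs
      unfolding f_def using pos_trace_nonneg[OF ft[OF that]] by simp
    show "f rs \<le> f qs" if "length qs = k" "list_all2 (\<le>) qs rs" for qs rs
      unfolding f_def using that k by (intro pos_trace_cp_powers_antimono E T ne D) auto
  qed
  have sum_tr: "(\<Sum>qs\<in>A. 1 / of_nat (prod_list (map2 (^) ns qs)) * op_trace (cp_powers T qs ?D))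
      = complex_of_real (\<Sum>qs\<in>A. f qs)" if "A \<subseteq> {qs. length qs = k}" for A
    unfolding of_real_sum by (rule sum.cong[OF refl], rule tr) (use that in blast)
  let ?L = "complex_of_real (family_inf k f)"
  have lim1: "(\<lambda>m. 1 / of_nat ((m + k) choose k) *
      (\<Sum>qs | length qs = k \<and> sum_list qs \<le> m.
        1 / of_nat (prod_list (map2 (^) ns qs)) * op_trace (cp_powers T qs ?D))) \<longlonglongrightarrow> ?L"
    using tendsto_of_real[OF simplex_average_tendsto[OF f], where ?'a = complex]
    by (subst sum_tr) auto
  \<comment> \<open>\<open>lim\<close> is a description, so its value follows from convergence;
    summand by summand the expression agrees with the first average.\<close>
  have curv: "curvature T = ?L"
    unfolding curvature_def
  proof (rule limI)
    have "op_trace (adj (berezin_kernel T) o\<^sub>L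
        tensor_op (map2 (\<lambda>Ti q. fock_proj (length Ti) q) T qs) (proj_onto (defect_space T)) o\<^sub>L
        berezin_kernel T) /
      op_trace (tensor_op (map2 (\<lambda>Ti q. fock_proj (length Ti) q) T qs)
        (id_blinfun :: complex \<Rightarrow>\<^sub>L complex))
      = 1 / of_nat (prod_list (map2 (^) ns qs)) * op_trace (cp_powers T qs ?D)"
      if "length qs = k" for qs
      using that k by (simp add: op_trace_berezin_compression[OF T] op_trace_fock_proj wc)
    then show "(\<lambda>m. 1 / of_nat ((m + length T) choose length T) *
      (\<Sum>qs | length qs = length T \<and> sum_list qs \<le> m.
        op_trace (adj (berezin_kernel T) o\<^sub>L
          tensor_op (map2 (\<lambda>Ti q. fock_proj (length Ti) q) T qs) (proj_onto (defect_space T)) o\<^sub>L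
          berezin_kernel T) /
        op_trace (tensor_op (map2 (\<lambda>Ti q. fock_proj (length Ti) q) T qs)
          (id_blinfun :: complex \<Rightarrow>\<^sub>L complex)))) \<longlonglongrightarrow> ?L"
      using lim1 by (simp add: k)
  qed
  have lim2: "(\<lambda>m. 1 / of_nat ((m + k - 1) choose (k - 1)) *
      (\<Sum>qs | length qs = k \<and> sum_list qs = m.
        1 / of_nat (prod_list (map2 (^) ns qs)) * op_trace (cp_powers T qs ?D))) \<longlonglongrightarrow> ?L"
    using tendsto_of_real[OF simplex_face_average_tendsto[OF f assms(1)], where ?'a = complex]
    by (subst sum_tr) auto
  have lim3: "has_iterated_lim k
      (\<lambda>qs. op_trace (comp_list (map2 (\<lambda>q Ti Y. Y - (cp_map Ti ^^ (q + 1)) Y) qs T) id_blinfun) /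
        of_nat (prod_list (map2 (\<lambda>n q. \<Sum>s\<le>q. n ^ s) ns qs))) ?L"
  proof (rule has_iterated_lim_cong)
    show "has_iterated_lim k (\<lambda>qs. complex_of_real ((\<Sum>ss\<in>idx_box qs. real (prod_list (map2 (^) ns ss)) * f ss)
        / real (prod_list (map2 (\<lambda>n q. \<Sum>s\<le>q. n ^ s) ns qs)))) ?L"
      using weighted_box_average_iterated_lim[of ns f] f assms(2,3)
      by (intro has_iterated_lim_of_real) simp
    fix qs :: "nat list" assume len: "length qs = k"
    have ss: "length ss = k" if "ss \<in> idx_box qs" for ss
      using that len by (auto simp: in_box_iff dest: list_all2_lengthD)
    have box: "box_defect T qs = (\<Sum>ss\<in>idx_box qs. cp_powers T ss ?D)"
      using len k by (intro box_defect_eq_sum T) simp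
    have ftb: "finite_trace E (box_defect T qs)"
      unfolding box by (intro finite_trace_sum ft ss)
    have "pos_trace E (box_defect T qs) = (\<Sum>ss\<in>idx_box qs. pos_trace E (cp_powers T ss ?D))"
      unfolding box by (intro pos_trace_sum ft ss)
    \<comment> \<open>Undoing the normalisation inside \<open>f\<close> exposes the weights
      \<open>n_1^(s_1) ... n_k^(s_k)\<close>, whose sum over the box is the denominator of the third
      formula.\<close>
    also have "\<dots> = (\<Sum>ss\<in>idx_box qs. real (prod_list (map2 (^) ns ss)) * f ss)"
    proof (rule sum.cong[OF refl])
      fix us assume "us \<in> idx_box qs"
      then have "word_count T us > 0" by (intro wc_pos ss)
      then show "pos_trace E (cp_powers T us ?D) = real (prod_list (map2 (^) ns us)) * f us"
        unfolding f_def wc by simp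
    qed
    finally have "op_trace (box_defect T qs)
        = complex_of_real (\<Sum>ss\<in>idx_box qs. real (prod_list (map2 (^) ns ss)) * f ss)"
      using op_trace_eq_pos_trace[OF ftb[unfolded E_def]] by (simp only: E_def)
    then show "complex_of_real ((\<Sum>ss\<in>idx_box qs. real (prod_list (map2 (^) ns ss)) * f ss)
        / real (prod_list (map2 (\<lambda>n q. \<Sum>s\<le>q. n ^ s) ns qs)))
      = op_trace (comp_list (map2 (\<lambda>q Ti Y. Y - (cp_map Ti ^^ (q + 1)) Y) qs T) id_blinfun) /
        of_nat (prod_list (map2 (\<lambda>n q. \<Sum>s\<le>q. n ^ s) ns qs))"
      unfolding box_defect_def by simp
  qed
  have lim4: "((\<lambda>qs. 1 / of_nat (prod_list (map2 (^) ns qs)) * op_trace (cp_powers T qs ?D))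
      \<longlongrightarrow> ?L) (multi_at_top k)"
  proof (rule Lim_transform_eventually)
    show "((\<lambda>qs. complex_of_real (f qs)) \<longlongrightarrow> ?L) (multi_at_top k)"
      by (intro tendsto_of_real family_tendsto_multi_at_top f)
    show "\<forall>\<^sub>F qs in multi_at_top k. complex_of_real (f qs)
        = 1 / of_nat (prod_list (map2 (^) ns qs)) * op_trace (cp_powers T qs ?D)"
      unfolding multi_at_top_def
    \<comment> \<open>The base sets of \<open>multi_at_top\<close> consist of lists of length
      \<open>k\<close>, the only lists for which \<open>tr\<close> applies; the zero list gives the
      largest of them.\<close>
    proof (rule eventually_INF1[of "replicate k 0"])
      show "\<forall>\<^sub>F qs in principal {qs. length qs = k \<and> list_all2 (\<le>) (replicate k 0) qs}.
          complex_of_real (f qs) = 1 / of_nat (prod_list (map2 (^) ns qs)) * op_trace (cp_powers T qs ?D)"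
        unfolding eventually_principal by (intro ballI tr[symmetric]) simp
    qed simp
  qed
  show ?thesis unfolding curv using lim1 lim2 lim3 lim4 by blast
qed

end
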